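(* Let $a,b,c$ be non-negative constants, let $M>0$ be the prescribed mass, and let $g$ be either $g(H)=H^2-1$ or $g(H)=\frac{I(H)}{H^2-1}$, with $I(H)=\frac1{16}\left[4H^4\ln H+(H^2-1)(1-3H^2)\right]$. Consider the travelling wave problem, for $V(\xi)=H^2(\xi)-1$ and $0\le\xi\le L$, $$-s\,U'+a\,U\,U'+b\,\kappa'=c\,\frac{(V\,U')'}{V}+1-\frac{U}{g(H)},\qquad -s\,V'+a(UV)'=0,$$ subject to $L$-periodic boundary conditions and the mass constraint $$\int_0^L H^2(\xi)\,d\xi=\mathcal{M}>0,\qquad \mathcal{M}=M+L.$$ Then there exist $L>0$, $s$ and $C_0\neq0$ such that this problem has at least one periodic (non-trivial) solution $(H,U)$, with $-V(s-aU)=C_0$, satisfying $$H(0)=H(L)>1,\qquad H'(0)=H'(L)=0.$$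
   Context: Here $'=d/d\xi$, $f(z)=(1+z^2)^{-1/2}$, and $\kappa=f(H')H^{-1}-f^3(H')H''$. One looks for $L$ (depending on $M$) such that $V(\xi)>0$ for $\xi\in(0,L)$ and $U$ are continuous functions. The second equation integrates to $-V(s-aU)=C_0$ for a constant $C_0$; this is the constant $C_0$ of the claim. The system arises by substituting $u(x,t)=U(\xi)$, $h(x,t)=H(\xi)$, $\xi=x-st$ (with $s$ the propagation speed), into $u_t+a(u^2/2)_x+b\kappa_x=c\frac{(vu_x)_x}{v}+1-\frac{u}{g(h)}$, $v_t+a(uv)_x=0$, where $v=h^2-1$ and $\kappa=f(h_x)h^{-1}-f^3(h_x)h_{xx}$; $M$ is the mass $\int v\,dx$ over one period.
   Formalization: Non-triviality (H non-constant) is claimed only when a>0 and b>0; if a=0 or b=0, every periodic solution with C_0≠0 has H and U constant, so there only existence of a solution with the other properties is asserted. *)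

theory Defs
  imports "HOL-Analysis.Analysis"
begin

definition slope_factor :: "real \<Rightarrow> real" where
  "slope_factor z = (1 + z\<^sup>2) powr (-1/2)"

definition curvature :: "(real \<Rightarrow> real) \<Rightarrow> real \<Rightarrow> real" where
  "curvature H \<xi> =
     slope_factor (deriv H \<xi>) * inverse (H \<xi>) - (slope_factor (deriv H \<xi>)) ^ 3 * deriv (deriv H) \<xi>"

definition film_V :: "(real \<Rightarrow> real) \<Rightarrow> real \<Rightarrow> real" where
  "film_V H \<xi> = (H \<xi>)\<^sup>2 - 1"

definition film_I :: "real \<Rightarrow> real" where
  "film_I \<eta> = (1/16) * (4 * \<eta>^4 * ln \<eta> + (\<eta>\<^sup>2 - 1) * (1 - 3 * \<eta>\<^sup>2))"

definition g_quadratic :: "real \<Rightarrow> real" where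
  "g_quadratic \<eta> = \<eta>\<^sup>2 - 1"

definition g_log :: "real \<Rightarrow> real" where
  "g_log \<eta> = film_I \<eta> / (\<eta>\<^sup>2 - 1)"

definition C_diff :: "nat \<Rightarrow> (real \<Rightarrow> real) \<Rightarrow> bool" where
  "C_diff n F \<longleftrightarrow>
     (\<forall>k<n. \<forall>\<xi>. (deriv ^^ k) F differentiable (at \<xi>)) \<and> continuous_on UNIV ((deriv ^^ n) F)"

text \<open>
  The boundary conditions on \<open>[0, L]\<close> are expressed by letting \<open>H\<close> and \<open>U\<close> be
  \<open>L\<close>-periodic functions on the whole line. The regularity clauses make all values of
  \<^const>\<open>deriv\<close> in the two equations genuine derivatives.
\<close>

definition travelling_wave ::
  "real \<Rightarrow> real \<Rightarrow> real \<Rightarrow> (real \<Rightarrow> real) \<Rightarrow> real \<Rightarrow> real \<Rightarrow>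
   (real \<Rightarrow> real) \<Rightarrow> (real \<Rightarrow> real) \<Rightarrow> bool" where
  "travelling_wave a b c g L s H U \<longleftrightarrow>
     C_diff 3 H \<and> C_diff 2 U \<and>
     (\<forall>\<xi>. H (\<xi> + L) = H \<xi>) \<and> (\<forall>\<xi>. U (\<xi> + L) = U \<xi>) \<and>
     (\<forall>\<xi>\<in>{0<..<L}. film_V H \<xi> > 0) \<and>
     (\<forall>\<xi>\<in>{0..L}.
        - s * deriv U \<xi> + a * U \<xi> * deriv U \<xi> + b * deriv (curvature H) \<xi> =
        c * (deriv (\<lambda>\<zeta>. film_V H \<zeta> * deriv U \<zeta>) \<xi> / film_V H \<xi>) + 1 - U \<xi> / g (H \<xi>)) \<and>
     (\<forall>\<xi>\<in>{0..L}.
        - s * deriv (film_V H) \<xi> + a * deriv (\<lambda>\<zeta>. U \<zeta> * film_V H \<zeta>) \<xi> = 0)"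

text \<open>
  The rest of this theory shows that for \<open>a = 0\<close> or \<open>b = 0\<close> every travelling wave with
  \<open>C\<^sub>0 \<noteq> 0\<close> is constant, so that non-triviality can only be asked for when \<open>a, b > 0\<close>.
\<close>

lemma film_I_pos:
  assumes "1 < (x::real)"
  shows "0 < film_I x"
proof -
  have J: "0 < 2 * y\<^sup>2 * ln y - y\<^sup>2 + 1" if "1 < y" for y :: real
  proof -
    have "\<exists>z>1. z < y \<and> (2 * y\<^sup>2 * ln y - y\<^sup>2 + 1) - (2 * 1\<^sup>2 * ln 1 - 1\<^sup>2 + 1)
            = (y - 1) * (4 * z * ln z)"
      using that
      by (intro MVT2) (auto intro!: derivative_eq_intros simp: field_simps power2_eq_square)
    then show ?thesis using that by auto
  qed
  have "\<exists>z>1. z < x \<and> film_I x - film_I 1 = (x - 1) * (z / 2 * (2 * z\<^sup>2 * ln z - z\<^sup>2 + 1))"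
    using assms unfolding film_I_def
    by (intro MVT2) (auto intro!: derivative_eq_intros simp: field_simps power2_eq_square power3_eq_cube power4_eq_xxxx)
  then obtain z where "1 < z" "film_I x = (x - 1) * (z / 2 * (2 * z\<^sup>2 * ln z - z\<^sup>2 + 1))"
    by (auto simp: film_I_def)
  moreover have "0 < (x - 1) * (z / 2 * (2 * z\<^sup>2 * ln z - z\<^sup>2 + 1))"
    using J[of z] assms \<open>1 < z\<close> by (intro mult_pos_pos) auto
  ultimately show ?thesis by metis
qed

lemma sq_gt_1: "1 < (x::real) \<Longrightarrow> 1 < x\<^sup>2"
  by (simp add: one_less_power)

lemma g_regular:
  assumes "g = g_quadratic \<or> g = g_log"
  shows "continuous_on {1<..} g" "\<forall>x>1. 0 < g x"
proof -
  have ne: "x\<^sup>2 - 1 \<noteq> 0" if "1 < x" for x :: real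
    using sq_gt_1[OF that] by simp
  have "continuous_on {1<..} g_quadratic" "continuous_on {1<..} g_log"
    unfolding g_quadratic_def g_log_def film_I_def
    using ne by (auto intro!: continuous_intros)
  then show "continuous_on {1<..} g" using assms by auto
  show "\<forall>x>1. 0 < g x"
    using assms film_I_pos sq_gt_1 by (auto simp: g_quadratic_def g_log_def)
qed

lemma returning_mono_deriv_zero:
  fixes F F' :: "real \<Rightarrow> real"
  assumes L: "0 < L" and D: "\<And>x. x \<in> {0..L} \<Longrightarrow> (F has_real_derivative F' x) (at x)"
    and nn: "\<And>x. x \<in> {0..L} \<Longrightarrow> 0 \<le> F' x" and eq: "F L = F 0" and x: "x \<in> {0<..<L}"
  shows "F' x = 0"
proof -
  have mono: "F u \<le> F v" if "0 \<le> u" "u \<le> v" "v \<le> L" for u v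
  proof (rule DERIV_nonneg_imp_nondecreasing[OF that(2)])
    fix x assume "u \<le> x" "x \<le> v"
    then have "x \<in> {0..L}" using that by auto
    then show "\<exists>y. (F has_real_derivative y) (at x) \<and> 0 \<le> y" using D nn by blast
  qed
  have const: "F y = F 0" if "y \<in> {0<..<L}" for y
    using mono[of 0 y] mono[of y L] eq that by auto
  have "(F has_real_derivative 0) (at x)"
    by (rule has_field_derivative_transform_within_open[where f = "\<lambda>_. F 0" and S = "{0<..<L}"])
       (use const x in \<open>auto simp: DERIV_const\<close>)
  moreover have "(F has_real_derivative F' x) (at x)" using D x by auto
  ultimately show ?thesis using DERIV_unique by blast
qed


lemma deriv_shift:
  fixes F :: "real \<Rightarrow> real"
  assumes "\<And>x. F (x + L) = F x" and "\<And>x. F differentiable (at x)"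
  shows "deriv F (x + L) = deriv F x"
proof -
  have "(F has_real_derivative deriv F (x + L)) (at (x + L))"
    using assms(2) DERIV_deriv_iff_real_differentiable by blast
  then have "((\<lambda>y. F (y + L)) has_real_derivative deriv F (x + L)) (at x)"
    by (simp add: DERIV_shift)
  then show ?thesis using assms(1) by (simp add: DERIV_imp_deriv)
qed

lemma constant_on_if_deriv_zero:
  fixes F :: "real \<Rightarrow> real"
  assumes "0 < L" and "\<And>x. F differentiable (at x)" and "\<And>x. x \<in> {0<..<L} \<Longrightarrow> deriv F x = 0"
  shows "F constant_on {0..L}"
proof -
  have D: "(F has_real_derivative deriv F x) (at x)" for x
    using assms(2) DERIV_deriv_iff_real_differentiable by blast
  then have cont: "continuous_on {0..L} F"
    by (meson DERIV_continuous_on has_field_derivative_at_within)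
  have "F x = F 0" if "x \<in> {0..L}" for x
  proof (rule DERIV_isconst2[of 0 L F x])
    fix y assume "0 < y" "y < L"
    then show "(F has_real_derivative 0) (at y)" using assms(3)[of y] D[of y] by simp
  qed (use that assms(1) cont in auto)
  then show ?thesis unfolding constant_on_def by blast
qed

lemma constant_on_if_sq_constant:
  assumes "(\<lambda>x. (H x)\<^sup>2 :: real) constant_on S" and "\<And>x. x \<in> S \<Longrightarrow> 0 < H x"
  shows "H constant_on S"
proof -
  obtain y where "\<And>x. x \<in> S \<Longrightarrow> (H x)\<^sup>2 = y"
    using assms(1) by (auto simp: constant_on_def)
  then have "H x = sqrt y" if "x \<in> S" for x
    using assms(2)[OF that] that by (metis less_imp_le real_sqrt_unique)
  then show ?thesis unfolding constant_on_def by blast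
qed

lemma degenerate_trivial:
  assumes a: "0 \<le> a" and c: "0 \<le> c" and g: "g = g_quadratic \<or> g = g_log"
    and L: "0 < L" and C0: "C\<^sub>0 \<noteq> 0" and tw: "travelling_wave a b c g L s H U"
    and flux: "\<forall>\<xi>\<in>{0..L}. - film_V H \<xi> * (s - a * U \<xi>) = C\<^sub>0"
    and H0: "H 0 = H L" "H L > 1" and deg: "a = 0 \<or> b = 0"
  shows "H constant_on {0..L} \<and> U constant_on {0..L}"
proof -
  have D: "\<And>x. H differentiable (at x)" "\<And>x. U differentiable (at x)"
      "\<And>x. deriv U differentiable (at x)"
    using tw unfolding travelling_wave_def C_diff_def
    by (force simp: numeral_eq_Suc All_less_Suc)+
  have per: "\<And>x. H (x + L) = H x" "\<And>x. U (x + L) = U x"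
    using tw unfolding travelling_wave_def by auto
  have dH: "(H has_real_derivative deriv H x) (at x)"
    and dU: "(U has_real_derivative deriv U x) (at x)"
    and ddU: "(deriv U has_real_derivative deriv (deriv U) x) (at x)" for x
    using D DERIV_deriv_iff_real_differentiable by blast+
  have per': "deriv U L = deriv U 0"
    using deriv_shift[of U L 0] per D by simp
  have contH: "continuous_on {0..L} H"
    using dH by (meson DERIV_continuous_on has_field_derivative_at_within)
  have Vpos: "0 < film_V H x" if "x \<in> {0..L}" for x
    using tw that H0 sq_gt_1[OF H0(2)] unfolding travelling_wave_def
    by (cases "x = 0 \<or> x = L") (auto simp: film_V_def)
  have H1: "1 < H x" if x: "x \<in> {0..L}" for x
  proof (rule ccontr)
    assume "\<not> 1 < H x"
    then obtain y where "0 \<le> y" "y \<le> x" "H y = 1"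
      using IVT2'[of H x 1 0] H0 x contH continuous_on_subset[of "{0..L}" H "{0..x}"] by auto
    then show False using Vpos[of y] x by (auto simp: film_V_def)
  qed
  note greg = g_regular[OF g]
  have gpos: "0 < g (H x)" if "x \<in> {0..L}" for x using H1[OF that] greg by auto
  define p where "p x = film_V H x * deriv U x" for x
  have dV: "(film_V H has_real_derivative 2 * H x * deriv H x) (at x)" for x
    unfolding film_V_def by (auto intro!: derivative_eq_intros dH)
  have dp: "(p has_real_derivative deriv p x) (at x)" for x
    unfolding p_def using DERIV_mult[OF dV ddU] DERIV_imp_deriv by metis
  have eq1: "- s * deriv U x + a * U x * deriv U x + b * deriv (curvature H) x =
      c * (deriv p x / film_V H x) + 1 - U x / g (H x)" if "x \<in> {0..L}" for x
    using tw that unfolding travelling_wave_def p_def[abs_def] by blast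
  have eq2: "- s * deriv (film_V H) x + a * deriv (\<lambda>\<zeta>. U \<zeta> * film_V H \<zeta>) x = 0"
    if "x \<in> {0..L}" for x
    using tw that unfolding travelling_wave_def by blast
  have pper: "p L = p 0" using per' H0 by (simp add: p_def film_V_def)
  show ?thesis
  proof (cases "a = 0")
    case True
    have Vs: "film_V H x * s = - C\<^sub>0" if "x \<in> {0..L}" for x
      using bspec[OF flux that] True by simp
    have s: "s \<noteq> 0" using Vs[of L] C0 L by auto
    have Hc: "H constant_on {0..L}"
    proof (rule constant_on_if_sq_constant)
      show "(\<lambda>x. (H x)\<^sup>2) constant_on {0..L}"
        unfolding constant_on_def using Vs s
        by (intro exI[of _ "1 - C\<^sub>0 / s"]) (auto simp: film_V_def field_simps)
    qed (use H1 in force)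
    then obtain r where HL: "\<And>x. x \<in> {0..L} \<Longrightarrow> H x = r"
      unfolding constant_on_def by blast
    have inn: "deriv (curvature H) x = 0 \<and> deriv p x = film_V H x * deriv (deriv U) x"
      if x: "x \<in> {0<..<L}" for x
    proof -
      have h0: "deriv H y = 0" if "y \<in> {0<..<L}" for y
      proof -
        have "(H has_real_derivative 0) (at y)"
          by (rule has_field_derivative_transform_within_open[where f = "\<lambda>_. r" and S = "{0<..<L}"])
             (use HL that in \<open>auto simp: DERIV_const\<close>)
        then show ?thesis by (rule DERIV_imp_deriv)
      qed
      have h1: "deriv (deriv H) y = 0" if "y \<in> {0<..<L}" for y
      proof -
        have "(deriv H has_real_derivative 0) (at y)"
          by (rule has_field_derivative_transform_within_open[where f = "\<lambda>_. 0" and S = "{0<..<L}"])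
             (use h0 that in \<open>auto simp: DERIV_const\<close>)
        then show ?thesis by (rule DERIV_imp_deriv)
      qed
      have "(curvature H has_real_derivative 0) (at x)"
        by (rule has_field_derivative_transform_within_open
             [where f = "\<lambda>_. slope_factor 0 * inverse r" and S = "{0<..<L}"])
           (use h0 h1 HL x in \<open>auto simp: DERIV_const curvature_def\<close>)
      moreover have "(p has_real_derivative 2 * H x * deriv H x * deriv U x
          + deriv (deriv U) x * film_V H x) (at x)"
        unfolding p_def by (rule DERIV_mult[OF dV ddU])
      ultimately show ?thesis using h0[OF x] by (simp add: DERIV_imp_deriv mult.commute)
    qed
    define G where "G = g r"
    have G: "0 < G" using gpos[of L] HL[of L] L by (simp add: G_def)
    define w where "w x = U x - G" for x
    define F where "F x = c * w x * deriv U x + s * (w x)\<^sup>2 / 2" for x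
    have dw: "(w has_real_derivative deriv U x) (at x)" for x
      unfolding w_def by (auto intro!: derivative_eq_intros dU)
    have dF: "(F has_real_derivative
        c * (deriv U x)\<^sup>2 + c * w x * deriv (deriv U) x + s * w x * deriv U x) (at x)" for x
      unfolding F_def
      by (auto intro!: derivative_eq_intros dw ddU simp: power2_eq_square algebra_simps)
    have ode: "c * deriv (deriv U) x + s * deriv U x = w x / G" if x: "x \<in> {0<..<L}" for x
    proof -
      have "- s * deriv U x = c * (deriv p x / film_V H x) + 1 - U x / g (H x)"
        using eq1[of x] x inn[OF x] True by simp
      moreover have "deriv p x / film_V H x = deriv (deriv U) x"
        using inn[OF x] Vpos[of x] x by simp
      moreover have "g (H x) = G" using HL[of x] x by (simp add: G_def)
      ultimately show ?thesis using G by (simp add: w_def field_simps)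
    qed
    have F': "c * (deriv U x)\<^sup>2 + c * w x * deriv (deriv U) x + s * w x * deriv U x
        = c * (deriv U x)\<^sup>2 + (w x)\<^sup>2 / G" if "x \<in> {0<..<L}" for x
    proof -
      have "c * w x * deriv (deriv U) x + s * w x * deriv U x
        = w x * (c * deriv (deriv U) x + s * deriv U x)" by (simp add: algebra_simps)
      also have "\<dots> = (w x)\<^sup>2 / G" using ode[OF that] by (simp add: power2_eq_square)
      finally show ?thesis by simp
    qed
    have FL: "F L = F 0" using per'[symmetric] per(2)[of 0] by (simp add: F_def w_def)
    have contF: "continuous_on {u..v} F" for u v
      by (rule DERIV_continuous_on) (rule has_field_derivative_at_within[OF dF])
    have mono: "F u \<le> F v" if "0 \<le> u" "u \<le> v" "v \<le> L" for u v
    proof (cases "u = v")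
      case False
      have "\<exists>y. (F has_real_derivative y) (at x) \<and> 0 \<le> y" if "u < x" "x < v" for x
      proof (intro exI conjI)
        show "(F has_real_derivative c * (deriv U x)\<^sup>2 + (w x)\<^sup>2 / G) (at x)"
          using dF[of x] F'[of x] that \<open>0 \<le> u\<close> \<open>v \<le> L\<close> by simp
      qed (use c G in simp)
      then show ?thesis
        using that contF by (intro DERIV_nonneg_imp_increasing_open[of u v F]) blast+
    qed simp
    have w0: "w x = 0" if x: "x \<in> {0<..<L}" for x
    proof -
      have const: "F y = F 0" if "y \<in> {0<..<L}" for y
        using mono[of 0 y] mono[of y L] FL that by auto
      have "(F has_real_derivative 0) (at x)"
        by (rule has_field_derivative_transform_within_open[where f = "\<lambda>_. F 0" and S = "{0<..<L}"])
           (use const x in \<open>auto simp: DERIV_const\<close>)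
      then have "c * (deriv U x)\<^sup>2 + (w x)\<^sup>2 / G = 0"
        using DERIV_unique[OF dF[of x]] F'[OF x] by metis
      moreover have "0 \<le> c * (deriv U x)\<^sup>2" "0 \<le> (w x)\<^sup>2 / G" using c G by auto
      ultimately have "(w x)\<^sup>2 / G = 0" by linarith
      then show ?thesis using G by simp
    qed
    have "deriv U x = 0" if "x \<in> {0<..<L}" for x
    proof -
      have "(w has_real_derivative 0) (at x)"
        by (rule has_field_derivative_transform_within_open[where f = "\<lambda>_. 0" and S = "{0<..<L}"])
           (use w0 that in \<open>auto simp: DERIV_const\<close>)
      then show ?thesis using dw DERIV_unique by blast
    qed
    then have "U constant_on {0..L}"
      using constant_on_if_deriv_zero[OF L, of U] D by blast
    with Hc show ?thesis by blast
  next
    case False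
    then have a: "0 < a" and b: "b = 0" using a deg by auto
    obtain m where m: "m \<in> {0..L}" "\<And>x. x \<in> {0..L} \<Longrightarrow> H m \<le> H x"
      using continuous_attains_inf[of "{0..L}" H] contH L by auto
    obtain n where n: "n \<in> {0..L}" "\<And>x. x \<in> {0..L} \<Longrightarrow> H x \<le> H n"
      using continuous_attains_sup[of "{0..L}" H] contH L by auto
    define lo where "lo = (1 + H m) / 2"
    define hi where "hi = H n + 1"
    have lo: "1 < lo" and rng: "\<And>x. x \<in> {0..L} \<Longrightarrow> lo < H x \<and> H x < hi"
      using H1[OF m(1)] m n by (auto simp: lo_def hi_def) (smt (verit) field_sum_of_halves)+
    define R where "R y = 2 * y * (1 - ((s + C\<^sub>0 / (y\<^sup>2 - 1)) / a) / g y)" for y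
    have gt: "y\<^sup>2 - 1 \<noteq> 0" "g y \<noteq> 0" if "y \<in> {lo..hi}" for y
    proof -
      have y: "1 < y" using that lo by simp
      show "y\<^sup>2 - 1 \<noteq> 0" using sq_gt_1[OF y] by simp
      show "g y \<noteq> 0" using greg(2) y by fastforce
    qed
    have "{lo..hi} \<subseteq> {1<..}" using lo by auto
    then have "continuous_on {lo..hi} g" by (rule continuous_on_subset[OF greg(1)])
    then have "continuous_on {lo..hi} R"
      unfolding R_def using gt a by (intro continuous_intros) auto
    then obtain Q where Q: "\<And>y. y \<in> {lo..hi} \<Longrightarrow>
        (Q has_vector_derivative R y) (at y within {lo..hi})"
      using antiderivative_continuous by blast
    have dQ: "(Q has_real_derivative R y) (at y)" if "lo < y" "y < hi" for y
      using Q[of y] that at_within_Icc_at[of lo y hi]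
      by (simp add: has_real_derivative_iff_has_vector_derivative)
    have dQH: "((\<lambda>x. Q (H x)) has_real_derivative R (H x) * deriv H x) (at x)"
      if "x \<in> {0..L}" for x
      using DERIV_chain2[OF dQ dH] rng[OF that] by blast
    have Ueq: "U x = (s + C\<^sub>0 / film_V H x) / a" if "x \<in> {0..L}" for x
    proof -
      have "film_V H x * (a * U x - s) = C\<^sub>0" using flux that by (auto simp: algebra_simps)
      then show ?thesis using Vpos[OF that] a by (simp add: field_simps)
    qed
    have V': "film_V H x * p x = - (C\<^sub>0 / a) * (2 * H x * deriv H x)" if x: "x \<in> {0..L}" for x
    proof -
      have "a * deriv (\<lambda>\<zeta>. U \<zeta> * film_V H \<zeta>) x = s * (2 * H x * deriv H x)"
        using eq2[OF x] DERIV_imp_deriv[OF dV] by simp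
      moreover have "deriv (\<lambda>\<zeta>. U \<zeta> * film_V H \<zeta>) x
          = deriv U x * film_V H x + 2 * H x * deriv H x * U x"
        by (rule DERIV_imp_deriv) (rule DERIV_mult[OF dU dV])
      ultimately have "a * p x = 2 * H x * deriv H x * (s - a * U x)"
        by (simp add: p_def algebra_simps)
      then have "a * (film_V H x * p x) = 2 * H x * deriv H x * (film_V H x * (s - a * U x))"
        by (metis mult.left_commute)
      also have "film_V H x * (s - a * U x) = - C\<^sub>0" using flux x by force
      finally show ?thesis using a by (simp add: field_simps)
    qed
    have ode: "c * deriv p x = C\<^sub>0 * deriv U x
        - film_V H x * (1 - U x / g (H x))" if x: "x \<in> {0..L}" for x
    proof -
      have "- s * deriv U x + a * U x * deriv U x = c * (deriv p x / film_V H x) + 1 - U x / g (H x)"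
        using eq1[OF x] b by simp
      then have "film_V H x * ((a * U x - s) * deriv U x - (1 - U x / g (H x))) = c * deriv p x"
        using Vpos[OF x] by (simp add: field_simps)
      moreover have "film_V H x * (a * U x - s) = C\<^sub>0" using flux x by (auto simp: algebra_simps)
      ultimately show ?thesis by (metis mult.assoc right_diff_distrib)
    qed
    define F where "F x = C\<^sub>0 * (c * (p x)\<^sup>2 / 2 - (C\<^sub>0 / a) * Q (H x))" for x
    have dF: "(F has_real_derivative C\<^sub>0\<^sup>2 * film_V H x * (deriv U x)\<^sup>2) (at x)"
      if x: "x \<in> {0..L}" for x
    proof -
      have "(F has_real_derivative
          C\<^sub>0 * (c * p x * deriv p x - (C\<^sub>0 / a) * (R (H x) * deriv H x))) (at x)"
        unfolding F_def using a
        by (auto intro!: derivative_eq_intros dp dQH[OF x] simp: power2_eq_square)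
      moreover have "c * p x * deriv p x - (C\<^sub>0 / a) * (R (H x) * deriv H x)
          = C\<^sub>0 * film_V H x * (deriv U x)\<^sup>2"
      proof -
        have R: "R (H x) = 2 * H x * (1 - U x / g (H x))"
          using Ueq[OF x] by (simp add: R_def film_V_def)
        have "(C\<^sub>0 / a) * (R (H x) * deriv H x) = - (film_V H x * p x) * (1 - U x / g (H x))"
          unfolding R V'[OF x] by simp
        moreover have "c * p x * deriv p x
            = p x * (C\<^sub>0 * deriv U x - film_V H x * (1 - U x / g (H x)))"
          unfolding ode[OF x, symmetric] by simp
        ultimately have "c * p x * deriv p x - (C\<^sub>0 / a) * (R (H x) * deriv H x)
            = p x * (C\<^sub>0 * deriv U x)" by (simp add: algebra_simps)
        then show ?thesis by (simp add: p_def power2_eq_square)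
      qed
      ultimately show ?thesis by (simp add: power2_eq_square mult.assoc)
    qed
    have "C\<^sub>0\<^sup>2 * film_V H x * (deriv U x)\<^sup>2 = 0" if "x \<in> {0<..<L}" for x
      by (rule returning_mono_deriv_zero[OF L dF _ _ that])
         (use Vpos pper H0 in \<open>auto simp: F_def less_imp_le\<close>)
    then have "deriv U x = 0" if "x \<in> {0<..<L}" for x
      using that Vpos[of x] C0 by force
    then have Uc: "U constant_on {0..L}"
      using constant_on_if_deriv_zero[OF L, of U] D by blast
    then obtain u where u: "\<And>x. x \<in> {0..L} \<Longrightarrow> U x = u" unfolding constant_on_def by blast
    have Veq: "film_V H x * (a * u - s) = C\<^sub>0" if "x \<in> {0..L}" for x
      using flux u[OF that] that by (auto simp: algebra_simps)
    then have "a * u - s \<noteq> 0" using C0 L by force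
    then have "(H x)\<^sup>2 = 1 + C\<^sub>0 / (a * u - s)" if "x \<in> {0..L}" for x
      using Veq[OF that] by (simp add: film_V_def field_simps)
    then have "(\<lambda>x. (H x)\<^sup>2) constant_on {0..L}" unfolding constant_on_def by blast
    then have "H constant_on {0..L}"
      by (rule constant_on_if_sq_constant) (use H1 in force)
    with Uc show ?thesis by blast
  qed
qed

end

theory Submission
  imports Defs
begin

text \<open>
  For \<open>a = 0\<close> or \<open>b = 0\<close> a constant solution does. For \<open>a, b > 0\<close> the flux relation eliminates \<open>U\<close>
  and leaves a third-order equation for \<open>H\<close>; small periodic solutions branch off the equilibrium
  \<open>H = A\<close> where its linearisation has eigenvalues \<open>\<plusminus>i\<omega>\<close> (a Hopf point; \<open>C\<^sub>0 = -k < 0\<close>).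
  Writing \<open>H(\<xi>) = A + \<epsilon> y(\<omega>\<xi>)\<close>, the equation for \<open>y\<close> extends continuously to \<open>\<epsilon> = 0\<close>, where it reads
  \<open>y''' = \<rho> (y'' + y) - y' - q\<^sub>1 y' + q\<^sub>2 y - r\<close> and has the solution \<open>cos\<close> for \<open>q\<^sub>1 = q\<^sub>2 = r = 0\<close>.
  Four parameters are left: \<open>A\<close> and detunings \<open>x\<^sub>1, x\<^sub>2, x\<^sub>3\<close> of \<open>\<omega>\<close>, \<open>k\<close> and \<open>s\<close>, proportional
  to \<open>q\<^sub>1, q\<^sub>2, r\<close>. Periodicity with period \<open>2\<pi>\<close> amounts to three scalar equations, which near \<open>cos\<close> are
  dominated by \<open>q\<^sub>1\<close>, \<open>q\<^sub>2\<close> and \<open>r\<close> respectively, and the mass over one period is close to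
  \<open>2\<pi>(A\<^sup>2 - 1) / \<omega>\<close>, which is small for \<open>A\<close> near \<open>1\<close>. Hence the Poincare-Miranda theorem solves the
  four equations for small \<open>\<epsilon> > 0\<close>, with mass \<open>M / n\<close> on one period; then \<open>L\<close> consists of \<open>n\<close> periods.
\<close>

section \<open>Ordinary differential equations\<close>

text \<open>Since \<open>c = 0\<close> is allowed, the third eigenvalue \<rho> of the linearisation
  may vanish. The classical Hopf theorem excludes an eigenvalue 0 next to the imaginary pair, so the
  branch is built by hand. The initial state \<open>(1, 0, -1)\<close> of
  \<open>(y, y', y'')\<close> is prescribed, which fixes phase and amplitude, and all three
  components have to return to it. At \<epsilon> = 0 the failure to return is tested against
  \<open>cos\<close>, \<open>sin\<close> and \<open>exp (- \<rho> t)\<close>, which span the kernel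
  of the adjoint operator when \<rho> is a non-zero real and remain independent when \<rho> = 0.
  Cosine solves the limit equation for every \<open>A\<close> once the detunings vanish, so
  \<open>A\<close> stays free to adjust the mass. Strict signs on the faces of a box at \<epsilon> =
  0 need only continuity in all parameters, and they persist for small \<epsilon> > 0. Two devices
  make the limit tractable: a divided difference of \<open>g\<close> removes the division by
  \<epsilon>, and truncation makes the field globally Lipschitz, so that the flow exists over a full
  period before anything is known about its size.\<close>

lemma integral_rescale_unit_interval:
  fixes F :: "real \<Rightarrow> 'a::banach"
  assumes t: "0 \<le> t" and F: "continuous_on {0..t} F"
  shows "t *\<^sub>R integral {0..1} (\<lambda>u. F (t * u)) = integral {0..t} F"
proof (cases "t = 0")
  case False
  then have t: "0 < t" using t by simp
  have "(F has_integral integral {0..t} F) {0..t}"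
    using F by (simp add: integrable_continuous_real integrable_integral)
  from has_integral_stretch_real[OF this False]
  have "((\<lambda>x. F (t * x)) has_integral (1/t) *\<^sub>R integral {0..t} F) {0..1}"
    using t by simp
  then show ?thesis using t by (simp add: integral_unique)
qed simp

text \<open>
  The iteration starts at \<open>Z\<close>, so that a parameter for which \<open>Z\<close> is already a solution yields \<open>Z\<close>
  without a separate uniqueness argument.
\<close>

lemma picard_flow:
  fixes \<Phi> :: "'p::metric_space \<Rightarrow> 'a::euclidean_space \<Rightarrow> 'a" and Z :: "real \<Rightarrow> 'a"
  assumes P: "compact P" and T: "0 \<le> T" and K: "0 \<le> K"
    and cont: "continuous_on (P \<times> UNIV) (\<lambda>z. \<Phi> (fst z) (snd z))"
    and lip: "\<And>p x y. p \<in> P \<Longrightarrow> norm (\<Phi> p x - \<Phi> p y) \<le> K * norm (x - y)"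
    and Z: "continuous_on {0..T} Z"
  obtains Y where "continuous_on (P \<times> {0..T}) (\<lambda>z. Y (fst z) (snd z))"
    and "\<And>p. p \<in> P \<Longrightarrow> Y p 0 = Z 0"
    and "\<And>p t. p \<in> P \<Longrightarrow> t \<in> {0..T} \<Longrightarrow>
          (Y p has_vector_derivative \<Phi> p (Y p t)) (at t within {0..T})"
    and "\<And>p t. p \<in> P \<Longrightarrow> t \<in> {0..T} \<Longrightarrow>
          (\<And>t. t \<in> {0..T} \<Longrightarrow> (Z has_vector_derivative \<Phi> p (Z t)) (at t within {0..T})) \<Longrightarrow> Y p t = Z t"
proof -
  \<comment> \<open>Written over the fixed interval \<open>{0..1}\<close>, the Picard integral has
    \<open>p\<close> and \<open>t\<close> as parameters of equal standing. Joint continuity of every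
    iterate is then continuity of a parametric integral.\<close>
  define Pic where "Pic Y p t = Z 0 + t *\<^sub>R integral {0..1} (\<lambda>u. \<Phi> p (Y p (t * u)))" for Y p t
  define W where "W n = (Pic ^^ n) (\<lambda>p. Z)" for n
  let ?S = "P \<times> {0..T}"
  let ?C = "\<lambda>Y. continuous_on ?S (\<lambda>z. Y (fst z) (snd z))"
  have tu: "t * u \<in> {0..T}" if "t \<in> {0..T}" "u \<in> {0..1}" for t u :: real
    using that mult_mono[of t T u 1] by auto
  have contF: "continuous_on (?S \<times> {0..1}) (\<lambda>(z,u). \<Phi> (fst z) (Y (fst z) (snd z * u)))"
    if "?C Y" for Y
  proof -
    have "continuous_on (?S \<times> {0..1}) (\<lambda>z. Y (fst (fst (fst z), snd (fst z) * snd z))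
         (snd (fst (fst z), snd (fst z) * snd z)))"
      by (rule continuous_on_compose2[OF that]) (use tu in \<open>auto intro!: continuous_intros\<close>)
    then have 1: "continuous_on (?S \<times> {0..1}) (\<lambda>z. Y (fst (fst z)) (snd (fst z) * snd z))" by simp
    have "continuous_on (?S \<times> {0..1}) (\<lambda>z. \<Phi> (fst (fst (fst z), Y (fst (fst z)) (snd (fst z) * snd z)))
         (snd (fst (fst z), Y (fst (fst z)) (snd (fst z) * snd z))))"
      by (rule continuous_on_compose2[OF cont]) (use 1 in \<open>auto intro!: continuous_intros\<close>)
    then show ?thesis by (simp add: split_beta)
  qed
  have contPic: "?C (Pic Y)" if "?C Y" for Y
    unfolding Pic_def using contF[OF that]
    by (intro continuous_intros
         integral_continuous_on_param[of ?S 0 "1::real" "\<lambda>z u. \<Phi> (fst z) (Y (fst z) (snd z * u))", simplified])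
  have C0: "?C (\<lambda>p. Z)" by (rule continuous_on_compose2[OF Z]) (auto intro!: continuous_intros)
  have CW: "?C (W n)" for n
    by (induction n) (simp_all add: W_def C0 contPic)
  have Wsuc: "W (Suc n) = Pic (W n)" for n by (simp add: W_def)
  have int: "(\<lambda>u. \<Phi> p (Y p (t * u))) integrable_on {0..1}" if "?C Y" "p \<in> P" "t \<in> {0..T}" for Y p t
  proof -
    have "continuous_on {0..1} (\<lambda>u. (\<lambda>(z,u). \<Phi> (fst z) (Y (fst z) (snd z * u))) ((p,t),u))"
      by (rule continuous_on_compose2[OF contF[OF that(1)]]) (use that in \<open>auto intro!: continuous_intros\<close>)
    then show ?thesis by (simp add: integrable_continuous_real)
  qed
  have "compact ?S" using P by (intro compact_Times) auto
  then have "bounded ((\<lambda>z. W 1 (fst z) (snd z) - W 0 (fst z) (snd z)) ` ?S)"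
    by (intro compact_imp_bounded compact_continuous_image continuous_on_diff CW)
  then obtain M where M: "\<And>p t. p \<in> P \<Longrightarrow> t \<in> {0..T} \<Longrightarrow> norm (W 1 p t - W 0 p t) \<le> M"
    unfolding bounded_iff by force
  have step: "norm (Pic Y p t - Pic X p t) \<le> t * integral {0..1} e"
    if "?C Y" "?C X" "p \<in> P" "t \<in> {0..T}" "e integrable_on {0..1}"
      and e: "\<And>u. u \<in> {0..1} \<Longrightarrow> K * norm (Y p (t * u) - X p (t * u)) \<le> e u" for X Y p t e
  proof -
    have "Pic Y p t - Pic X p t = t *\<^sub>R integral {0..1} (\<lambda>u. \<Phi> p (Y p (t * u)) - \<Phi> p (X p (t * u)))"
      unfolding Pic_def using int that by (simp add: integral_diff scaleR_diff_right)
    also have "norm \<dots> = t * norm (integral {0..1} (\<lambda>u. \<Phi> p (Y p (t * u)) - \<Phi> p (X p (t * u))))"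
      using that by simp
    also have "\<dots> \<le> t * integral {0..1} e"
    proof (intro mult_left_mono integral_norm_bound_integral integrable_diff int that(1-5))
      show "norm (\<Phi> p (Y p (t * u)) - \<Phi> p (X p (t * u))) \<le> e u" if "u \<in> {0..1}" for u
        using lip[OF \<open>p \<in> P\<close>] e[OF that] by (rule order_trans)
    qed (use that in auto)
    finally show ?thesis .
  qed
  \<comment> \<open>The factorial gives convergence on all of \<open>{0..T}\<close> without any
    smallness of \<open>K * T\<close>. The bound is uniform in \<open>p\<close> and
    \<open>t\<close>, so the limit is jointly continuous.\<close>
  have est: "norm (W (Suc n) p t - W n p t) \<le> M * (K * t) ^ n / fact n" if "p \<in> P" "t \<in> {0..T}" for n p t
    using that(2)
  proof (induction n arbitrary: t)
    case 0
    then show ?case using M that by simp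
  next
    case (Suc n)
    let ?c = "K * (M * (K * t) ^ n / fact n)"
    have I: "((\<lambda>u. ?c * u ^ n) has_integral ?c * (1 / real (Suc n))) {0..1}"
    proof -
      have "((\<lambda>u::real. u ^ n) has_integral (1 ^ Suc n / real (Suc n) - 0 ^ Suc n / real (Suc n))) {0..1}"
      proof (rule fundamental_theorem_of_calculus)
        fix u :: real
        have "((\<lambda>u. u ^ Suc n / real (Suc n)) has_real_derivative u ^ n) (at u within {0..1})"
          using DERIV_cdivide[OF DERIV_pow[of "Suc n" u "{0..1}"], of "real (Suc n)"]
          by (simp del: of_nat_Suc power_Suc)
        then show "((\<lambda>u. u ^ Suc n / real (Suc n)) has_vector_derivative u ^ n) (at u within {0..1})"
          by (simp add: has_real_derivative_iff_has_vector_derivative)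
      qed simp
      from has_integral_mult_right[OF this, of ?c] show ?thesis by simp
    qed
    have "norm (W (Suc (Suc n)) p t - W (Suc n) p t) \<le> t * integral {0..1} (\<lambda>u. ?c * u ^ n)"
      unfolding Wsuc[of "Suc n"] unfolding Wsuc[of n, THEN fun_cong, THEN fun_cong, of p t]
    proof (rule step[OF CW CW that(1) Suc.prems])
      show "(\<lambda>u. ?c * u ^ n) integrable_on {0..1}" using I by blast
      fix u :: real assume u: "u \<in> {0..1}"
      have "K * norm (W (Suc n) p (t * u) - W n p (t * u)) \<le> K * (M * (K * (t * u)) ^ n / fact n)"
        by (intro mult_left_mono Suc.IH tu K Suc.prems u)
      then show "K * norm (W (Suc n) p (t * u) - W n p (t * u)) \<le> ?c * u ^ n"
        by (simp add: power_mult_distrib mult_ac)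
    qed
    also have "\<dots> = M * (K * t) ^ Suc n / fact (Suc n)"
      unfolding integral_unique[OF I] by (simp add: mult_ac del: of_nat_Suc)
    finally show ?case .
  qed
  define Y where "Y p t = W 0 p t + (\<Sum>n. W (Suc n) p t - W n p t)" for p t
  have M0: "0 \<le> M" if "p \<in> P" for p
    using M[OF that, of 0] T by (meson atLeastAtMost_iff norm_ge_zero order.refl order_trans)
  have UL: "uniform_limit ?S (\<lambda>n z. W n (fst z) (snd z)) (\<lambda>z. Y (fst z) (snd z)) sequentially"
  proof -
    have "summable (\<lambda>n. M * ((K * T) ^ n / fact n))"
      using summable_exp[of "K * T"] by (intro summable_mult) (simp add: field_simps)
    then have "uniform_limit ?S (\<lambda>n z. \<Sum>i<n. W (Suc i) (fst z) (snd z) - W i (fst z) (snd z))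
      (\<lambda>z. \<Sum>i. W (Suc i) (fst z) (snd z) - W i (fst z) (snd z)) sequentially"
    proof (rule Weierstrass_m_test[rotated])
      fix n z assume z: "z \<in> ?S"
      then have "norm (W (Suc n) (fst z) (snd z) - W n (fst z) (snd z)) \<le> M * (K * snd z) ^ n / fact n"
        by (intro est) auto
      also have "\<dots> \<le> M * (K * T) ^ n / fact n"
        using z K M0 by (intro divide_right_mono mult_left_mono power_mono) auto
      finally show "norm (W (Suc n) (fst z) (snd z) - W n (fst z) (snd z)) \<le> M * ((K * T) ^ n / fact n)" by simp
    qed
    then have "uniform_limit ?S (\<lambda>n z. W 0 (fst z) (snd z) + (\<Sum>i<n. W (Suc i) (fst z) (snd z) - W i (fst z) (snd z)))
      (\<lambda>z. W 0 (fst z) (snd z) + (\<Sum>i. W (Suc i) (fst z) (snd z) - W i (fst z) (snd z))) sequentially"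
      by (intro uniform_limit_intros)
    moreover have "W 0 p t + (\<Sum>i<n. W (Suc i) p t - W i p t) = W n p t" for n p t
      using sum_lessThan_telescope[of "\<lambda>i. W i p t" n] by simp
    ultimately show ?thesis by (simp add: Y_def)
  qed
  have CY: "?C Y"
    by (rule uniform_limit_theorem[OF _ UL]) (auto simp: CW)
  have fixY: "Y p t = Pic Y p t" if pt: "p \<in> P" "t \<in> {0..T}" for p t
  proof -
    have "(\<lambda>n. W (Suc n) p t) \<longlonglongrightarrow> Y p t"
      using tendsto_uniform_limitI[OF UL, of "(p,t)"] pt by (intro LIMSEQ_Suc) auto
    moreover have "(\<lambda>n. Pic (W n) p t) \<longlonglongrightarrow> Pic Y p t"
    proof (rule LIMSEQ_I)
      fix r :: real assume r: "0 < r"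
      define e where "e = r / (1 + T * K)"
      have e: "0 < e" "e * (T * K) < r"
        using r T K by (auto simp: e_def field_simps add_pos_nonneg)
      obtain N where N: "\<And>n z. n \<ge> N \<Longrightarrow> z \<in> ?S \<Longrightarrow> dist (W n (fst z) (snd z)) (Y (fst z) (snd z)) < e"
        using UL e(1) unfolding uniform_limit_sequentially_iff by blast
      have "norm (Pic (W n) p t - Pic Y p t) < r" if "n \<ge> N" for n
      proof -
        have "norm (Pic (W n) p t - Pic Y p t) \<le> t * integral {0..1} (\<lambda>u::real. K * e)"
        proof (rule step[OF CW CY pt])
          fix u :: real assume "u \<in> {0..1}"
          then show "K * norm (W n p (t * u) - Y p (t * u)) \<le> K * e"
            using N[OF that, of "(p, t * u)"] pt tu K by (intro mult_left_mono) (auto simp: dist_norm)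
        qed auto
        also have "\<dots> = t * (K * e)" by simp
        also have "\<dots> \<le> T * (K * e)" using pt K e by (intro mult_right_mono) auto
        also have "\<dots> < r" using e by (simp add: mult_ac)
        finally show ?thesis .
      qed
      then show "\<exists>N. \<forall>n\<ge>N. norm (Pic (W n) p t - Pic Y p t) < r" by blast
    qed
    ultimately show ?thesis unfolding Wsuc using LIMSEQ_unique by blast
  qed
  have cY: "continuous_on {0..T} (\<lambda>t. \<Phi> p (X p t))" if "?C X" "p \<in> P" for X p
  proof -
    have "continuous_on {0..T} (\<lambda>t. X (fst (p,t)) (snd (p,t)))"
      by (rule continuous_on_compose2[OF that(1)]) (use that in \<open>auto intro!: continuous_intros\<close>)
    then have "continuous_on {0..T} (\<lambda>t. \<Phi> (fst (p, X p t)) (snd (p, X p t)))"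
      by (intro continuous_on_compose2[OF cont]) (use that in \<open>auto intro!: continuous_intros\<close>)
    then show ?thesis by simp
  qed
  have Pic_eq: "Pic X p t = Z 0 + integral {0..t} (\<lambda>s. \<Phi> p (X p s))"
    if "?C X" "p \<in> P" "t \<in> {0..T}" for X p t
    unfolding Pic_def using that cY[OF that(1,2)]
    by (subst integral_rescale_unit_interval[where F = "\<lambda>s. \<Phi> p (X p s)"])
       (auto intro: continuous_on_subset)
  show thesis
  proof
    show "?C Y" by (rule CY)
    show "Y p 0 = Z 0" if "p \<in> P" for p using fixY[OF that, of 0] T by (simp add: Pic_def)
    show "(Y p has_vector_derivative \<Phi> p (Y p t)) (at t within {0..T})"
      if pt: "p \<in> P" "t \<in> {0..T}" for p t
    proof -
      have "((\<lambda>t. Z 0 + integral {0..t} (\<lambda>s. \<Phi> p (Y p s))) has_vector_derivative \<Phi> p (Y p t)) (at t within {0..T})"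
        using integral_has_vector_derivative[OF cY[OF CY pt(1)] pt(2)]
        by (auto intro!: derivative_eq_intros)
      then show ?thesis
        by (rule has_vector_derivative_transform[OF pt(2), rotated])
           (use fixY Pic_eq[OF CY] pt in auto)
    qed
    show "Y p t = Z t" if p: "p \<in> P" and t: "t \<in> {0..T}"
      and Zs: "\<And>t. t \<in> {0..T} \<Longrightarrow> (Z has_vector_derivative \<Phi> p (Z t)) (at t within {0..T})" for p t
    proof -
      have "W n p t = Z t" if "t \<in> {0..T}" for n t
        using that
      proof (induction n arbitrary: t)
        case (Suc n)
        have "W (Suc n) p t = Z 0 + integral {0..t} (\<lambda>s. \<Phi> p (W n p s))"
          unfolding Wsuc by (rule Pic_eq[OF CW p Suc.prems])
        also have "integral {0..t} (\<lambda>s. \<Phi> p (W n p s)) = integral {0..t} (\<lambda>s. \<Phi> p (Z s))"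
          using Suc by (intro integral_cong) auto
        also have "\<dots> = Z t - Z 0"
          using Suc.prems
          by (intro integral_unique fundamental_theorem_of_calculus)
             (auto intro!: has_vector_derivative_within_subset[OF Zs])
        finally show ?case by simp
      qed (simp add: W_def)
      then show ?thesis using t by (simp add: Y_def)
    qed
  qed
qed

text \<open>\<open>ext h\<close> reduces the argument modulo \<open>L\<close>. The delicate points
  are the multiples of \<open>L\<close>: there the matching end values of \<open>f\<close> and
  \<open>f'\<close> make the two one-sided derivatives agree, and two adjacent closed periods form a
  neighbourhood.\<close>

lemma periodic_extension_derivative:
  fixes f f' :: "real \<Rightarrow> real"
  assumes L: "0 < L"
    and d: "\<And>x. x \<in> {0..L} \<Longrightarrow> (f has_real_derivative f' x) (at x within {0..L})"
    and f: "f L = f 0" and f': "f' L = f' 0"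
  defines "ext \<equiv> \<lambda>h x. h (x - L * of_int \<lfloor>x / L\<rfloor>)"
  shows "(ext f has_real_derivative ext f' x) (at x)"
proof -
  define n where "n = \<lfloor>x / L\<rfloor>"
  have shift: "((\<lambda>y. f (y - L * of_int m)) has_real_derivative f' (x - L * of_int m)) (at x within {L * of_int m..L * of_int m + L})"
    if "x \<in> {L * of_int m..L * of_int m + L}" for m
  proof -
    have "((f \<circ> (\<lambda>y. y - L * of_int m)) has_real_derivative f' (x - L * of_int m) * 1) (at x within {L * of_int m..L * of_int m + L})"
    proof (rule DERIV_image_chain)
      have "(\<lambda>y. y - L * of_int m) ` {L * of_int m..L * of_int m + L} = {0..L}"
        by (auto simp: image_iff intro!: bexI[of _ "_ + L * of_int m"])
      then show "(f has_real_derivative f' (x - L * of_int m)) (at (x - L * of_int m) within (\<lambda>y. y - L * of_int m) ` {L * of_int m..L * of_int m + L})"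
        using d[of "x - L * of_int m"] that by auto
    qed (auto intro!: derivative_eq_intros)
    then show ?thesis by (simp add: o_def)
  qed
  \<comment> \<open>This covers the closed period. At its right end the floor has already jumped to
    \<open>m + 1\<close>, and \<open>h L = h 0\<close> compensates.\<close>
  have ext: "ext h y = h (y - L * of_int m)" if "y \<in> {L * of_int m..L * of_int m + L}" "h L = h 0" for y m and h :: "real \<Rightarrow> real"
  proof (cases "y = L * of_int m + L")
    case True
    then have "y / L = of_int (m + 1)" using L by (simp add: field_simps)
    then have "\<lfloor>y / L\<rfloor> = m + 1" by (metis floor_of_int)
    then have "ext h y = h 0" using True by (simp add: ext_def algebra_simps)
    then show ?thesis using True that by simp
  next
    case False
    then have "\<lfloor>y / L\<rfloor> = m" using that L by (intro floor_unique) (auto simp: field_simps)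
    then show ?thesis by (simp add: ext_def)
  qed
  have D: "(ext f has_real_derivative ext f' x) (at x within {L * of_int m..L * of_int m + L})"
    if "x \<in> {L * of_int m..L * of_int m + L}" for m
    using ext[of x m f'] that f'
    by (auto intro!: has_field_derivative_transform_within[OF shift[OF that] zero_less_one that] ext[where h=f, symmetric] simp: f)
  have "of_int n \<le> x / L" "x / L < of_int n + 1" by (simp_all add: n_def)
  then have xn: "L * of_int n \<le> x" "x < L * of_int n + L"
    using L by (simp_all add: pos_le_divide_eq pos_divide_less_eq algebra_simps)
  show ?thesis
  proof (cases "x = L * of_int n")
    case False
    then have "at x within {L * of_int n..L * of_int n + L} = at x"
      using xn by (intro at_within_Icc_at) auto
    with D[of n] xn show ?thesis by simp
  next
    case True
    have "(ext f has_real_derivative ext f' x)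
        (at x within ({L * of_int n..L * of_int n + L} \<union> {L * of_int (n-1)..L * of_int (n-1) + L}))"
    proof -
      have "x \<in> {L * of_int n..L * of_int n + L}" "x \<in> {L * of_int (n-1)..L * of_int (n-1) + L}"
        using True L by (auto simp: algebra_simps)
      from this[THEN D] show ?thesis
        unfolding has_field_derivative_iff unfolding at_within_union by (rule filterlim_sup)
    qed
    moreover have "{L * of_int n..L * of_int n + L} \<union> {L * of_int (n-1)..L * of_int (n-1) + L} = {x - L..x + L}"
      using True L by (auto simp: algebra_simps)
    moreover have "at x within {x - L..x + L} = at x" using L by (intro at_within_Icc_at) auto
    ultimately show ?thesis by simp
  qed
qed

lemma integral_periodic_multiple:
  fixes f :: "real \<Rightarrow> real"
  assumes T: "0 < T" and cont: "continuous_on UNIV f" and per: "\<And>x. f (x + T) = f x"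
  shows "integral {0..real n * T} f = real n * integral {0..T} f"
proof (induction n)
  case (Suc n)
  have pern: "f (x + real m * T) = f x" for x m
  proof (induction m)
    case (Suc m)
    have "x + real (Suc m) * T = (x + real m * T) + T" by (simp add: algebra_simps)
    then show ?case using Suc per by metis
  qed simp
  have int: "f integrable_on S" if "S = {u..v}" for S u v
    unfolding that by (intro integrable_continuous_real continuous_on_subset[OF cont]) simp
  have "integral {0..real (Suc n) * T} f = integral {0..real n * T} f + integral {real n * T..real (Suc n) * T} f"
    using Henstock_Kurzweil_Integration.integral_combine[of 0 "real n * T" "real (Suc n) * T" f] T int
    by (simp add: algebra_simps)
  also have "integral {real n * T..real (Suc n) * T} f = integral {0..T} f"
  proof -
    have "real (Suc n) * T - real n * T = T" by (simp add: algebra_simps)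
    then show ?thesis
      using integral_shift_real_ivl[of "real n * T" "real n * T" "real (Suc n) * T" f] by (simp only: pern diff_self)
  qed
  finally show ?case using Suc by (simp add: algebra_simps)
qed simp

section \<open>Zeros of perturbed maps\<close>

text \<open>Brouwer's theorem is applied to \<open>z - F z\<close>, clipped to the box in each
  coordinate. At a fixed point a coordinate off the faces is not clipped, so its \<open>F\<close>
  vanishes; on a face the sign of \<open>F\<close> pushes the image inwards, so no fixed point lies
  there. If the two faces coincide, their sign conditions contradict each other.\<close>

lemma poincare_miranda_4:
  fixes F1 F2 F3 F4 :: "real \<times> real \<times> real \<times> real \<Rightarrow> real"
  assumes le: "l1 \<le> u1" "l2 \<le> u2" "l3 \<le> u3" "l4 \<le> u4"
  defines "S \<equiv> {l1..u1} \<times> {l2..u2} \<times> {l3..u3} \<times> {l4..u4}"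
  assumes cont: "continuous_on S F1" "continuous_on S F2" "continuous_on S F3" "continuous_on S F4"
    and F1: "\<And>z. z \<in> S \<Longrightarrow> fst z = l1 \<Longrightarrow> F1 z < 0" "\<And>z. z \<in> S \<Longrightarrow> fst z = u1 \<Longrightarrow> 0 < F1 z"
    and F2: "\<And>z. z \<in> S \<Longrightarrow> fst (snd z) = l2 \<Longrightarrow> F2 z < 0" "\<And>z. z \<in> S \<Longrightarrow> fst (snd z) = u2 \<Longrightarrow> 0 < F2 z"
    and F3: "\<And>z. z \<in> S \<Longrightarrow> fst (snd (snd z)) = l3 \<Longrightarrow> F3 z < 0" "\<And>z. z \<in> S \<Longrightarrow> fst (snd (snd z)) = u3 \<Longrightarrow> 0 < F3 z"
    and F4: "\<And>z. z \<in> S \<Longrightarrow> snd (snd (snd z)) = l4 \<Longrightarrow> F4 z < 0" "\<And>z. z \<in> S \<Longrightarrow> snd (snd (snd z)) = u4 \<Longrightarrow> 0 < F4 z"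
  shows "\<exists>z\<in>S. F1 z = 0 \<and> F2 z = 0 \<and> F3 z = 0 \<and> F4 z = 0"
proof -
  define cl :: "real \<Rightarrow> real \<Rightarrow> real \<Rightarrow> real" where "cl l u x = max l (min u x)" for l u x
  define f where "f z = (cl l1 u1 (fst z - F1 z), cl l2 u2 (fst (snd z) - F2 z),
    cl l3 u3 (fst (snd (snd z)) - F3 z), cl l4 u4 (snd (snd (snd z)) - F4 z))" for z
  have "compact S" "convex S" unfolding S_def by (intro compact_Times convex_Times; simp)+
  moreover have "S \<noteq> {}" unfolding S_def using le by auto
  moreover have "continuous_on S f"
    unfolding f_def cl_def using cont by (intro continuous_intros)
  moreover have "f \<in> S \<rightarrow> S" unfolding S_def f_def cl_def using le by auto
  ultimately obtain z where z: "z \<in> S" "f z = z" by (rule brouwer)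
  have key: "y = 0" if "cl l u (x - y) = x" "x = l \<Longrightarrow> y < 0" "x = u \<Longrightarrow> 0 < y" "l \<le> u" for l u x y
    using that unfolding cl_def by (cases "x = l"; cases "x = u") (auto simp: max_def min_def split: if_splits)
  have "cl l1 u1 (fst z - F1 z) = fst z" "cl l2 u2 (fst (snd z) - F2 z) = fst (snd z)"
    "cl l3 u3 (fst (snd (snd z)) - F3 z) = fst (snd (snd z))" "cl l4 u4 (snd (snd (snd z)) - F4 z) = snd (snd (snd z))"
    using z(2) unfolding f_def by (metis fst_conv snd_conv)+
  then show ?thesis using key F1 F2 F3 F4 le z(1) by (intro bexI[of _ z] conjI; blast)
qed

lemma eventually_pos_near_compact_slice:
  fixes F :: "'a::metric_space \<times> real \<Rightarrow> real"
  assumes K: "compact K" and cont: "continuous_on (K \<times> {0..e0}) F"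
    and pos: "\<And>x. x \<in> K \<Longrightarrow> 0 < F (x, 0)"
  shows "\<forall>\<^sub>F e in at_right 0. \<forall>x\<in>K. e \<le> e0 \<longrightarrow> 0 < F (x, e)"
proof (cases "K = {} \<or> e0 < 0")
  case True
  then show ?thesis
    by (auto simp: eventually_at_filter)
next
  case False
  have c0: "continuous_on K (\<lambda>x. F (x, 0))"
    by (rule continuous_on_compose2[OF cont]) (use False in \<open>auto intro!: continuous_intros\<close>)
  obtain x0 where x0: "x0 \<in> K" "\<And>x. x \<in> K \<Longrightarrow> F (x0, 0) \<le> F (x, 0)"
    using continuous_attains_inf[OF K _ c0] False by auto
  have "uniformly_continuous_on (K \<times> {0..e0}) F"
    by (intro compact_uniformly_continuous[OF cont] compact_Times K) simp
  then obtain d where d: "0 < d" "\<And>z z'. z \<in> K \<times> {0..e0} \<Longrightarrow> z' \<in> K \<times> {0..e0} \<Longrightarrow> dist z' z < d \<Longrightarrow> dist (F z') (F z) < F (x0, 0)"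
    using pos[OF x0(1)] unfolding uniformly_continuous_on_def by meson
  have "0 < F (x, e)" if "0 < e" "e < d" "e \<le> e0" "x \<in> K" for x e
  proof -
    have "dist (F (x, e)) (F (x, 0)) < F (x0, 0)"
      using that False by (intro d) (auto simp: dist_Pair_Pair)
    then show ?thesis using x0(2)[OF that(4)] by (auto simp: dist_real_def)
  qed
  then show ?thesis using d(1) by (auto simp: eventually_at_right[of 0 1] intro!: exI[of _ d])
qed

text \<open>Each face is compact, so a strict sign at \<open>e = 0\<close> persists for all small
  \<open>e > 0\<close>. This leaves conditions on the limit problem alone, which is linear in the
  application.\<close>

lemma poincare_miranda_4_perturbed:
  fixes F1 F2 F3 F4 :: "(real \<times> real \<times> real \<times> real) \<times> real \<Rightarrow> real"
  assumes le: "l1 \<le> u1" "l2 \<le> u2" "l3 \<le> u3" "l4 \<le> u4"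
  defines "S \<equiv> {l1..u1} \<times> {l2..u2} \<times> {l3..u3} \<times> {l4..u4}"
  assumes e0: "0 < e0"
    and cont: "continuous_on (S \<times> {0..e0}) F1" "continuous_on (S \<times> {0..e0}) F2"
      "continuous_on (S \<times> {0..e0}) F3" "continuous_on (S \<times> {0..e0}) F4"
    and F1: "\<And>z. z \<in> S \<Longrightarrow> fst z = l1 \<Longrightarrow> F1 (z, 0) < 0" "\<And>z. z \<in> S \<Longrightarrow> fst z = u1 \<Longrightarrow> 0 < F1 (z, 0)"
    and F2: "\<And>z. z \<in> S \<Longrightarrow> fst (snd z) = l2 \<Longrightarrow> F2 (z, 0) < 0" "\<And>z. z \<in> S \<Longrightarrow> fst (snd z) = u2 \<Longrightarrow> 0 < F2 (z, 0)"
    and F3: "\<And>z. z \<in> S \<Longrightarrow> fst (snd (snd z)) = l3 \<Longrightarrow> F3 (z, 0) < 0" "\<And>z. z \<in> S \<Longrightarrow> fst (snd (snd z)) = u3 \<Longrightarrow> 0 < F3 (z, 0)"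
    and F4: "\<And>z. z \<in> S \<Longrightarrow> snd (snd (snd z)) = l4 \<Longrightarrow> F4 (z, 0) < 0" "\<And>z. z \<in> S \<Longrightarrow> snd (snd (snd z)) = u4 \<Longrightarrow> 0 < F4 (z, 0)"
  shows "\<exists>e\<in>{0<..e0}. \<exists>z\<in>S. F1 (z, e) = 0 \<and> F2 (z, e) = 0 \<and> F3 (z, e) = 0 \<and> F4 (z, e) = 0"
proof -
  have S: "compact S" unfolding S_def by (intro compact_Times) simp_all
  have pos: "\<forall>\<^sub>F e in at_right 0. \<forall>z\<in>S. \<pi> z = v \<longrightarrow> e \<le> e0 \<longrightarrow> 0 < F (z, e)"
    if \<pi>: "continuous_on UNIV \<pi>" and F: "continuous_on (S \<times> {0..e0}) F" "\<And>z. z \<in> S \<Longrightarrow> \<pi> z = v \<Longrightarrow> 0 < F (z, 0)"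
    for \<pi> :: "real \<times> real \<times> real \<times> real \<Rightarrow> real" and v and F :: "(real \<times> real \<times> real \<times> real) \<times> real \<Rightarrow> real"
  proof -
    have "closed {z. \<pi> z = v}" using \<pi> by (intro closed_Collect_eq continuous_intros)
    then have "compact (S \<inter> {z. \<pi> z = v})" using S by (rule compact_Int_closed[rotated])
    then have "\<forall>\<^sub>F e in at_right 0. \<forall>z\<in>S \<inter> {z. \<pi> z = v}. e \<le> e0 \<longrightarrow> 0 < F (z, e)"
      by (rule eventually_pos_near_compact_slice) (use F in \<open>auto intro: continuous_on_subset\<close>)
    then show ?thesis by (rule eventually_mono) auto
  qed
  have neg: "\<forall>\<^sub>F e in at_right 0. \<forall>z\<in>S. \<pi> z = v \<longrightarrow> e \<le> e0 \<longrightarrow> F (z, e) < 0"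
    if \<pi>: "continuous_on UNIV \<pi>" and F: "continuous_on (S \<times> {0..e0}) F" "\<And>z. z \<in> S \<Longrightarrow> \<pi> z = v \<Longrightarrow> F (z, 0) < 0"
    for \<pi> :: "real \<times> real \<times> real \<times> real \<Rightarrow> real" and v and F :: "(real \<times> real \<times> real \<times> real) \<times> real \<Rightarrow> real"
    using pos[OF \<pi> continuous_on_minus[OF F(1)], of v] F(2) by simp
  have \<pi>: "continuous_on UNIV (fst :: real \<times> real \<times> real \<times> real \<Rightarrow> real)"
    "continuous_on UNIV (\<lambda>z :: real \<times> real \<times> real \<times> real. fst (snd z))"
    "continuous_on UNIV (\<lambda>z :: real \<times> real \<times> real \<times> real. fst (snd (snd z)))"
    "continuous_on UNIV (\<lambda>z :: real \<times> real \<times> real \<times> real. snd (snd (snd z)))"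
    by (intro continuous_intros)+
  have faces:
    "\<forall>\<^sub>F e in at_right 0. \<forall>z\<in>S. fst z = l1 \<longrightarrow> e \<le> e0 \<longrightarrow> F1 (z, e) < 0"
    "\<forall>\<^sub>F e in at_right 0. \<forall>z\<in>S. fst z = u1 \<longrightarrow> e \<le> e0 \<longrightarrow> 0 < F1 (z, e)"
    "\<forall>\<^sub>F e in at_right 0. \<forall>z\<in>S. fst (snd z) = l2 \<longrightarrow> e \<le> e0 \<longrightarrow> F2 (z, e) < 0"
    "\<forall>\<^sub>F e in at_right 0. \<forall>z\<in>S. fst (snd z) = u2 \<longrightarrow> e \<le> e0 \<longrightarrow> 0 < F2 (z, e)"
    "\<forall>\<^sub>F e in at_right 0. \<forall>z\<in>S. fst (snd (snd z)) = l3 \<longrightarrow> e \<le> e0 \<longrightarrow> F3 (z, e) < 0"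
    "\<forall>\<^sub>F e in at_right 0. \<forall>z\<in>S. fst (snd (snd z)) = u3 \<longrightarrow> e \<le> e0 \<longrightarrow> 0 < F3 (z, e)"
    "\<forall>\<^sub>F e in at_right 0. \<forall>z\<in>S. snd (snd (snd z)) = l4 \<longrightarrow> e \<le> e0 \<longrightarrow> F4 (z, e) < 0"
    "\<forall>\<^sub>F e in at_right 0. \<forall>z\<in>S. snd (snd (snd z)) = u4 \<longrightarrow> e \<le> e0 \<longrightarrow> 0 < F4 (z, e)"
    using neg[OF \<pi>(1) cont(1), of l1] pos[OF \<pi>(1) cont(1), of u1] neg[OF \<pi>(2) cont(2), of l2] pos[OF \<pi>(2) cont(2), of u2]
      neg[OF \<pi>(3) cont(3), of l3] pos[OF \<pi>(3) cont(3), of u3] neg[OF \<pi>(4) cont(4), of l4] pos[OF \<pi>(4) cont(4), of u4]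
      F1 F2 F3 F4 by blast+
  have "\<forall>\<^sub>F e in at_right 0. e \<in> {0<..<e0}" using e0 by (rule eventually_at_right_real)
  then have "\<forall>\<^sub>F e in at_right 0. e \<in> {0<..e0} \<and>
      (\<exists>z\<in>S. F1 (z, e) = 0 \<and> F2 (z, e) = 0 \<and> F3 (z, e) = 0 \<and> F4 (z, e) = 0)"
    using faces
  proof eventually_elim
    case (elim e)
    have e: "0 < e" "e \<le> e0" using elim(1) by auto
    have sl: "continuous_on S (\<lambda>z. F (z, e))" if "continuous_on (S \<times> {0..e0}) F" for F :: "(real \<times> real \<times> real \<times> real) \<times> real \<Rightarrow> real"
      by (rule continuous_on_compose2[OF that]) (use e in \<open>auto intro!: continuous_intros\<close>)
    have "\<exists>z\<in>S. F1 (z, e) = 0 \<and> F2 (z, e) = 0 \<and> F3 (z, e) = 0 \<and> F4 (z, e) = 0"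
      unfolding S_def
      by (rule poincare_miranda_4[OF le]; fold S_def)
         (use elim e sl[OF cont(1)] sl[OF cont(2)] sl[OF cont(3)] sl[OF cont(4)] in blast)+
    with e show ?case by auto
  qed
  from eventually_happens[OF this] show ?thesis by (auto simp: trivial_limit_at_right_real)
qed

text \<open>The function \<open>k * B ^ 3 + l * B\<close> increases with slope at least
  \<open>l\<close>. Hence the root is unique, and subtracting two such equations bounds the distance
  of their roots by the change of the coefficients. The Hopf condition is a cubic of this kind once
  the frequency is eliminated; its leading coefficient \<open>k\<close> is zero when
  \<open>c = 0\<close>.\<close>

lemma depressed_cubic_root_continuous:
  obtains \<beta> :: "real \<Rightarrow> real \<Rightarrow> real \<Rightarrow> real" where
    "\<And>k l m. 0 \<le> k \<Longrightarrow> 0 < l \<Longrightarrow> k * \<beta> k l m ^ 3 + l * \<beta> k l m = m"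
    "\<And>S k l m. continuous_on S k \<Longrightarrow> continuous_on S l \<Longrightarrow> continuous_on S m \<Longrightarrow>
       (\<And>x. x \<in> S \<Longrightarrow> 0 \<le> k x \<and> 0 < l x) \<Longrightarrow>
       continuous_on (S :: 'a::topological_space set) (\<lambda>x. \<beta> (k x) (l x) (m x))"
proof -
  have ex: "\<exists>B. k * B ^ 3 + l * B = m" if k: "0 \<le> k" and l: "0 < l" for k l m :: real
  proof -
    define r where "r = \<bar>m\<bar> / l"
    have "l * r = \<bar>m\<bar>" "0 \<le> k * r ^ 3" "0 \<le> r" using k l by (auto simp: r_def)
    moreover have "k * (- r) ^ 3 = - (k * r ^ 3)" by simp
    ultimately have "k * (- r) ^ 3 + l * (- r) \<le> m" "m \<le> k * r ^ 3 + l * r" "- r \<le> r" by auto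
    then have "\<exists>x. - r \<le> x \<and> x \<le> r \<and> k * x ^ 3 + l * x = m"
      by (rule IVT'[where f = "\<lambda>x. k * x ^ 3 + l * x"]) (intro continuous_intros)
    then show ?thesis by blast
  qed
  define \<beta> where "\<beta> k l m = (SOME B. k * B ^ 3 + l * B = m)" for k l m :: real
  have \<beta>: "k * \<beta> k l m ^ 3 + l * \<beta> k l m = m" if "0 \<le> k" "0 < l" for k l m
    unfolding \<beta>_def by (rule someI_ex[OF ex[OF that]])
  have poly: "k' * B' ^ 3 + l' * B' - (k * B ^ 3 + l * B) - (l' - l) * B - (k' - k) * B ^ 3
      = (B' - B) * (l' + k' * (B'\<^sup>2 + B' * B + B\<^sup>2))" for k' B' l' k B l :: real
    by (simp add: algebra_simps power2_eq_square power3_eq_cube)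
  have key: "l' * \<bar>\<beta> k' l' m' - \<beta> k l m\<bar> \<le> \<bar>m' - m - (l' - l) * \<beta> k l m - (k' - k) * \<beta> k l m ^ 3\<bar>"
    if "0 \<le> k" "0 < l" "0 \<le> k'" "0 < l'" for k l m k' l' m'
  proof -
    let ?B = "\<beta> k l m" and ?B' = "\<beta> k' l' m'"
    have "m' - m - (l' - l) * ?B - (k' - k) * ?B ^ 3 = (?B' - ?B) * (l' + k' * (?B'\<^sup>2 + ?B' * ?B + ?B\<^sup>2))"
      using poly[of k' ?B' l' k ?B l] unfolding \<beta>[OF that(1,2)] \<beta>[OF that(3,4)] .
    moreover have "0 \<le> ?B'\<^sup>2 + ?B' * ?B + ?B\<^sup>2"
    proof -
      have "?B'\<^sup>2 + ?B' * ?B + ?B\<^sup>2 = (?B' + ?B / 2)\<^sup>2 + 3/4 * ?B\<^sup>2" by (simp add: power2_eq_square algebra_simps)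
      then show ?thesis by simp
    qed
    ultimately show ?thesis
      using that mult_right_mono[of l' "l' + k' * (?B'\<^sup>2 + ?B' * ?B + ?B\<^sup>2)" "\<bar>?B' - ?B\<bar>"]
      by (simp add: abs_mult mult.commute[of "\<bar>?B' - ?B\<bar>"])
  qed
  have "continuous_on S (\<lambda>x. \<beta> (k x) (l x) (m x))"
    if c: "continuous_on S k" "continuous_on S l" "continuous_on S m"
      and pos: "\<And>x. x \<in> S \<Longrightarrow> 0 \<le> k x \<and> 0 < l x" for S :: "'a set" and k l m
    unfolding continuous_on_def
  proof
    fix x assume x: "x \<in> S"
    let ?B = "\<beta> (k x) (l x) (m x)"
    have t: "(k \<longlongrightarrow> k x) (at x within S)" "(l \<longlongrightarrow> l x) (at x within S)" "(m \<longlongrightarrow> m x) (at x within S)"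
      using c x by (auto simp: continuous_on_def)
    have "((\<lambda>y. \<bar>m y - m x - (l y - l x) * ?B - (k y - k x) * ?B ^ 3\<bar> / l y) \<longlongrightarrow>
        \<bar>m x - m x - (l x - l x) * ?B - (k x - k x) * ?B ^ 3\<bar> / l x) (at x within S)"
      by (intro tendsto_intros t) (use pos[OF x] in auto)
    then have "((\<lambda>y. \<bar>m y - m x - (l y - l x) * ?B - (k y - k x) * ?B ^ 3\<bar> / l y) \<longlongrightarrow> 0) (at x within S)"
      by simp
    then have "((\<lambda>y. \<beta> (k y) (l y) (m y) - ?B) \<longlongrightarrow> 0) (at x within S)"
    proof (rule Lim_null_comparison[rotated])
      show "\<forall>\<^sub>F y in at x within S. norm (\<beta> (k y) (l y) (m y) - ?B)
         \<le> \<bar>m y - m x - (l y - l x) * ?B - (k y - k x) * ?B ^ 3\<bar> / l y"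
        unfolding eventually_at_filter
      proof (rule always_eventually, intro allI impI)
        fix y assume "y \<noteq> x" "y \<in> S"
        then show "norm (\<beta> (k y) (l y) (m y) - ?B) \<le> \<bar>m y - m x - (l y - l x) * ?B - (k y - k x) * ?B ^ 3\<bar> / l y"
          using key[of "k x" "l x" "k y" "l y" "m y" "m x"] pos x by (simp add: field_simps)
      qed
    qed
    then show "((\<lambda>y. \<beta> (k y) (l y) (m y)) \<longlongrightarrow> ?B) (at x within S)" by (simp add: LIM_zero_iff)
  qed
  with \<beta> show thesis by (rule that)
qed

section \<open>Defects of near-cosine solutions\<close>

text \<open>
  All four quantities come from integrating \<open>f = y''' - \<rho> (y'' + y) + y'\<close> against \<open>cos\<close>, \<open>sin\<close> and
  \<open>exp (- \<rho> t)\<close>, for which \<open>f\<close> times the weight is an exact derivative.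
\<close>

lemma near_cosine_defects:
  fixes y0 y1 y2 :: "real \<Rightarrow> real"
  assumes d0: "\<And>t. t \<in> {0..2*pi} \<Longrightarrow> (y0 has_real_derivative y1 t) (at t within {0..2*pi})"
    and d1: "\<And>t. t \<in> {0..2*pi} \<Longrightarrow> (y1 has_real_derivative y2 t) (at t within {0..2*pi})"
    and d2: "\<And>t. t \<in> {0..2*pi} \<Longrightarrow> (y2 has_real_derivative
        \<rho> * (y2 t + y0 t) - y1 t - q1 * y1 t + q2 * y0 t - r) (at t within {0..2*pi})"
    and init: "y0 0 = 1" "y1 0 = 0" "y2 0 = - 1"
    and near: "\<And>t. t \<in> {0..2*pi} \<Longrightarrow> \<bar>y0 t - cos t\<bar> \<le> d \<and> \<bar>y1 t + sin t\<bar> \<le> d"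
  shows "\<bar>y2 (2*pi) + 1 - \<rho> * y1 (2*pi) - pi * q2\<bar> \<le> 2 * pi * (d * (\<bar>q1\<bar> + \<bar>q2\<bar>))" (is ?A)
    and "\<bar>- y1 (2*pi) + \<rho> * (y0 (2*pi) - 1) - pi * q1\<bar> \<le> 2 * pi * (d * (\<bar>q1\<bar> + \<bar>q2\<bar>))" (is ?B)
    and "(\<And>t. t \<in> {0..2*pi} \<Longrightarrow> - q1 * y1 t + q2 * y0 t - r < 0) \<Longrightarrow> y2 (2*pi) + y0 (2*pi) < 0" (is "PROP ?C")
    and "(\<And>t. t \<in> {0..2*pi} \<Longrightarrow> 0 < - q1 * y1 t + q2 * y0 t - r) \<Longrightarrow> 0 < y2 (2*pi) + y0 (2*pi)" (is "PROP ?D")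
proof -
  let ?I = "{0..2*pi}"
  have dd: "\<bar>(- q1 * (y1 t + sin t) + q2 * (y0 t - cos t)) * \<sigma>\<bar> \<le> d * (\<bar>q1\<bar> + \<bar>q2\<bar>)"
    if "t \<in> ?I" "\<bar>\<sigma>\<bar> \<le> 1" for t \<sigma>
  proof -
    have "\<bar>- q1 * (y1 t + sin t) + q2 * (y0 t - cos t)\<bar> \<le> \<bar>q1\<bar> * \<bar>y1 t + sin t\<bar> + \<bar>q2\<bar> * \<bar>y0 t - cos t\<bar>"
      by (metis abs_minus_cancel abs_mult abs_triangle_ineq)
    also have "\<dots> \<le> \<bar>q1\<bar> * d + \<bar>q2\<bar> * d"
      using near[OF that(1)] by (intro add_mono mult_left_mono) auto
    finally have 1: "\<bar>- q1 * (y1 t + sin t) + q2 * (y0 t - cos t)\<bar> \<le> d * (\<bar>q1\<bar> + \<bar>q2\<bar>)" by (simp add: algebra_simps)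
    have "\<bar>X * \<sigma>\<bar> \<le> \<bar>X\<bar>" for X
      using mult_left_mono[OF that(2) abs_ge_zero[of X]] by (simp add: abs_mult)
    then show ?thesis using 1 by (rule order_trans)
  qed
  have bound: "\<bar>\<phi> (2*pi) - \<phi> 0\<bar> \<le> 2 * pi * (d * (\<bar>q1\<bar> + \<bar>q2\<bar>))"
    if "\<And>t. t \<in> ?I \<Longrightarrow> (\<phi> has_real_derivative (- q1 * (y1 t + sin t) + q2 * (y0 t - cos t)) * \<sigma> t) (at t within ?I)"
      and "\<And>t. \<bar>\<sigma> t\<bar> \<le> 1" for \<phi> \<sigma> :: "real \<Rightarrow> real"
  proof -
    have "norm (\<phi> (2*pi) - \<phi> 0) \<le> (d * (\<bar>q1\<bar> + \<bar>q2\<bar>)) * norm (2 * pi - 0)"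
      by (rule field_differentiable_bound[where S = ?I, OF _ that(1)]) (use dd that(2) in auto)
    then show ?thesis by (simp add: mult_ac)
  qed
  have sc: "sin t * sin t = 1 - cos t * cos t" for t :: real
    using sin_squared_eq[of t] by (simp add: power2_eq_square)
  \<comment> \<open>The subtracted bracket is a primitive of
    \<open>(q1 * sin t + q2 * cos t - r) * cos t\<close>, the weighted forcing along the exact
    cosine. What remains in the derivative is only the deviation from the cosine. Over one period
    the bracket grows by \<open>pi * q2\<close>, and \<open>r\<close> drops out.\<close>
  let ?\<phi> = "\<lambda>t. y2 t * cos t + y1 t * sin t - \<rho> * (y1 t * cos t + y0 t * sin t)
      - (1/2 * (q1 * (sin t * sin t) + q2 * (t + sin t * cos t)) - r * sin t)"
  have "\<bar>?\<phi> (2*pi) - ?\<phi> 0\<bar> \<le> 2 * pi * (d * (\<bar>q1\<bar> + \<bar>q2\<bar>))"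
  proof (rule bound)
    fix t assume t: "t \<in> ?I"
    show "(?\<phi> has_real_derivative (- q1 * (y1 t + sin t) + q2 * (y0 t - cos t)) * cos t) (at t within ?I)"
      by (rule derivative_eq_intros d0[OF t] d1[OF t] d2[OF t] refl)+
         (simp add: algebra_simps sc)
  qed simp
  then show ?A using init by (simp add: algebra_simps)
  let ?\<psi> = "\<lambda>t. y2 t * sin t - y1 t * cos t - \<rho> * (y1 t * sin t - y0 t * cos t)
      - (1/2 * (q1 * (t - sin t * cos t) + q2 * (sin t * sin t)) + r * cos t)"
  have "\<bar>?\<psi> (2*pi) - ?\<psi> 0\<bar> \<le> 2 * pi * (d * (\<bar>q1\<bar> + \<bar>q2\<bar>))"
  proof (rule bound)
    fix t assume t: "t \<in> ?I"
    show "(?\<psi> has_real_derivative (- q1 * (y1 t + sin t) + q2 * (y0 t - cos t)) * sin t) (at t within ?I)"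
      by (rule derivative_eq_intros d0[OF t] d1[OF t] d2[OF t] refl)+
         (simp add: algebra_simps sc)
  qed simp
  then show ?B using init by (simp add: algebra_simps)
  \<comment> \<open>The sum \<open>y2 + y0\<close> satisfies a first-order linear equation with rate
    \<rho> and starts at 0. With this integrating factor a fixed sign of the forcing passes to the
    end value, whatever the sign of \<rho>.\<close>
  let ?v = "\<lambda>t. exp (- \<rho> * t) * (y2 t + y0 t)"
  have dv: "(?v has_real_derivative exp (- \<rho> * t) * (- q1 * y1 t + q2 * y0 t - r)) (at t within ?I)"
    if t: "t \<in> ?I" for t
    by (rule derivative_eq_intros d0[OF t] d1[OF t] d2[OF t] refl)+ (simp add: algebra_simps)
  have cv: "continuous_on ?I ?v" by (rule DERIV_continuous_on[OF dv])
  have dv': "(?v has_real_derivative exp (- \<rho> * t) * (- q1 * y1 t + q2 * y0 t - r)) (at t)"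
    if "0 < t" "t < 2 * pi" for t
    using dv[of t] that at_within_Icc_at[of 0 t "2*pi"] by simp
  have v0: "?v 0 = 0" using init by simp
  obtain z where z: "0 < z" "z < 2*pi" "?v (2*pi) - ?v 0 = (2*pi - 0) * (exp (- \<rho> * z) * (- q1 * y1 z + q2 * y0 z - r))"

  proof -
    obtain l z where "0 < z" "z < 2*pi" "(?v has_real_derivative l) (at z)" "?v (2*pi) - ?v 0 = (2*pi - 0) * l"
      using MVT[OF _ cv] dv' by (meson pi_gt_zero real_differentiable_def zero_less_mult_iff zero_less_numeral)
    then show thesis using that DERIV_unique[OF dv'[of z]] by metis
  qed
  have eq: "exp (- \<rho> * (2*pi)) * (y2 (2*pi) + y0 (2*pi)) = (2*pi * exp (- \<rho> * z)) * (- q1 * y1 z + q2 * y0 z - r)"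
    using z(3) v0 by simp
  show "PROP ?C"
  proof -
    assume "\<And>t. t \<in> ?I \<Longrightarrow> - q1 * y1 t + q2 * y0 t - r < 0"
    then have "(2*pi * exp (- \<rho> * z)) * (- q1 * y1 z + q2 * y0 z - r) < 0"
      using z by (intro mult_pos_neg) auto
    then show "y2 (2*pi) + y0 (2*pi) < 0" unfolding eq[symmetric] by (simp add: mult_less_0_iff)
  qed
  show "PROP ?D"
  proof -
    assume "\<And>t. t \<in> ?I \<Longrightarrow> 0 < - q1 * y1 t + q2 * y0 t - r"
    then have "0 < (2*pi * exp (- \<rho> * z)) * (- q1 * y1 z + q2 * y0 z - r)"
      using z by (intro mult_pos_pos) auto
    then show "0 < y2 (2*pi) + y0 (2*pi)" unfolding eq[symmetric] by (simp add: zero_less_mult_iff)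
  qed
qed

section \<open>Bounded Lipschitz families\<close>

text \<open>Boundedness is included because products of Lipschitz functions are Lipschitz only when
  the factors are bounded. Both constants are uniform in the parameter, as the Picard iteration
  requires.\<close>

definition lip_family :: "'p::metric_space set \<Rightarrow> ('p \<times> 'a::real_normed_vector \<Rightarrow> real) \<Rightarrow> bool" where
  "lip_family P F \<longleftrightarrow> continuous_on (P \<times> UNIV) F \<and> (\<exists>B. \<forall>p\<in>P. \<forall>x. \<bar>F (p, x)\<bar> \<le> B) \<and>
     (\<exists>K. \<forall>p\<in>P. \<forall>x y. \<bar>F (p, x) - F (p, y)\<bar> \<le> K * norm (x - y))"

lemma lip_familyE:
  assumes "lip_family P F"
  obtains B K where "0 \<le> B" "0 \<le> K" "continuous_on (P \<times> UNIV) F" "\<And>p x. p \<in> P \<Longrightarrow> \<bar>F (p, x)\<bar> \<le> B"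
    "\<And>p x y. p \<in> P \<Longrightarrow> \<bar>F (p, x) - F (p, y)\<bar> \<le> K * norm (x - y)"
proof -
  obtain B K where c: "continuous_on (P \<times> UNIV) F" and B: "\<And>p x. p \<in> P \<Longrightarrow> \<bar>F (p, x)\<bar> \<le> B"
    and K: "\<And>p x y. p \<in> P \<Longrightarrow> \<bar>F (p, x) - F (p, y)\<bar> \<le> K * norm (x - y)"
    using assms unfolding lip_family_def by blast
  show thesis
  proof (rule that[of "\<bar>B\<bar>" "\<bar>K\<bar>"])
    show "\<bar>F (p, x)\<bar> \<le> \<bar>B\<bar>" if "p \<in> P" for p x using B[OF that, of x] by simp
    show "\<bar>F (p, x) - F (p, y)\<bar> \<le> \<bar>K\<bar> * norm (x - y)" if "p \<in> P" for p x y
      using K[OF that, of x y] mult_right_mono[OF abs_ge_self[of K] norm_ge_zero[of "x - y"]] by linarith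
  qed (use c in auto)
qed

lemma lip_familyI:
  assumes "continuous_on (P \<times> UNIV) F" "\<And>p x. p \<in> P \<Longrightarrow> \<bar>F (p, x)\<bar> \<le> B"
    "\<And>p x y. p \<in> P \<Longrightarrow> \<bar>F (p, x) - F (p, y)\<bar> \<le> K * norm (x - y)"
  shows "lip_family P F"
  using assms unfolding lip_family_def by blast

lemma lip_family_param:
  assumes "compact P" "continuous_on P u"
  shows "lip_family P (\<lambda>z. u (fst z))"
proof -
  have "bounded (u ` P)" using assms by (intro compact_imp_bounded compact_continuous_image)
  then obtain B where "\<And>p. p \<in> P \<Longrightarrow> \<bar>u p\<bar> \<le> B" unfolding bounded_iff by auto
  moreover have "continuous_on (P \<times> UNIV) (\<lambda>z. u (fst z))"
    by (rule continuous_on_compose2[OF assms(2)]) (auto intro!: continuous_intros)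
  ultimately show ?thesis by (intro lip_familyI[where B = B and K = 0]) auto
qed

lemma lip_family_add:
  assumes "lip_family P F" "lip_family P G"
  shows "lip_family P (\<lambda>z. F z + G z)"
proof -
  obtain B K where F: "continuous_on (P \<times> UNIV) F" "\<And>p x. p \<in> P \<Longrightarrow> \<bar>F (p, x)\<bar> \<le> B"
    "\<And>p x y. p \<in> P \<Longrightarrow> \<bar>F (p, x) - F (p, y)\<bar> \<le> K * norm (x - y)"
    by (rule lip_familyE[OF assms(1)]) blast
  obtain B' K' where G: "continuous_on (P \<times> UNIV) G" "\<And>p x. p \<in> P \<Longrightarrow> \<bar>G (p, x)\<bar> \<le> B'"
    "\<And>p x y. p \<in> P \<Longrightarrow> \<bar>G (p, x) - G (p, y)\<bar> \<le> K' * norm (x - y)"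
    by (rule lip_familyE[OF assms(2)]) blast
  show ?thesis
  proof (rule lip_familyI[where B = "B + B'" and K = "K + K'"])
    fix p x y assume p: "p \<in> P"
    show "\<bar>F (p, x) + G (p, x)\<bar> \<le> B + B'" using F(2)[OF p, of x] G(2)[OF p, of x] by linarith
    show "\<bar>F (p, x) + G (p, x) - (F (p, y) + G (p, y))\<bar> \<le> (K + K') * norm (x - y)"
      using F(3)[OF p, of x y] G(3)[OF p, of x y] by (simp add: distrib_right)
  qed (intro continuous_intros F G)
qed

lemma lip_family_mult:
  assumes "lip_family P F" "lip_family P G"
  shows "lip_family P (\<lambda>z. F z * G z)"
proof -
  obtain B K where F: "0 \<le> B" "0 \<le> K" "continuous_on (P \<times> UNIV) F" "\<And>p x. p \<in> P \<Longrightarrow> \<bar>F (p, x)\<bar> \<le> B"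
    "\<And>p x y. p \<in> P \<Longrightarrow> \<bar>F (p, x) - F (p, y)\<bar> \<le> K * norm (x - y)"
    by (rule lip_familyE[OF assms(1)]) blast
  obtain B' K' where G: "0 \<le> B'" "0 \<le> K'" "continuous_on (P \<times> UNIV) G" "\<And>p x. p \<in> P \<Longrightarrow> \<bar>G (p, x)\<bar> \<le> B'"
    "\<And>p x y. p \<in> P \<Longrightarrow> \<bar>G (p, x) - G (p, y)\<bar> \<le> K' * norm (x - y)"
    by (rule lip_familyE[OF assms(2)]) blast
  show ?thesis
  proof (rule lip_familyI[where B = "B * B'" and K = "B * K' + K * B'"])
    fix p x y assume p: "p \<in> P"
    show "\<bar>F (p, x) * G (p, x)\<bar> \<le> B * B'"
      unfolding abs_mult by (intro mult_mono F G p) auto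
    have "F (p, x) * G (p, x) - F (p, y) * G (p, y)
        = F (p, x) * (G (p, x) - G (p, y)) + (F (p, x) - F (p, y)) * G (p, y)"
      by (simp add: algebra_simps)
    also have "\<bar>\<dots>\<bar> \<le> \<bar>F (p, x)\<bar> * \<bar>G (p, x) - G (p, y)\<bar> + \<bar>F (p, x) - F (p, y)\<bar> * \<bar>G (p, y)\<bar>"
      by (metis abs_mult abs_triangle_ineq)
    also have "\<dots> \<le> B * (K' * norm (x - y)) + (K * norm (x - y)) * B'"
      by (intro add_mono mult_mono F G p) (use F G in auto)
    finally show "\<bar>F (p, x) * G (p, x) - F (p, y) * G (p, y)\<bar> \<le> (B * K' + K * B') * norm (x - y)"
      by (simp add: algebra_simps)
  qed (intro continuous_intros F G)
qed

lemma lip_family_minus: "lip_family P F \<Longrightarrow> lip_family P (\<lambda>z. - F z)"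
  unfolding lip_family_def by (auto intro!: continuous_intros simp: abs_minus_commute)

lemma lip_family_diff: "lip_family P F \<Longrightarrow> lip_family P G \<Longrightarrow> lip_family P (\<lambda>z. F z - G z)"
  using lip_family_add[OF _ lip_family_minus] by force

lemma lip_family_power: "compact P \<Longrightarrow> lip_family P F \<Longrightarrow> lip_family P (\<lambda>z. F z ^ n)"
  by (induction n) (auto intro: lip_family_mult lip_family_param[where u = "\<lambda>_. 1"])

text \<open>Together with the upper bound contained in \<open>lip_family\<close>, the lower bound
  \<open>l\<close> confines the values of \<open>F\<close> to a compact interval, on which \<phi>'
  is bounded.\<close>

lemma lip_family_compose:
  assumes F: "lip_family P F" and l: "\<And>p x. p \<in> P \<Longrightarrow> l \<le> F (p, x)"
    and d: "\<And>x. l \<le> x \<Longrightarrow> (\<phi> has_real_derivative \<phi>' x) (at x)" and c: "continuous_on {l..} \<phi>'"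
  shows "lip_family P (\<lambda>z. \<phi> (F z))"
proof -
  obtain B K where FF: "0 \<le> B" "0 \<le> K" "continuous_on (P \<times> UNIV) F" "\<And>p x. p \<in> P \<Longrightarrow> \<bar>F (p, x)\<bar> \<le> B"
    "\<And>p x y. p \<in> P \<Longrightarrow> \<bar>F (p, x) - F (p, y)\<bar> \<le> K * norm (x - y)"
    by (rule lip_familyE[OF F]) blast
  have rng: "F (p, x) \<in> {l..B}" if "p \<in> P" for p x using l[OF that, of x] FF(4)[OF that, of x] by auto
  have cphi: "continuous_on {l..} \<phi>"
    by (rule DERIV_continuous_on[where D = \<phi>']) (auto intro: has_field_derivative_at_within d)
  have "bounded (\<phi> ` {l..B})" "bounded (\<phi>' ` {l..B})"
    by (auto intro!: compact_imp_bounded compact_continuous_image continuous_on_subset[OF c] continuous_on_subset[OF cphi])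
  then obtain M N where M: "\<And>x. x \<in> {l..B} \<Longrightarrow> \<bar>\<phi> x\<bar> \<le> M" and N: "\<And>x. x \<in> {l..B} \<Longrightarrow> \<bar>\<phi>' x\<bar> \<le> N"
    by (auto simp: bounded_iff simp del: atLeastAtMost_iff)
  show ?thesis
  proof (rule lip_familyI[where B = M and K = "\<bar>N\<bar> * K"])
    show "continuous_on (P \<times> UNIV) (\<lambda>z. \<phi> (F z))"
      by (rule continuous_on_compose2[OF cphi FF(3)]) (use l in auto)
    fix p x y assume p: "p \<in> P"
    show "\<bar>\<phi> (F (p, x))\<bar> \<le> M" using rng[OF p] by (rule M)
    have "norm (\<phi> (F (p, x)) - \<phi> (F (p, y))) \<le> \<bar>N\<bar> * norm (F (p, x) - F (p, y))"
    proof (rule field_differentiable_bound[where S = "{l..B}"])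
      fix z assume z: "z \<in> {l..B}"
      show "(\<phi> has_field_derivative \<phi>' z) (at z within {l..B})" using d z by (auto intro: has_field_derivative_at_within)
      show "norm (\<phi>' z) \<le> \<bar>N\<bar>" using N[OF z] by simp
    qed (use rng[OF p] in auto)
    also have "\<dots> \<le> \<bar>N\<bar> * (K * norm (x - y))" using FF(5)[OF p, of x y] by (intro mult_left_mono) auto
    finally show "\<bar>\<phi> (F (p, x)) - \<phi> (F (p, y))\<bar> \<le> \<bar>N\<bar> * K * norm (x - y)" by (simp add: mult.assoc)
  qed
qed

text \<open>The level 2 leaves room around the values of \<open>cos\<close> and \<open>sin\<close>,
  so the truncation is inactive on every solution that stays close to the cosine.\<close>

definition clamp2 :: "real \<Rightarrow> real" where "clamp2 x = max (-2) (min 2 x)"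

lemma clamp2_bound: "\<bar>clamp2 x\<bar> \<le> 2" by (auto simp: clamp2_def)

lemma clamp2_id: "\<bar>x\<bar> \<le> 2 \<Longrightarrow> clamp2 x = x" by (auto simp: clamp2_def)

lemma clamp2_lip: "\<bar>clamp2 x - clamp2 y\<bar> \<le> \<bar>x - y\<bar>" by (auto simp: clamp2_def)

lemma lip_family_clamp2:
  fixes \<pi> :: "'a::real_normed_vector \<Rightarrow> real"
  assumes "bounded_linear \<pi>"
  shows "lip_family P (\<lambda>z. clamp2 (\<pi> (snd z)))"
proof -
  obtain K where K: "\<And>x. norm (\<pi> x) \<le> norm x * K" using bounded_linear.bounded[OF assms] by blast
  have c: "continuous_on UNIV clamp2" unfolding clamp2_def by (intro continuous_intros)
  show ?thesis
  proof (rule lip_familyI[where B = 2 and K = K])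
    show "continuous_on (P \<times> UNIV) (\<lambda>z. clamp2 (\<pi> (snd z)))"
      by (intro continuous_on_compose2[OF c] bounded_linear.continuous_on[OF assms] continuous_intros) auto
    show "\<bar>clamp2 (\<pi> (snd (p, x))) - clamp2 (\<pi> (snd (p, y)))\<bar> \<le> K * norm (x - y)" for p x y
      using clamp2_lip[of "\<pi> x" "\<pi> y"] K[of "x - y"]
      by (simp add: linear_diff[OF bounded_linear.linear[OF assms]] mult.commute)
  qed (simp add: clamp2_bound)
qed

section \<open>The rescaled profile equation\<close>

text \<open>Both choices of \<open>g\<close> enter through these properties only. Positivity of
  \<open>g'\<close> makes the Hopf value of \<open>k\<close> positive, and hence
  \<open>C\<^sub>0 = -k\<close> non-zero.\<close>

locale film_flow =
  fixes a b c :: real and g g' :: "real \<Rightarrow> real"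
  assumes a: "0 < a" and b: "0 < b" and c: "0 \<le> c"
    and g_pos: "\<And>x. 1 < x \<Longrightarrow> 0 < g x"
    and g_deriv: "\<And>x. 1 < x \<Longrightarrow> (g has_real_derivative g' x) (at x)"
    and g'_cont: "continuous_on {1<..} g'"
    and g'_pos: "\<And>x. 1 < x \<Longrightarrow> 0 < g' x"
begin

text \<open>This is the divided difference \<open>(g (A + x) - g A) / x\<close>, in the integral
  form that remains continuous at \<open>x = 0\<close>, where its value is
  \<open>g' A\<close>.\<close>

definition gslope :: "real \<Rightarrow> real \<Rightarrow> real" where
  "gslope A x = integral {0..1} (\<lambda>t. g' (A + t * x))"

lemma segment_gt_1:
  assumes "1 < A" "1 < A + x" "t \<in> {0..1}"
  shows "1 < A + t * (x::real)"
proof (cases "0 \<le> x")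
  case True
  then have "0 \<le> t * x" using assms by simp
  then show ?thesis using assms by linarith
next
  case False
  then have "x \<le> t * x" using assms mult_right_mono_neg[of t 1 x] by simp
  then show ?thesis using assms by simp
qed

lemma gslope_cont:
  "continuous_on {z. 1 < fst z \<and> 1 < fst z + snd z} (\<lambda>z. gslope (fst z) (snd z))"
proof -
  let ?S = "{z::real\<times>real. 1 < fst z \<and> 1 < fst z + snd z}"
  have "continuous_on (?S \<times> cbox 0 1) (\<lambda>(z,t). g' (fst z + t * snd z))"
    unfolding split_beta
    by (rule continuous_on_compose2[OF g'_cont])
       (use segment_gt_1 in \<open>auto intro!: continuous_intros\<close>)
  from integral_continuous_on_param[OF this] show ?thesis by (simp add: gslope_def)
qed

lemma gslope_eq:
  assumes "1 < A" "1 < A + x"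
  shows "g (A + x) - g A = x * gslope A x"
proof -
  have "((\<lambda>t. x * g' (A + t * x)) has_integral g (A + 1 * x) - g (A + 0 * x)) {0..1}"
  proof (rule fundamental_theorem_of_calculus)
    fix t :: real assume t: "t \<in> {0..1}"
    have "((\<lambda>t. g (A + t * x)) has_real_derivative g' (A + t * x) * x) (at t)"
      by (rule DERIV_chain2[OF g_deriv]) (use segment_gt_1 assms t in \<open>auto intro!: derivative_eq_intros\<close>)
    then show "((\<lambda>t. g (A + t * x)) has_vector_derivative x * g' (A + t * x)) (at t within {0..1})"
      by (simp add: mult.commute has_real_derivative_iff_has_vector_derivative has_vector_derivative_at_within)
  qed simp
  from integral_unique[OF this] show ?thesis by (simp add: gslope_def)
qed

lemma g_cont: "continuous_on {1<..} g"
  by (rule DERIV_continuous_on[where D = g']) (auto intro: has_field_derivative_at_within g_deriv)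

text \<open>For \<open>e > 0\<close> the product is \<open>(g (A + e * Y) - g A) / e\<close>. Its
  increments in \<open>Y\<close> are again divided differences of \<open>g\<close>, bounded by the
  maximum of \<open>\<bar>g'\<bar>\<close> uniformly in \<open>e\<close>. The product is treated as
  a whole because \<open>gslope\<close> alone need not be Lipschitz when \<open>g'\<close> is merely
  continuous.\<close>

lemma lip_family_gslope:
  assumes P: "compact P" and cont: "continuous_on P A" "continuous_on P e"
    and lo: "1 < lo" "\<And>p. p \<in> P \<Longrightarrow> 0 \<le> e p \<and> lo + 2 * e p \<le> A p"
    and Y: "lip_family P Y" "\<And>p x. p \<in> P \<Longrightarrow> \<bar>Y (p, x)\<bar> \<le> 2"
  shows "lip_family P (\<lambda>z. Y z * gslope (A (fst z)) (e (fst z) * Y z))"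
proof -
  obtain B K where K: "0 \<le> B" "0 \<le> K" "continuous_on (P \<times> UNIV) Y" "\<And>p x. p \<in> P \<Longrightarrow> \<bar>Y (p, x)\<bar> \<le> B"
    "\<And>p x y. p \<in> P \<Longrightarrow> \<bar>Y (p, x) - Y (p, y)\<bar> \<le> K * norm (x - y)"
    by (rule lip_familyE[OF Y(1)]) blast
  have ey: "lo \<le> A p + e p * y \<and> \<bar>e p * y\<bar> \<le> 2 * e p" if "p \<in> P" "\<bar>y\<bar> \<le> 2" for p y
  proof -
    have "\<bar>e p * y\<bar> \<le> e p * 2" unfolding abs_mult using lo(2)[OF that(1)] that by (intro mult_mono) auto
    then show ?thesis using lo(2)[OF that(1)] by linarith
  qed
  have Alo: "lo \<le> A p" if "p \<in> P" for p using lo(2)[OF that] by linarith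
  have fstc: "continuous_on (P \<times> (UNIV::'b set)) (\<lambda>z. A (fst z))" "continuous_on (P \<times> (UNIV::'b set)) (\<lambda>z. e (fst z))"
    by (auto intro!: continuous_on_compose2[OF cont(1)] continuous_on_compose2[OF cont(2)] continuous_intros)
  have cJ: "continuous_on (P \<times> UNIV) (\<lambda>z. gslope (fst (A (fst z), e (fst z) * Y z)) (snd (A (fst z), e (fst z) * Y z)))"
  proof (rule continuous_on_compose2[OF gslope_cont])
    show "(\<lambda>z. (A (fst z), e (fst z) * Y z)) ` (P \<times> UNIV) \<subseteq> {z. 1 < fst z \<and> 1 < fst z + snd z}"
      using ey Y(2) Alo lo(1) by (auto, (smt (verit))+)
  qed (intro continuous_intros fstc K)
  obtain S where S: "\<And>p. p \<in> P \<Longrightarrow> A p + 2 * e p \<le> S"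
  proof -
    have "bounded ((\<lambda>p. A p + 2 * e p) ` P)"
      by (intro compact_imp_bounded compact_continuous_image P continuous_intros cont)
    then obtain S where "\<forall>x\<in>(\<lambda>p. A p + 2 * e p) ` P. norm x \<le> S" unfolding bounded_iff by blast
    then have "A p + 2 * e p \<le> S" if "p \<in> P" for p using that by fastforce
    then show thesis by (rule that)
  qed
  have "bounded (g' ` {lo..S})"
    by (intro compact_imp_bounded compact_continuous_image continuous_on_subset[OF g'_cont]) (use lo in auto)
  then obtain M where M: "\<And>x. x \<in> {lo..S} \<Longrightarrow> \<bar>g' x\<bar> \<le> M"
    by (auto simp: bounded_iff simp del: atLeastAtMost_iff)
  have Jb: "\<bar>gslope x y\<bar> \<le> \<bar>M\<bar>" if "x \<in> {lo..S}" "x + y \<in> {lo..S}" for x y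
  proof -
    have "norm (integral {0..1} (\<lambda>t. g' (x + t * y))) \<le> integral {0..1} (\<lambda>t::real. \<bar>M\<bar>)"
    proof (rule integral_norm_bound_integral)
      have seg: "x + t * y \<in> {lo..S}" if "t \<in> {0..1}" for t
      proof -
        have "(1 - t) *\<^sub>R x + t *\<^sub>R (x + y) \<in> {lo..S}"
          using that by (intro convexD_alt \<open>x \<in> {lo..S}\<close> \<open>x + y \<in> {lo..S}\<close>) auto
        then show ?thesis by (simp add: algebra_simps)
      qed
      have "(\<lambda>t. x + t * y) ` {0..1} \<subseteq> {1<..}"
      proof
        fix v assume "v \<in> (\<lambda>t. x + t * y) ` {0..1}"
        then have "v \<in> {lo..S}" using seg by blast
        then show "v \<in> {1<..}" using lo(1) by simp
      qed
      then show "(\<lambda>t. g' (x + t * y)) integrable_on {0..1}"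
        by (intro integrable_continuous_real continuous_on_compose2[OF g'_cont] continuous_intros)
      show "norm (g' (x + t * y)) \<le> \<bar>M\<bar>" if "t \<in> {0..1}" for t
      proof -
        have "\<bar>g' (x + t * y)\<bar> \<le> M" by (intro M seg that)
        then show ?thesis by simp
      qed
    qed (simp add: integrable_const_ivl)
    then show ?thesis by (simp add: gslope_def)
  qed
  have rng: "A p + e p * y \<in> {lo..S}" if "p \<in> P" "\<bar>y\<bar> \<le> 2" for p y
    using ey[OF that] S[OF that(1)] by auto
  have Arng: "A p \<in> {lo..S}" if "p \<in> P" for p
    using rng[OF that, of 0] by simp
  show ?thesis
  proof (rule lip_familyI[where B = "2 * \<bar>M\<bar>" and K = "\<bar>M\<bar> * K"])
    show "continuous_on (P \<times> UNIV) (\<lambda>z. Y z * gslope (A (fst z)) (e (fst z) * Y z))"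
      using cJ K(3) by (intro continuous_intros) auto
    fix p x y assume p: "p \<in> P"
    show "\<bar>Y (p, x) * gslope (A (fst (p, x))) (e (fst (p, x)) * Y (p, x))\<bar> \<le> 2 * \<bar>M\<bar>"
      unfolding abs_mult fst_conv by (intro mult_mono Y(2) Jb Arng rng p) auto
    let ?u = "Y (p, x)" and ?v = "Y (p, y)"
    have u: "\<bar>?u\<bar> \<le> 2" and v: "\<bar>?v\<bar> \<le> 2" using Y(2)[OF p] by auto
    have uv: "A p + e p * ?v + e p * (?u - ?v) = A p + e p * ?u" by (simp add: algebra_simps)
    have "?u * gslope (A p) (e p * ?u) - ?v * gslope (A p) (e p * ?v) = (?u - ?v) * gslope (A p + e p * ?v) (e p * (?u - ?v))"
    proof (cases "e p = 0")
      case True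
      then show ?thesis by (simp add: algebra_simps)
    next
      case False
      have "e p * (?u * gslope (A p) (e p * ?u)) = g (A p + e p * ?u) - g (A p)"
        using gslope_eq[of "A p" "e p * ?u"] ey[OF p u] Alo[OF p] lo(1) by simp
      moreover have "e p * (?v * gslope (A p) (e p * ?v)) = g (A p + e p * ?v) - g (A p)"
        using gslope_eq[of "A p" "e p * ?v"] ey[OF p v] Alo[OF p] lo(1) by simp
      moreover have "e p * ((?u - ?v) * gslope (A p + e p * ?v) (e p * (?u - ?v))) = g (A p + e p * ?u) - g (A p + e p * ?v)"
        using gslope_eq[of "A p + e p * ?v" "e p * (?u - ?v)"] ey[OF p v] ey[OF p u] lo(1) by (simp add: uv)
      ultimately have "e p * (?u * gslope (A p) (e p * ?u) - ?v * gslope (A p) (e p * ?v))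
          = e p * ((?u - ?v) * gslope (A p + e p * ?v) (e p * (?u - ?v)))" by (simp add: right_diff_distrib)
      then show ?thesis using False by simp
    qed
    also have "\<bar>\<dots>\<bar> \<le> (K * norm (x - y)) * \<bar>M\<bar>"
      unfolding abs_mult by (intro mult_mono K p Jb rng v) (use rng[OF p u] uv K in auto)
    finally show "\<bar>Y (p, x) * gslope (A (fst (p, x))) (e (fst (p, x)) * Y (p, x)) -
            Y (p, y) * gslope (A (fst (p, y))) (e (fst (p, y)) * Y (p, y))\<bar> \<le> \<bar>M\<bar> * K * norm (x - y)"
      by (simp add: mult_ac)
  qed
qed

text \<open>
  The third derivative of \<open>y\<close> in \<open>H(\<xi>) = A + e y(w \<xi>)\<close>. The last summand is \<open>(1 - U / g(H)) / e\<close>, where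
  \<open>s\<close> is chosen such that \<open>1 - U / g(H) = e r\<close> at \<open>H = A\<close>; \<^term>\<open>gslope\<close> makes it continuous at \<open>e = 0\<close>.
\<close>

definition profile_field :: "real \<Rightarrow> real \<Rightarrow> real \<Rightarrow> real \<Rightarrow> real \<Rightarrow> real \<Rightarrow> real \<Rightarrow> real \<Rightarrow> real" where
  "profile_field A w k r e y0 y1 y2 = (let h = A + e * y0; V = h\<^sup>2 - 1; D = 1 + (e * w * y1)\<^sup>2 in
     - (D * y1 * (1 / h\<^sup>2) * (1 / w\<^sup>2)) - e * y1 * y2 * (1 / h) + 3 * e\<^sup>2 * w\<^sup>2 * y1 * y2\<^sup>2 * (1 / D)
     - (D * sqrt D * (1 / b)) *
        ((2 * k\<^sup>2 / a) * (h / V ^ 3) * y1 * (1 / w\<^sup>2)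
         + (2 * c * k / a) * (h / V\<^sup>2 * y2 - e * ((h\<^sup>2 + 1) / V ^ 3) * y1\<^sup>2) * (1 / w)
         + (y0 * gslope A (e * y0) + r * g A - (k / a) * y0 * (2 * A + e * y0) * (1 / V) * (1 / (A\<^sup>2 - 1)))
           * (1 / g h) * (1 / w ^ 3)))"

lemma lip_family_profile_field:
  fixes y0 y1 y2 :: "'p::metric_space \<times> 'x::real_normed_vector \<Rightarrow> real"
  assumes P: "compact P" and cont: "continuous_on P A" "continuous_on P w" "continuous_on P k" "continuous_on P r" "continuous_on P e"
    and lo: "1 < lo" "\<And>p. p \<in> P \<Longrightarrow> 0 \<le> e p \<and> lo + 2 * e p \<le> A p" and w: "\<And>p. p \<in> P \<Longrightarrow> 0 < w p"
    and y: "lip_family P y0" "lip_family P y1" "lip_family P y2" and y0: "\<And>p x. p \<in> P \<Longrightarrow> \<bar>y0 (p, x)\<bar> \<le> 2"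
  shows "lip_family P (\<lambda>z. profile_field (A (fst z)) (w (fst z)) (k (fst z)) (r (fst z)) (e (fst z)) (y0 z) (y1 z) (y2 z))"
proof -
  have ey: "lo \<le> A p + e p * y" if "p \<in> P" "\<bar>y\<bar> \<le> 2" for p y
  proof -
    have "\<bar>e p * y\<bar> \<le> e p * 2" unfolding abs_mult using lo(2)[OF that(1)] that by (intro mult_mono) auto
    then show ?thesis using lo(2)[OF that(1)] by linarith
  qed
  have Alo: "lo \<le> A p" if "p \<in> P" for p using lo(2)[OF that] by linarith
  have V: "x\<^sup>2 - 1 \<noteq> 0" if "lo \<le> x" for x
  proof -
    have "1 < x\<^sup>2" by (rule one_less_power) (use that lo(1) in auto)
    then show ?thesis by simp
  qed
  note pars = lip_family_param[OF P cont(1)] lip_family_param[OF P cont(2)] lip_family_param[OF P cont(3)]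
     lip_family_param[OF P cont(4)] lip_family_param[OF P cont(5)]
  note base = lip_family_add lip_family_diff lip_family_minus lip_family_mult lip_family_power[OF P]
     lip_family_param[OF P continuous_on_const]
  define h where "h z = A (fst z) + e (fst z) * y0 z" for z
  have hlo: "lo \<le> h (p, x)" if "p \<in> P" for p x
    using ey[OF that y0[OF that]] by (simp add: h_def)
  have h: "lip_family P h" unfolding h_def by (intro base pars y)
  define D where "D z = 1 + (e (fst z) * w (fst z) * y1 z)\<^sup>2" for z
  have D: "lip_family P D" unfolding D_def by (intro base pars y)
  have D1: "1 \<le> D z" for z by (simp add: D_def)
  have invD: "lip_family P (\<lambda>z. 1 / D z)"
    by (rule lip_family_compose[OF D, where l = 1 and \<phi>' = "\<lambda>x. - 1 / x\<^sup>2"])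
       (use D1 in \<open>auto intro!: derivative_eq_intros continuous_intros simp: power2_eq_square\<close>)
  have sqD: "lip_family P (\<lambda>z. sqrt (D z))"
    by (rule lip_family_compose[OF D, where l = 1 and \<phi>' = "\<lambda>x. inverse (sqrt x) / 2"])
       (use D1 in \<open>auto intro!: derivative_eq_intros continuous_intros\<close>)
  have invh: "lip_family P (\<lambda>z. 1 / h z)"
    by (rule lip_family_compose[OF h hlo, where \<phi>' = "\<lambda>x. - 1 / x\<^sup>2"])
       (use lo(1) in \<open>auto intro!: derivative_eq_intros continuous_intros simp: power2_eq_square\<close>)
  have invV: "lip_family P (\<lambda>z. 1 / ((h z)\<^sup>2 - 1))"
    by (rule lip_family_compose[OF h hlo, where \<phi>' = "\<lambda>x. - (2 * x) / (x\<^sup>2 - 1)\<^sup>2"])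
       (use lo(1) V in \<open>auto intro!: derivative_eq_intros continuous_intros simp: power2_eq_square\<close>)
  have invg: "lip_family P (\<lambda>z. 1 / g (h z))"
  proof (rule lip_family_compose[OF h hlo, where \<phi>' = "\<lambda>x. - g' x / (g x)\<^sup>2"])
    show "((\<lambda>x. 1 / g x) has_real_derivative - g' x / (g x)\<^sup>2) (at x)" if "lo \<le> x" for x
      using that lo(1) g_pos[of x] by (auto intro!: derivative_eq_intros g_deriv simp: power2_eq_square)
    have "{lo..} \<subseteq> {1<..}" using lo(1) by auto
    note sub = continuous_on_subset[OF g'_cont this] continuous_on_subset[OF g_cont this]
    have "g x \<noteq> 0" if "lo \<le> x" for x using g_pos[of x] that lo(1) by simp
    then show "continuous_on {lo..} (\<lambda>x. - g' x / (g x)\<^sup>2)"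
      by (intro continuous_intros sub) auto
  qed auto
  have cgA: "continuous_on P (\<lambda>p. g (A p))"
    by (rule continuous_on_compose2[OF g_cont cont(1)]) (use Alo lo(1) in force)
  have cw: "continuous_on P (\<lambda>p. 1 / w p ^ n)" for n
    using w by (intro continuous_intros cont) force
  have cV: "continuous_on P (\<lambda>p. 1 / ((A p)\<^sup>2 - 1))"
    using Alo V by (intro continuous_intros cont) force
  have gs: "lip_family P (\<lambda>z. y0 z * gslope (A (fst z)) (e (fst z) * y0 z))"
    by (rule lip_family_gslope[OF P cont(1,5) lo y(1) y0])
  note pars2 = lip_family_param[OF P cgA] lip_family_param[OF P cw] lip_family_param[OF P cw[of 1, unfolded power_one_right]] lip_family_param[OF P cV]
  have ka: "lip_family P (\<lambda>z::'p \<times> 'x. k (fst z) / a)" "lip_family P (\<lambda>z::'p \<times> 'x. 2 * (k (fst z))\<^sup>2 / a)"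
    "lip_family P (\<lambda>z::'p \<times> 'x. 2 * c * k (fst z) / a)"
  proof -
    have "lip_family P (\<lambda>z::'p \<times> 'x. k (fst z) * (1 / a))" "lip_family P (\<lambda>z::'p \<times> 'x. 2 * (k (fst z))\<^sup>2 * (1 / a))"
      "lip_family P (\<lambda>z::'p \<times> 'x. 2 * c * k (fst z) * (1 / a))"
      by (intro base pars)+
    then show "lip_family P (\<lambda>z::'p \<times> 'x. k (fst z) / a)" "lip_family P (\<lambda>z::'p \<times> 'x. 2 * (k (fst z))\<^sup>2 / a)"
      "lip_family P (\<lambda>z::'p \<times> 'x. 2 * c * k (fst z) / a)" by simp_all
  qed
  have eq: "profile_field (A (fst z)) (w (fst z)) (k (fst z)) (r (fst z)) (e (fst z)) (y0 z) (y1 z) (y2 z) =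
     - (D z * y1 z * (1 / h z)\<^sup>2 * (1 / (w (fst z))\<^sup>2)) - e (fst z) * y1 z * y2 z * (1 / h z) + 3 * (e (fst z))\<^sup>2 * (w (fst z))\<^sup>2 * y1 z * (y2 z)\<^sup>2 * (1 / D z)
     - (D z * sqrt (D z) * (1 / b)) *
        ((2 * (k (fst z))\<^sup>2 / a) * (h z * (1 / ((h z)\<^sup>2 - 1)) ^ 3) * y1 z * (1 / (w (fst z))\<^sup>2)
         + (2 * c * k (fst z) / a) * (h z * (1 / ((h z)\<^sup>2 - 1))\<^sup>2 * y2 z - e (fst z) * (((h z)\<^sup>2 + 1) * (1 / ((h z)\<^sup>2 - 1)) ^ 3) * (y1 z)\<^sup>2) * (1 / w (fst z))
         + (y0 z * gslope (A (fst z)) (e (fst z) * y0 z) + r (fst z) * g (A (fst z)) - (k (fst z) / a) * y0 z * (2 * A (fst z) + e (fst z) * y0 z) * (1 / ((h z)\<^sup>2 - 1)) * (1 / ((A (fst z))\<^sup>2 - 1)))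
           * (1 / g (h z)) * (1 / w (fst z) ^ 3))" for z
    unfolding profile_field_def Let_def h_def[symmetric] D_def[symmetric] by (simp add: power_divide)
  show ?thesis
    unfolding eq by (intro base pars pars2 ka gs invD sqD invh invV invg h D y)
qed

text \<open>The truncated system is globally Lipschitz, so its solution covers a full period for
  every parameter and depends continuously on it. The last clause anchors the perturbation argument:
  the iteration starts at the cosine and stays there when the cosine is a solution.\<close>

lemma profile_flow:
  fixes A w k r e :: "'p::metric_space \<Rightarrow> real"
  assumes P: "compact P" and cont: "continuous_on P A" "continuous_on P w" "continuous_on P k" "continuous_on P r" "continuous_on P e"
    and lo: "1 < lo" "\<And>p. p \<in> P \<Longrightarrow> 0 \<le> e p \<and> lo + 2 * e p \<le> A p" and w: "\<And>p. p \<in> P \<Longrightarrow> 0 < w p"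
  defines "I \<equiv> {0..2*pi}"
  obtains Y :: "'p \<Rightarrow> real \<Rightarrow> real \<times> real \<times> real"
  where "continuous_on (P \<times> I) (\<lambda>z. Y (fst z) (snd z))"
    "\<And>p. p \<in> P \<Longrightarrow> Y p 0 = (1, 0, -1)"
    "\<And>p t. p \<in> P \<Longrightarrow> t \<in> I \<Longrightarrow> ((\<lambda>t. fst (Y p t)) has_real_derivative clamp2 (fst (snd (Y p t)))) (at t within I)"
    "\<And>p t. p \<in> P \<Longrightarrow> t \<in> I \<Longrightarrow> ((\<lambda>t. fst (snd (Y p t))) has_real_derivative clamp2 (snd (snd (Y p t)))) (at t within I)"
    "\<And>p t. p \<in> P \<Longrightarrow> t \<in> I \<Longrightarrow> ((\<lambda>t. snd (snd (Y p t))) has_real_derivative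
        profile_field (A p) (w p) (k p) (r p) (e p) (clamp2 (fst (Y p t))) (clamp2 (fst (snd (Y p t)))) (clamp2 (snd (snd (Y p t))))) (at t within I)"
    "\<And>p t. p \<in> P \<Longrightarrow> t \<in> I \<Longrightarrow> (\<And>t. profile_field (A p) (w p) (k p) (r p) (e p) (cos t) (- sin t) (- cos t) = sin t) \<Longrightarrow>
        Y p t = (cos t, - sin t, - cos t)"
proof -
  define c0 where "c0 z = clamp2 (fst (snd z))" for z :: "'p \<times> real \<times> real \<times> real"
  define c1 where "c1 z = clamp2 (fst (snd (snd z)))" for z :: "'p \<times> real \<times> real \<times> real"
  define c2 where "c2 z = clamp2 (snd (snd (snd z)))" for z :: "'p \<times> real \<times> real \<times> real"
  define v where "v z = profile_field (A (fst z)) (w (fst z)) (k (fst z)) (r (fst z)) (e (fst z)) (c0 z) (c1 z) (c2 z)" for z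
  have lc: "lip_family P c0" "lip_family P c1" "lip_family P c2"
    unfolding c0_def c1_def c2_def
    by (intro lip_family_clamp2[of fst] lip_family_clamp2[of "\<lambda>x. fst (snd x)"] lip_family_clamp2[of "\<lambda>x. snd (snd x)"]
        bounded_linear_fst bounded_linear_fst_comp bounded_linear_snd_comp bounded_linear_snd)+
  have lv: "lip_family P v"
    unfolding v_def by (rule lip_family_profile_field[OF P cont lo w lc]) (simp_all add: c0_def clamp2_bound)
  obtain K1 where K1: "0 \<le> K1" "\<And>p x y. p \<in> P \<Longrightarrow> \<bar>c1 (p, x) - c1 (p, y)\<bar> \<le> K1 * norm (x - y)"
    by (rule lip_familyE[OF lc(2)]) blast
  obtain K2 where K2: "0 \<le> K2" "\<And>p x y. p \<in> P \<Longrightarrow> \<bar>c2 (p, x) - c2 (p, y)\<bar> \<le> K2 * norm (x - y)"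
    by (rule lip_familyE[OF lc(3)]) blast
  obtain K3 where K3: "0 \<le> K3" "\<And>p x y. p \<in> P \<Longrightarrow> \<bar>v (p, x) - v (p, y)\<bar> \<le> K3 * norm (x - y)"
    by (rule lip_familyE[OF lv]) blast
  define \<Phi> where "\<Phi> p x = (c1 (p, x), c2 (p, x), v (p, x))" for p x
  define Z where "Z t = (cos t, - sin t, - cos t)" for t :: real
  have lip: "norm (\<Phi> p x - \<Phi> p y) \<le> (K1 + K2 + K3) * norm (x - y)" if "p \<in> P" for p x y
  proof -
    have "norm (\<Phi> p x - \<Phi> p y) \<le> \<bar>c1 (p, x) - c1 (p, y)\<bar> + (\<bar>c2 (p, x) - c2 (p, y)\<bar> + \<bar>v (p, x) - v (p, y)\<bar>)"
      unfolding \<Phi>_def diff_Pair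
      by (rule order_trans[OF norm_Pair_le add_mono[OF _ order_trans[OF norm_Pair_le]]]) simp_all
    also have "\<dots> \<le> (K1 + K2 + K3) * norm (x - y)"
      using K1(2)[OF that, of x y] K2(2)[OF that, of x y] K3(2)[OF that, of x y] by (simp add: algebra_simps)
    finally show ?thesis .
  qed
  have "continuous_on (P \<times> UNIV) c1" "continuous_on (P \<times> UNIV) c2" "continuous_on (P \<times> UNIV) v"
    using lc lv unfolding lip_family_def by auto
  then have contPhi: "continuous_on (P \<times> UNIV) (\<lambda>z. \<Phi> (fst z) (snd z))"
    unfolding \<Phi>_def by (simp add: continuous_on_Pair)
  have contZ: "continuous_on {0..2*pi} Z" unfolding Z_def by (intro continuous_intros)
  have T0: "0 \<le> 2 * pi" and K0: "0 \<le> K1 + K2 + K3" using K1(1) K2(1) K3(1) by simp_all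
  obtain Y where Y: "continuous_on (P \<times> I) (\<lambda>z. Y (fst z) (snd z))" "\<And>p. p \<in> P \<Longrightarrow> Y p 0 = Z 0"
    "\<And>p t. p \<in> P \<Longrightarrow> t \<in> I \<Longrightarrow> (Y p has_vector_derivative \<Phi> p (Y p t)) (at t within I)"
    "\<And>p t. p \<in> P \<Longrightarrow> t \<in> I \<Longrightarrow> (\<And>t. t \<in> I \<Longrightarrow> (Z has_vector_derivative \<Phi> p (Z t)) (at t within I)) \<Longrightarrow> Y p t = Z t"
    unfolding I_def by (rule picard_flow[OF P T0 K0 contPhi _ contZ], erule lip, blast)
  note lin = bounded_linear.has_vector_derivative[OF bounded_linear_fst]
    bounded_linear.has_vector_derivative[OF bounded_linear_fst_comp[OF bounded_linear_snd]]
    bounded_linear.has_vector_derivative[OF bounded_linear_snd_comp[OF bounded_linear_snd]]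
  show thesis
  proof
    show "continuous_on (P \<times> I) (\<lambda>z. Y (fst z) (snd z))" by (rule Y(1))
    show "Y p 0 = (1, 0, -1)" if "p \<in> P" for p using Y(2)[OF that] by (simp add: Z_def)
    fix p t assume p: "p \<in> P" and t: "t \<in> I"
    note D = lin[OF Y(3)[OF p t]]
    show "((\<lambda>t. fst (Y p t)) has_real_derivative clamp2 (fst (snd (Y p t)))) (at t within I)"
      using D(1) by (simp add: \<Phi>_def c1_def has_real_derivative_iff_has_vector_derivative)
    show "((\<lambda>t. fst (snd (Y p t))) has_real_derivative clamp2 (snd (snd (Y p t)))) (at t within I)"
      using D(2) by (simp add: \<Phi>_def c2_def has_real_derivative_iff_has_vector_derivative)
    show "((\<lambda>t. snd (snd (Y p t))) has_real_derivative
        profile_field (A p) (w p) (k p) (r p) (e p) (clamp2 (fst (Y p t))) (clamp2 (fst (snd (Y p t)))) (clamp2 (snd (snd (Y p t))))) (at t within I)"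
      using D(3) by (simp add: \<Phi>_def v_def c0_def c1_def c2_def has_real_derivative_iff_has_vector_derivative)
    assume cosine: "\<And>t. profile_field (A p) (w p) (k p) (r p) (e p) (cos t) (- sin t) (- cos t) = sin t"
    have "Y p t = Z t"
    proof (rule Y(4)[OF p t])
      fix t :: real
      have "\<bar>cos t\<bar> \<le> 2" "\<bar>sin t\<bar> \<le> 2"
        using abs_cos_le_one[of t] abs_sin_le_one[of t] by linarith+
      then have "\<Phi> p (Z t) = (- sin t, - cos t, sin t)"
        by (simp add: \<Phi>_def Z_def v_def c0_def c1_def c2_def clamp2_id cosine)
      moreover have "(Z has_vector_derivative (- sin t, - cos t, sin t)) (at t within I)"
        unfolding Z_def
        by (intro has_vector_derivative_Pair)
           (auto simp: has_real_derivative_iff_has_vector_derivative[symmetric] intro!: derivative_eq_intros)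
      ultimately show "(Z has_vector_derivative \<Phi> p (Z t)) (at t within I)" by simp
    qed
    then show "Y p t = (cos t, - sin t, - cos t)" by (simp add: Z_def)
  qed
qed

text \<open>\<open>B\<close> is the slope at \<open>H = A\<close> of
  \<open>U = (s - k / V) / a\<close> as a function of \<open>H\<close>. For
  \<open>x1 = x2 = 0\<close> the conditions \<open>freq\<close> and \<open>cubic\<close> say that
  the linear operator factors as \<open>(D - \<rho>) (D^2 + 1)\<close> with
  \<open>\<rho> = - (c * B / (b * w))\<close>: the former normalises the coefficient of
  \<open>y1\<close>, the latter equates those of \<open>y2\<close> and \<open>y0\<close>.\<close>

lemma profile_field_linear:
  assumes A: "1 < A" and w: "0 < w"
    and cubic: "B * (1 + c * g A * w\<^sup>2) = g' A + x2"
    and freq: "w\<^sup>2 = 1 / A\<^sup>2 + a * (A\<^sup>2 - 1) * B\<^sup>2 / (2 * A * b) - x1"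
    and k: "k = B * a * (A\<^sup>2 - 1)\<^sup>2 / (2 * A)"
  shows "profile_field A w k r 0 y0 y1 y2 = - (c * B / (b * w)) * (y2 + y0) - y1 - (1 / w\<^sup>2 * x1) * y1
     + (1 / (b * g A * w ^ 3) * x2) * y0 - 1 / (b * w ^ 3) * r"
proof -
  define V where "V = A\<^sup>2 - 1"
  have V: "0 < V" unfolding V_def using A one_less_power[of A 2] by simp
  have G: "0 < g A" using g_pos A by blast
  have gs: "gslope A 0 = g' A" by (simp add: gslope_def)
  have 1: "2 * c * k / a * (A / V\<^sup>2 * y2) * (1 / w) = c * B * y2 / w"
    unfolding k V_def[symmetric] using a A V w by (simp add: field_simps power2_eq_square)
  have 2: "(2 * k\<^sup>2 / a) * (A / V ^ 3) * y1 * (1 / w\<^sup>2) = a * V * B\<^sup>2 / (2 * A) * y1 / w\<^sup>2"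
    unfolding k V_def[symmetric] using a A V w by (simp add: field_simps power2_eq_square power3_eq_cube)
  have 3: "k / a * y0 * (2 * A) * (1 / V) * (1 / V) = B * y0"
    unfolding k V_def[symmetric] using a A V w by (simp add: field_simps power2_eq_square power3_eq_cube)
  have "profile_field A w k r 0 y0 y1 y2 = - (y1 * (1 / A\<^sup>2) * (1 / w\<^sup>2))
     - 1 / b * (a * V * B\<^sup>2 / (2 * A) * y1 / w\<^sup>2 + c * B * y2 / w + (y0 * g' A + r * g A - B * y0) * (1 / g A) * (1 / w ^ 3))"
    unfolding profile_field_def Let_def using 1 2 3 by (simp add: V_def[symmetric] gs)
  also have "\<dots> = - ((w\<^sup>2 + x1) * y1 / w\<^sup>2) - c * B * y2 / (b * w)
      + (x2 - B * c * g A * w\<^sup>2) * y0 / (b * g A * w ^ 3) - r / (b * w ^ 3)"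
  proof -
    have "w\<^sup>2 + x1 = 1 / A\<^sup>2 + a * V * B\<^sup>2 / (2 * A * b)" using freq by (simp add: V_def)
    then have "(w\<^sup>2 + x1) * y1 / w\<^sup>2 = y1 * (1 / A\<^sup>2) * (1 / w\<^sup>2) + 1 / b * (a * V * B\<^sup>2 / (2 * A) * y1 / w\<^sup>2)"
      using A w b by (simp add: add_divide_distrib distrib_right)
    moreover have "x2 - B * c * g A * w\<^sup>2 = B - g' A" using cubic by (simp add: algebra_simps)
    moreover have "1 / b * ((y0 * g' A + r * g A - B * y0) * (1 / g A) * (1 / w ^ 3))
        = r / (b * w ^ 3) - (B - g' A) * y0 / (b * g A * w ^ 3)"
      using G w b by (simp add: field_simps)
    ultimately show ?thesis by (simp add: distrib_left)
  qed
  also have "(w\<^sup>2 + x1) * y1 / w\<^sup>2 = y1 + 1 / w\<^sup>2 * x1 * y1" using w by (simp add: field_simps)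
  also have "(x2 - B * c * g A * w\<^sup>2) * y0 / (b * g A * w ^ 3) = 1 / (b * g A * w ^ 3) * x2 * y0 - c * B / (b * w) * y0"
    using w G b by (simp add: field_simps power2_eq_square power3_eq_cube)
  finally show ?thesis by (simp add: algebra_simps add_divide_distrib)
qed

lemma periodic_profile_exists:
  assumes M: "0 < M"
  obtains n :: nat and A w k r e y0 y1 y2 where
    "0 < n" "0 < w" "0 < k" "0 < e" "1 < A - 2 * e"
    "\<And>t. t \<in> {0..2*pi} \<Longrightarrow> (y0 has_real_derivative y1 t) (at t within {0..2*pi})"
    "\<And>t. t \<in> {0..2*pi} \<Longrightarrow> (y1 has_real_derivative y2 t) (at t within {0..2*pi})"
    "\<And>t. t \<in> {0..2*pi} \<Longrightarrow> (y2 has_real_derivative profile_field A w k r e (y0 t) (y1 t) (y2 t)) (at t within {0..2*pi})"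
    "\<And>t. t \<in> {0..2*pi} \<Longrightarrow> \<bar>y0 t\<bar> \<le> 2"
    "y0 (2*pi) = y0 0" "y1 (2*pi) = y1 0" "y2 (2*pi) = y2 0" "y0 pi \<noteq> y0 0" "y1 0 = 0"
    "integral {0..2*pi} (\<lambda>t. (A + e * y0 t)\<^sup>2 - 1) = M / n * w"
proof -
  \<comment> \<open>\<open>W\<close> bounds \<open>(w p)\<^sup>2\<close> on the face
    \<open>A = 2\<close>, where \<open>1 / A\<^sup>2 - x1 \<le> 3/8\<close> and
    \<open>B \<le> 2 * g' 2\<close>. The choice of \<open>n\<close> then makes the limiting mass
    \<open>6 * pi\<close> on that face exceed the target \<mu> times \<open>w\<close>.\<close>
  define W where "W = 3/8 + a * 3 * (2 * g' 2)\<^sup>2 / (4 * b)"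
  have "0 \<le> a * 3 * (2 * g' 2)\<^sup>2 / (4 * b)" using a b by simp
  then have W: "0 < W" unfolding W_def by linarith
  obtain n :: nat where n: "M * sqrt W / (6 * pi) < n" using reals_Archimedean2 by blast
  have "0 < M * sqrt W / (6 * pi)" using M W by simp
  then have n0: "0 < n" using n by (metis of_nat_0_less_iff order_less_trans)
  define \<mu> where "\<mu> = M / n"
  have \<mu>: "0 < \<mu>" "\<mu> * sqrt W < 6 * pi" using M n n0 by (auto simp: \<mu>_def field_simps)
  \<comment> \<open>On the face \<open>A = A1\<close> the limiting mass has to fall below the
    target. As \<open>w > 1/3\<close> throughout, a mass below \<open>\<mu> / 3\<close> is enough;
    the chosen distance to 1 gives at most \<open>5 * \<mu> / 36\<close>.\<close>
  define A1 where "A1 = 1 + min (1/2) (\<mu> / (36 * pi))"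
  have A1: "1 < A1" "A1 \<le> 3/2" using \<mu>(1) by (auto simp: A1_def)
  have A1m: "2 * pi * (A1\<^sup>2 - 1) < \<mu> / 3"
  proof -
    have "A1\<^sup>2 - 1 = (A1 - 1) * (A1 + 1)" by (simp add: power2_eq_square algebra_simps)
    also have "\<dots> \<le> \<mu> / (36 * pi) * (5/2)" using A1 \<mu>(1) by (intro mult_mono) (auto simp: A1_def)
    finally have "2 * pi * (A1\<^sup>2 - 1) \<le> 2 * pi * (\<mu> / (36 * pi) * (5/2))" by (intro mult_left_mono) auto
    also have "\<dots> < \<mu> / 3" using \<mu>(1) by (simp add: field_simps)
    finally show ?thesis .
  qed
  have sub: "{A1..2} \<subseteq> {1<..}" using A1 by auto
  obtain am where am: "am \<in> {A1..2}" "\<And>x. x \<in> {A1..2} \<Longrightarrow> g' am \<le> g' x"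
    using continuous_attains_inf[of "{A1..2}" g'] continuous_on_subset[OF g'_cont sub] A1 by auto
  have gm: "0 < g' am" using am(1) A1 by (intro g'_pos) auto
  \<comment> \<open>The bound \<open>1/8\<close> keeps \<open>1 / A\<^sup>2 - x1\<close> at least
    \<open>1/8\<close> because \<open>A \<le> 2\<close>; the bound \<open>g' am / 2\<close> keeps
    \<open>g' A + x2\<close> positive.\<close>
  define xb where "xb = min (1/8) (g' am / 2)"
  have xb: "0 < xb" "xb \<le> 1/8" using gm by (auto simp: xb_def)
  \<comment> \<open>Together with \<open>lo\<close> below, this gives
    \<open>lo + 2 * e0 = A1\<close>. So \<open>A + e * y\<close> stays above \<open>lo > 1\<close>
    as long as \<open>\<bar>y\<bar> \<le> 2\<close>.\<close>
  define e0 where "e0 = (A1 - 1) / 4"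
  have e0: "0 < e0" using A1 by (simp add: e0_def)
  define lo where "lo = (A1 + 1) / 2"
  have lo: "1 < lo" using A1 by (simp add: lo_def)
  define Q where "Q = {A1..2} \<times> {-xb..xb} \<times> {-xb..xb} \<times> {-xb..xb}"
  define P where "P = Q \<times> {0..e0}"
  have cP: "compact P" unfolding P_def Q_def by (intro compact_Times) simp_all

  \<comment> \<open>Hopf data as continuous functions of the parameters\<close>
  define fA :: "(real \<times> real \<times> real \<times> real) \<times> real \<Rightarrow> real" where "fA p = fst (fst p)" for p
  define f1 :: "(real \<times> real \<times> real \<times> real) \<times> real \<Rightarrow> real" where "f1 p = fst (snd (fst p))" for p
  define f2 :: "(real \<times> real \<times> real \<times> real) \<times> real \<Rightarrow> real" where "f2 p = fst (snd (snd (fst p)))" for p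
  define f3 :: "(real \<times> real \<times> real \<times> real) \<times> real \<Rightarrow> real" where "f3 p = snd (snd (snd (fst p)))" for p
  define fe :: "(real \<times> real \<times> real \<times> real) \<times> real \<Rightarrow> real" where "fe p = snd p" for p
  have cf: "continuous_on S fA" "continuous_on S f1" "continuous_on S f2" "continuous_on S f3" "continuous_on S fe" for S
    unfolding fA_def f1_def f2_def f3_def fe_def by (intro continuous_intros)+
  have rng: "A1 \<le> fA p" "fA p \<le> 2" "1 < fA p" "\<bar>f1 p\<bar> \<le> xb" "\<bar>f2 p\<bar> \<le> xb" "\<bar>f3 p\<bar> \<le> xb" "0 \<le> fe p" "fe p \<le> e0"
    if "p \<in> P" for p
    using that A1 by (auto simp: P_def Q_def fA_def f1_def f2_def f3_def fe_def abs_le_iff)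
  have V: "0 < (fA p)\<^sup>2 - 1" if "p \<in> P" for p
    using one_less_power[OF rng(3)[OF that], of 2] by simp
  have gp: "0 < g (fA p)" "0 < g' (fA p)" if "p \<in> P" for p
    using rng(3)[OF that] g_pos g'_pos by auto
  have invA: "1/4 \<le> 1 / (fA p)\<^sup>2" if "p \<in> P" for p
  proof -
    have "(fA p)\<^sup>2 \<le> 2\<^sup>2" using rng(2,3)[OF that] by (intro power_mono) auto
    then show ?thesis using rng(3)[OF that] by (simp add: field_simps)
  qed
  obtain \<beta> :: "real \<Rightarrow> real \<Rightarrow> real \<Rightarrow> real" where \<beta>: "\<And>k l m. 0 \<le> k \<Longrightarrow> 0 < l \<Longrightarrow> k * \<beta> k l m ^ 3 + l * \<beta> k l m = m"
    and \<beta>_cont: "\<And>(S :: ((real \<times> real \<times> real \<times> real) \<times> real) set) k l m. continuous_on S k \<Longrightarrow> continuous_on S l \<Longrightarrow> continuous_on S m \<Longrightarrow>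
       (\<And>x. x \<in> S \<Longrightarrow> 0 \<le> k x \<and> 0 < l x) \<Longrightarrow> continuous_on S (\<lambda>x. \<beta> (k x) (l x) (m x))"
    by (rule depressed_cubic_root_continuous) blast
  \<comment> \<open>The frequency itself contains \<open>B\<^sup>2\<close>. Inserting its formula
    into the Hopf condition for \<open>B\<close> leaves the cubic with these coefficients.\<close>
  define fk where "fk p = c * g (fA p) * a * ((fA p)\<^sup>2 - 1) / (2 * fA p * b)" for p
  define fl where "fl p = 1 + c * g (fA p) * (1 / (fA p)\<^sup>2 - f1 p)" for p
  define fm where "fm p = g' (fA p) + f2 p" for p
  define B where "B p = \<beta> (fk p) (fl p) (fm p)" for p
  define w where "w p = sqrt (1 / (fA p)\<^sup>2 + a * ((fA p)\<^sup>2 - 1) * (B p)\<^sup>2 / (2 * fA p * b) - f1 p)" for p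
  define k where "k p = B p * a * ((fA p)\<^sup>2 - 1)\<^sup>2 / (2 * fA p)" for p
  define \<rho> where "\<rho> p = - (c * B p / (b * w p))" for p
  have fAsub: "fA ` P \<subseteq> {1<..}" using rng(3) by auto
  have cg: "continuous_on P (\<lambda>p. g (fA p))" "continuous_on P (\<lambda>p. g' (fA p))"
    by (intro continuous_on_compose2[OF g_cont cf(1) fAsub] continuous_on_compose2[OF g'_cont cf(1) fAsub])+
  have fA0: "\<forall>p\<in>P. fA p \<noteq> 0" using rng(3) by force
  have fk: "0 \<le> fk p" if "p \<in> P" for p
    unfolding fk_def using gp[OF that] V[OF that] rng(3)[OF that] a b c by simp
  have fl: "1 \<le> fl p" if "p \<in> P" for p
  proof -
    have "0 \<le> 1 / (fA p)\<^sup>2 - f1 p" using invA[OF that] rng(4)[OF that] xb(2) by linarith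
    then have "0 \<le> c * g (fA p) * (1 / (fA p)\<^sup>2 - f1 p)" using gp[OF that] c by (intro mult_nonneg_nonneg) auto
    then show ?thesis unfolding fl_def by simp
  qed
  have fm: "0 < fm p" "fm p \<le> 2 * g' (fA p)" if "p \<in> P" for p
  proof -
    have "g' am \<le> g' (fA p)" using rng(1,2)[OF that] by (intro am) auto
    then show "0 < fm p" "fm p \<le> 2 * g' (fA p)"
      using rng(5)[OF that] gm unfolding fm_def xb_def by linarith+
  qed
  have cubic0: "fk p * B p ^ 3 + fl p * B p = fm p" if "p \<in> P" for p
    unfolding B_def using fk[OF that] fl[OF that] by (intro \<beta>) auto
  have B: "0 < B p" "B p \<le> fm p" if p: "p \<in> P" for p
  proof -
    have "B p * (fk p * (B p)\<^sup>2 + fl p) = fm p"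
      using cubic0[OF p] by (simp add: algebra_simps power2_eq_square power3_eq_cube)
    moreover have "1 \<le> fk p * (B p)\<^sup>2 + fl p" using fk[OF p] fl[OF p] by (simp add: add_increasing)
    ultimately show "0 < B p" using fm(1)[OF p] by (metis less_le_trans zero_less_mult_pos2 zero_less_one)
    then show "B p \<le> fm p"
      using \<open>B p * _ = fm p\<close> \<open>1 \<le> _\<close> by (metis mult_left_mono mult_1_right less_imp_le)
  qed
  have w2: "1/8 \<le> 1 / (fA p)\<^sup>2 + a * ((fA p)\<^sup>2 - 1) * (B p)\<^sup>2 / (2 * fA p * b) - f1 p" if p: "p \<in> P" for p
  proof -
    have "0 \<le> a * ((fA p)\<^sup>2 - 1) * (B p)\<^sup>2 / (2 * fA p * b)"
      using a b V[OF p] rng(3)[OF p] by simp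
    then show ?thesis using invA[OF p] rng(4)[OF p] xb(2) by linarith
  qed
  have freq: "(w p)\<^sup>2 = 1 / (fA p)\<^sup>2 + a * ((fA p)\<^sup>2 - 1) * (B p)\<^sup>2 / (2 * fA p * b) - f1 p" if p: "p \<in> P" for p
    unfolding w_def by (rule real_sqrt_pow2) (use w2[OF p] in linarith)
  have w3: "1/3 < w p" if p: "p \<in> P" for p
  proof -
    have "(1/3)\<^sup>2 < (1/8::real)" by (simp add: power2_eq_square)
    then have "(1/3)\<^sup>2 < (w p)\<^sup>2" unfolding freq[OF p] using w2[OF p] by linarith
    moreover have "0 \<le> w p" unfolding w_def by (rule real_sqrt_ge_zero) (use w2[OF p] in linarith)
    ultimately show ?thesis by (rule power_less_imp_less_base)
  qed
  then have w0: "0 < w p" if "p \<in> P" for p using that by fastforce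
  have cubic: "B p * (1 + c * g (fA p) * (w p)\<^sup>2) = g' (fA p) + f2 p" if p: "p \<in> P" for p
    unfolding freq[OF p] using cubic0[OF p] rng(3)[OF p] b unfolding fk_def fl_def fm_def
    by (simp add: algebra_simps power2_eq_square power3_eq_cube)
  have k0: "0 < k p" if p: "p \<in> P" for p
    unfolding k_def by (intro divide_pos_pos mult_pos_pos zero_less_power) (use B(1)[OF p] a V[OF p] rng(3)[OF p] in auto)
  have cB: "continuous_on P B" unfolding B_def
  proof (rule \<beta>_cont)
    show "continuous_on P fk" "continuous_on P fl" "continuous_on P fm"
      unfolding fk_def fl_def fm_def using fA0 b by (auto intro!: continuous_intros cg cf)
    show "0 \<le> fk p \<and> 0 < fl p" if "p \<in> P" for p using fk[OF that] fl[OF that] by linarith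
  qed
  have cw: "continuous_on P w" unfolding w_def using fA0 b by (auto intro!: continuous_intros cf cB)
  have ck: "continuous_on P k" unfolding k_def using fA0 by (auto intro!: continuous_intros cf cB)
  have wne: "\<forall>p\<in>P. w p \<noteq> 0" using w0 by force
  have c\<rho>: "continuous_on P \<rho>" unfolding \<rho>_def using wne b by (auto intro!: continuous_intros cB cw)
  have lin: "profile_field (fA p) (w p) (k p) (f3 p) 0 y0 y1 y2 = \<rho> p * (y2 + y0) - y1 - (1 / (w p)\<^sup>2 * f1 p) * y1
     + (1 / (b * g (fA p) * w p ^ 3) * f2 p) * y0 - 1 / (b * w p ^ 3) * f3 p" if p: "p \<in> P" for p y0 y1 y2
    unfolding \<rho>_def using profile_field_linear[OF rng(3)[OF p] w0[OF p] cubic[OF p] freq[OF p] k_def] .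
  have loA: "0 \<le> fe p \<and> lo + 2 * fe p \<le> fA p" if "p \<in> P" for p
    using rng(1,7,8)[OF that] unfolding lo_def e0_def by (auto simp: field_simps)
  let ?I = "{0..2*pi}"

  \<comment> \<open>The flow over one period\<close>
  obtain Y where Yc: "continuous_on (P \<times> ?I) (\<lambda>z. Y (fst z) (snd z))"
    and Y0: "\<And>p. p \<in> P \<Longrightarrow> Y p 0 = (1, 0, -1)"
    and D0: "\<And>p t. p \<in> P \<Longrightarrow> t \<in> ?I \<Longrightarrow> ((\<lambda>t. fst (Y p t)) has_real_derivative clamp2 (fst (snd (Y p t)))) (at t within ?I)"
    and D1: "\<And>p t. p \<in> P \<Longrightarrow> t \<in> ?I \<Longrightarrow> ((\<lambda>t. fst (snd (Y p t))) has_real_derivative clamp2 (snd (snd (Y p t)))) (at t within ?I)"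
    and D2: "\<And>p t. p \<in> P \<Longrightarrow> t \<in> ?I \<Longrightarrow> ((\<lambda>t. snd (snd (Y p t))) has_real_derivative
        profile_field (fA p) (w p) (k p) (f3 p) (fe p) (clamp2 (fst (Y p t))) (clamp2 (fst (snd (Y p t)))) (clamp2 (snd (snd (Y p t))))) (at t within ?I)"
    and Ycos: "\<And>p t. p \<in> P \<Longrightarrow> t \<in> ?I \<Longrightarrow> (\<And>t. profile_field (fA p) (w p) (k p) (f3 p) (fe p) (cos t) (- sin t) (- cos t) = sin t) \<Longrightarrow>
        Y p t = (cos t, - sin t, - cos t)"
    by (rule profile_flow[OF cP cf(1) cw ck cf(4) cf(5) lo loA w0]) blast+
  define y0 where "y0 p t = fst (Y p t)" for p t
  define y1 where "y1 p t = fst (snd (Y p t))" for p t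
  define y2 where "y2 p t = snd (snd (Y p t))" for p t
  have init: "y0 p 0 = 1" "y1 p 0 = 0" "y2 p 0 = -1" if "p \<in> P" for p
    using Y0[OF that] by (auto simp: y0_def y1_def y2_def)
  have cend: "continuous_on P (\<lambda>p. Y p (2*pi))"
  proof -
    have "continuous_on P (\<lambda>p. Y (fst (p, 2*pi)) (snd (p, 2*pi)))"
      by (rule continuous_on_compose2[OF Yc]) (auto intro!: continuous_intros)
    then show ?thesis by simp
  qed
  have cends: "continuous_on P (\<lambda>p. y0 p (2*pi))" "continuous_on P (\<lambda>p. y1 p (2*pi))" "continuous_on P (\<lambda>p. y2 p (2*pi))"
    unfolding y0_def y1_def y2_def by (intro continuous_intros cend)+

  \<comment> \<open>Size of the final parameter box\<close>
  define m1 where "m1 p = 1 / (w p)\<^sup>2" for p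
  define m2 where "m2 p = 1 / (b * g (fA p) * w p ^ 3)" for p
  define m3 where "m3 p = 1 / (b * w p ^ 3)" for p
  have Pne: "P \<noteq> {}" using A1 xb e0 by (auto simp: P_def Q_def)
  have bnds: "\<exists>l u. 0 < l \<and> (\<forall>p\<in>P. l \<le> f p \<and> f p \<le> u)"
    if cfp: "continuous_on P f" and fpos: "\<And>p. p \<in> P \<Longrightarrow> 0 < f p" for f :: "_ \<Rightarrow> real"
  proof -
    obtain p where "p \<in> P" "\<forall>q\<in>P. f p \<le> f q" using continuous_attains_inf[OF cP Pne cfp] by blast
    moreover obtain q where "\<forall>p\<in>P. f p \<le> f q" using continuous_attains_sup[OF cP Pne cfp] by blast
    ultimately show ?thesis using fpos by blast
  qed
  have gne: "\<forall>p\<in>P. g (fA p) \<noteq> 0" using gp by force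
  have cm: "continuous_on P m1" "continuous_on P m2" "continuous_on P m3"
    unfolding m1_def m2_def m3_def using wne gne b by (auto intro!: continuous_intros cw cg)
  have mpos: "0 < m1 p" "0 < m2 p" "0 < m3 p" if "p \<in> P" for p
    unfolding m1_def m2_def m3_def using w0[OF that] gp[OF that] b by auto
  obtain l1 u1 where lu1: "0 < l1" "\<And>p. p \<in> P \<Longrightarrow> l1 \<le> m1 p \<and> m1 p \<le> u1" using bnds[OF cm(1) mpos(1)] by blast
  obtain l2 u2 where lu2: "0 < l2" "\<And>p. p \<in> P \<Longrightarrow> l2 \<le> m2 p \<and> m2 p \<le> u2" using bnds[OF cm(2) mpos(2)] by blast
  obtain l3 u3 where lu3: "0 < l3" "\<And>p. p \<in> P \<Longrightarrow> l3 \<le> m3 p \<and> m3 p \<le> u3" using bnds[OF cm(3) mpos(3)] by blast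
  define m where "m = min l1 (min l2 l3)"
  define N where "N = max m (max u1 u2)"
  have m: "0 < m" "m \<le> N" using lu1 lu2 lu3 by (auto simp: m_def N_def)
  have mN: "m \<le> m1 p" "m \<le> m2 p" "m \<le> m3 p" "m1 p \<le> N" "m2 p \<le> N" if "p \<in> P" for p
    using lu1(2)[OF that] lu2(2)[OF that] lu3(2)[OF that] by (auto simp: m_def N_def)
  \<comment> \<open>With this closeness to the cosine the error
    \<open>2 * pi * d * (2 * N * \<eta>)\<close> of a defect is half of
    \<open>pi * m * \<eta>\<close>, which bounds from below the main term on a face.\<close>
  define d where "d = m / (8 * N)"
  have N0: "0 < N" using m by linarith
  have d: "0 < d" "d \<le> 1/8" "d * (8 * N) = m" using m N0 by (auto simp: d_def field_simps)
  have "compact (P \<times> ?I)" using cP by (intro compact_Times) simp_all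
  then have "uniformly_continuous_on (P \<times> ?I) (\<lambda>z. Y (fst z) (snd z))" by (rule compact_uniformly_continuous[OF Yc])
  then obtain \<delta> where \<delta>: "0 < \<delta>" "\<And>z z'. z \<in> P \<times> ?I \<Longrightarrow> z' \<in> P \<times> ?I \<Longrightarrow> dist z' z < \<delta> \<Longrightarrow>
      dist (Y (fst z') (snd z')) (Y (fst z) (snd z)) < d"
    using d(1) unfolding uniformly_continuous_on_def by meson
  \<comment> \<open>The third detuning gets a longer interval. On its faces it contributes at least
    \<open>m * \<kappa> * \<eta> = 5 * N * \<eta>\<close> to the forcing, against at most
    \<open>4 * N * \<eta>\<close> from the other two detunings.\<close>
  define \<kappa> where "\<kappa> = 5 * N / m"
  have \<kappa>: "1 \<le> \<kappa>" "\<kappa> * m = 5 * N" using m by (auto simp: \<kappa>_def field_simps)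
  \<comment> \<open>Three detunings and the amplitude \<open>e\<close>, each at most
    \<open>\<delta> / 8\<close>, keep the distance to the cosine parameters below \<delta>.\<close>
  define \<eta> where "\<eta> = min xb (\<delta> / 8) / \<kappa>"
  have \<eta>: "0 < \<eta>" "\<eta> \<le> \<kappa> * \<eta>" "\<kappa> * \<eta> \<le> xb" "\<kappa> * \<eta> \<le> \<delta> / 8"
  proof -
    have eq: "\<kappa> * \<eta> = min xb (\<delta> / 8)" using \<kappa>(1) by (simp add: \<eta>_def)
    show "0 < \<eta>" using \<kappa>(1) xb(1) \<delta>(1) by (simp add: \<eta>_def)
    then show "\<eta> \<le> \<kappa> * \<eta>" using mult_right_mono[OF \<kappa>(1), of \<eta>] by simp
    show "\<kappa> * \<eta> \<le> xb" "\<kappa> * \<eta> \<le> \<delta> / 8" unfolding eq by simp_all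
  qed
  define e1 where "e1 = min e0 (\<delta> / 8)"
  have e1: "0 < e1" "e1 \<le> e0" "e1 \<le> \<delta> / 8" using e0 \<delta> by (auto simp: e1_def)
  define S where "S = {A1..2} \<times> {-\<eta>..\<eta>} \<times> {-\<eta>..\<eta>} \<times> {-(\<kappa>*\<eta>)..\<kappa>*\<eta>}"
  have "\<eta> \<le> xb" using \<eta> by linarith
  then have SP: "S \<times> {0..e1} \<subseteq> P" using \<eta>(3) e1 by (auto simp: S_def P_def Q_def)
  have Srng: "\<bar>f1 p\<bar> \<le> \<eta>" "\<bar>f2 p\<bar> \<le> \<eta>" "\<bar>f3 p\<bar> \<le> \<kappa> * \<eta>" "\<bar>fe p\<bar> \<le> e1" if "p \<in> S \<times> {0..e1}" for p
    using that by (auto simp: S_def f1_def f2_def f3_def fe_def abs_le_iff)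
  \<comment> \<open>The comparison parameter \<open>q\<close> has the same \<open>A\<close>, zero
    detunings and zero amplitude. Its flow is exactly the cosine, so uniform continuity of the flow
    gives the estimate for all \<open>A\<close> at once.\<close>
  have near: "norm (Y p t - (cos t, - sin t, - cos t)) < d" if p: "p \<in> S \<times> {0..e1}" and t: "t \<in> ?I" for p t
  proof -
    define q where "q = ((fA p, 0::real, 0::real, 0::real), 0::real)"
    have pP: "p \<in> P" using p SP by blast
    have q: "q \<in> P" using rng[OF pP] xb e0 by (auto simp: q_def P_def Q_def)
    have q0: "fA q = fA p" "f1 q = 0" "f2 q = 0" "f3 q = 0" "fe q = 0"
      by (simp_all add: q_def fA_def f1_def f2_def f3_def fe_def)
    have "Y q t = (cos t, - sin t, - cos t)"
    proof (rule Ycos[OF q t])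
      show "profile_field (fA q) (w q) (k q) (f3 q) (fe q) (cos t) (- sin t) (- cos t) = sin t" for t
        using lin[OF q, of "cos t" "- sin t" "- cos t"] by (simp add: q0)
    qed
    moreover have "dist (p, t) (q, t) < \<delta>"
    proof -
      have "p - q = ((0, f1 p, f2 p, f3 p), fe p)"
        by (cases p) (auto simp: q_def fA_def f1_def f2_def f3_def fe_def)
      then have "norm (p - q) \<le> norm (0::real, f1 p, f2 p, f3 p) + \<bar>fe p\<bar>"
        using norm_Pair_le[of "(0::real, f1 p, f2 p, f3 p)" "fe p"] by simp
      also have "norm (0::real, f1 p, f2 p, f3 p) \<le> \<bar>f1 p\<bar> + (\<bar>f2 p\<bar> + \<bar>f3 p\<bar>)"
        using norm_Pair_le[of "0::real" "(f1 p, f2 p, f3 p)"] norm_Pair_le[of "f1 p" "(f2 p, f3 p)"] norm_Pair_le[of "f2 p" "f3 p"]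
        by simp
      finally have "norm (p - q) \<le> \<bar>f1 p\<bar> + (\<bar>f2 p\<bar> + \<bar>f3 p\<bar>) + \<bar>fe p\<bar>" by simp
      also have "\<dots> \<le> \<delta> / 2" using Srng[OF p] \<eta> e1 by linarith
      also have "\<dots> < \<delta>" using \<delta>(1) by simp
      finally show ?thesis by (simp add: dist_Pair_Pair dist_norm)
    qed
    ultimately show ?thesis
      using \<delta>(2)[of "(q, t)" "(p, t)"] pP q t by (simp add: dist_norm)
  qed
  have near': "\<bar>y0 p t - cos t\<bar> \<le> d" "\<bar>y1 p t + sin t\<bar> \<le> d" "\<bar>y2 p t + cos t\<bar> \<le> d"
    if "p \<in> S \<times> {0..e1}" "t \<in> ?I" for p t
  proof -
    let ?u = "y0 p t - cos t" and ?v = "(y1 p t + sin t, y2 p t + cos t)"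
    have "Y p t - (cos t, - sin t, - cos t) = (?u, ?v)"
      by (cases "Y p t") (simp add: y0_def y1_def y2_def)
    then have "norm (?u, ?v) < d" using near[OF that] by simp
    then show "\<bar>y0 p t - cos t\<bar> \<le> d" "\<bar>y1 p t + sin t\<bar> \<le> d" "\<bar>y2 p t + cos t\<bar> \<le> d"
      using norm_fst_le[of ?u ?v] norm_snd_le[of ?v ?u] norm_fst_le[of "fst ?v" "snd ?v"] norm_snd_le[of "snd ?v" "fst ?v"]
      by (simp_all only: fst_conv snd_conv real_norm_def)
  qed
  \<comment> \<open>Within \<open>1/8\<close> of the cosine all components lie in
    \<open>[-2, 2]\<close>, where \<open>clamp2\<close> is the identity. From here on the solutions
    satisfy the equation without truncation.\<close>
  have le2: "\<bar>y0 p t\<bar> \<le> 2" "\<bar>y1 p t\<bar> \<le> 2" "\<bar>y2 p t\<bar> \<le> 2" if "p \<in> S \<times> {0..e1}" "t \<in> ?I" for p t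
    using near'[OF that] d(2) abs_cos_le_one[of t] abs_sin_le_one[of t] by linarith+
  have E0: "(y0 p has_real_derivative y1 p t) (at t within ?I)" if "p \<in> S \<times> {0..e1}" "t \<in> ?I" for p t
    using D0[of p t] le2[OF that] SP that unfolding y0_def y1_def by (auto simp: clamp2_id)
  have E1: "(y1 p has_real_derivative y2 p t) (at t within ?I)" if "p \<in> S \<times> {0..e1}" "t \<in> ?I" for p t
    using D1[of p t] le2[OF that] SP that unfolding y1_def y2_def by (auto simp: clamp2_id)
  have E2: "(y2 p has_real_derivative profile_field (fA p) (w p) (k p) (f3 p) (fe p) (y0 p t) (y1 p t) (y2 p t)) (at t within ?I)"
    if "p \<in> S \<times> {0..e1}" "t \<in> ?I" for p t
  proof -
    have "((\<lambda>t. snd (snd (Y p t))) has_real_derivative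
        profile_field (fA p) (w p) (k p) (f3 p) (fe p) (clamp2 (y0 p t)) (clamp2 (y1 p t)) (clamp2 (y2 p t))) (at t within ?I)"
      using D2[of p t] SP that unfolding y0_def y1_def y2_def by blast
    then show ?thesis unfolding clamp2_id[OF le2(1)[OF that]] clamp2_id[OF le2(2)[OF that]] clamp2_id[OF le2(3)[OF that]]
      by (simp add: y2_def[abs_def])
  qed
  \<comment> \<open>\<open>F1\<close> measures the excess mass. \<open>F2\<close> and
    \<open>F3\<close> are the boundary terms of the pairings with \<open>sin\<close> and
    \<open>cos\<close>, so they follow \<open>f1\<close> and \<open>f2\<close>. The sign in
    \<open>F4\<close> makes it increase with \<open>f3\<close>, which enters the forcing
    negatively.\<close>
  define F1 where "F1 p = integral ?I (\<lambda>t. (fA p + fe p * y0 p t)\<^sup>2 - 1) - \<mu> * w p" for p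
  define F2 where "F2 p = - y1 p (2*pi) + \<rho> p * (y0 p (2*pi) - 1)" for p
  define F3 where "F3 p = y2 p (2*pi) + 1 - \<rho> p * y1 p (2*pi)" for p
  define F4 where "F4 p = - (y2 p (2*pi) + y0 p (2*pi))" for p
  have cy0: "continuous_on (P \<times> ?I) (\<lambda>z. y0 (fst z) (snd z))" unfolding y0_def by (intro continuous_intros Yc)
  have cfst: "continuous_on (P \<times> ?I) (\<lambda>z. fA (fst z))" "continuous_on (P \<times> ?I) (\<lambda>z. fe (fst z))"
    by (auto intro!: continuous_on_compose2[OF cf(1)[of P]] continuous_on_compose2[OF cf(5)[of P]] continuous_intros)
  have "continuous_on (P \<times> cbox 0 (2*pi)) (\<lambda>(p, t). (fA p + fe p * y0 p t)\<^sup>2 - 1)"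
    unfolding split_beta using cy0 cfst by (auto intro!: continuous_intros)
  then have "continuous_on P (\<lambda>p. integral (cbox 0 (2*pi)) (\<lambda>t. (fA p + fe p * y0 p t)\<^sup>2 - 1))"
    by (rule integral_continuous_on_param)
  then have "continuous_on P F1" unfolding F1_def by (auto intro!: continuous_intros cw)
  moreover have "continuous_on P F2" "continuous_on P F3" "continuous_on P F4"
    unfolding F2_def F3_def F4_def by (intro continuous_intros c\<rho> cends)+
  ultimately have cF: "continuous_on (S \<times> {0..e1}) F1" "continuous_on (S \<times> {0..e1}) F2"
      "continuous_on (S \<times> {0..e1}) F3" "continuous_on (S \<times> {0..e1}) F4"
    using SP continuous_on_subset by blast+

  \<comment> \<open>Signs on the faces in the limit of zero amplitude\<close>
  have z0: "(z, 0) \<in> S \<times> {0..e1}" "(z, 0) \<in> P" if "z \<in> S" for z using that e1 SP by auto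
  have F1z: "F1 (z, 0) = 2 * pi * ((fst z)\<^sup>2 - 1) - \<mu> * w (z, 0)" for z
    by (simp add: F1_def fA_def fe_def)
  have ends: "\<bar>F3 p - pi * (m2 p * f2 p)\<bar> \<le> 2 * pi * (d * (\<bar>m1 p * f1 p\<bar> + \<bar>m2 p * f2 p\<bar>))"
    "\<bar>F2 p - pi * (m1 p * f1 p)\<bar> \<le> 2 * pi * (d * (\<bar>m1 p * f1 p\<bar> + \<bar>m2 p * f2 p\<bar>))"
    "(\<And>t. t \<in> ?I \<Longrightarrow> - (m1 p * f1 p) * y1 p t + (m2 p * f2 p) * y0 p t - m3 p * f3 p < 0) \<Longrightarrow> 0 < F4 p"
    "(\<And>t. t \<in> ?I \<Longrightarrow> 0 < - (m1 p * f1 p) * y1 p t + (m2 p * f2 p) * y0 p t - m3 p * f3 p) \<Longrightarrow> F4 p < 0"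
    if p: "p \<in> S \<times> {0..e1}" and e: "fe p = 0" for p
  proof -
    have pP: "p \<in> P" using p SP by blast
    have E2': "(y2 p has_real_derivative \<rho> p * (y2 p t + y0 p t) - y1 p t - (m1 p * f1 p) * y1 p t
        + (m2 p * f2 p) * y0 p t - m3 p * f3 p) (at t within ?I)" if "t \<in> ?I" for t
      using E2[OF p that] unfolding e lin[OF pP] m1_def m2_def m3_def .
    show "\<bar>F3 p - pi * (m2 p * f2 p)\<bar> \<le> 2 * pi * (d * (\<bar>m1 p * f1 p\<bar> + \<bar>m2 p * f2 p\<bar>))"
      unfolding F3_def
      by (rule near_cosine_defects(1)[OF E0[OF p] E1[OF p] E2' init(1)[OF pP] init(2)[OF pP] init(3)[OF pP]])
         (use near'[OF p] in auto)
    show "\<bar>F2 p - pi * (m1 p * f1 p)\<bar> \<le> 2 * pi * (d * (\<bar>m1 p * f1 p\<bar> + \<bar>m2 p * f2 p\<bar>))"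
      unfolding F2_def
      by (rule near_cosine_defects(2)[OF E0[OF p] E1[OF p] E2' init(1)[OF pP] init(2)[OF pP] init(3)[OF pP]])
         (use near'[OF p] in auto)
    show "0 < F4 p" if neg: "\<And>t. t \<in> ?I \<Longrightarrow> - (m1 p * f1 p) * y1 p t + (m2 p * f2 p) * y0 p t - m3 p * f3 p < 0"
    proof -
      have "y2 p (2*pi) + y0 p (2*pi) < 0"
        by (rule near_cosine_defects(3)[OF E0[OF p] E1[OF p] E2' init(1)[OF pP] init(2)[OF pP] init(3)[OF pP] _ neg])
           (use near'[OF p] in auto)
      then show ?thesis by (simp add: F4_def)
    qed
    show "F4 p < 0" if pos: "\<And>t. t \<in> ?I \<Longrightarrow> 0 < - (m1 p * f1 p) * y1 p t + (m2 p * f2 p) * y0 p t - m3 p * f3 p"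
    proof -
      have "0 < y2 p (2*pi) + y0 p (2*pi)"
        by (rule near_cosine_defects(4)[OF E0[OF p] E1[OF p] E2' init(1)[OF pP] init(2)[OF pP] init(3)[OF pP] _ pos])
           (use near'[OF p] in auto)
      then show ?thesis by (simp add: F4_def)
    qed
  qed
  have Nb: "\<bar>m1 p * f1 p\<bar> \<le> N * \<eta>" "\<bar>m2 p * f2 p\<bar> \<le> N * \<eta>" if p: "p \<in> S \<times> {0..e1}" for p
  proof -
    have pP: "p \<in> P" using p SP by blast
    show "\<bar>m1 p * f1 p\<bar> \<le> N * \<eta>" "\<bar>m2 p * f2 p\<bar> \<le> N * \<eta>"
      unfolding abs_mult using mN[OF pP] mpos[OF pP] Srng[OF p] m N0 by (auto intro!: mult_mono)
  qed
  have err: "2 * pi * (d * (\<bar>m1 p * f1 p\<bar> + \<bar>m2 p * f2 p\<bar>)) < pi * (m * \<eta>)" if p: "p \<in> S \<times> {0..e1}" for p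
  proof -
    have "2 * pi * (d * (\<bar>m1 p * f1 p\<bar> + \<bar>m2 p * f2 p\<bar>)) \<le> 2 * pi * (d * (N * \<eta> + N * \<eta>))"
      using Nb[OF p] d(1) by (intro mult_left_mono add_mono) auto
    also have "\<dots> = pi * (m * \<eta>) / 2" unfolding d(3)[symmetric] by simp
    also have "\<dots> < pi * (m * \<eta>)" using m \<eta> by simp
    finally show ?thesis .
  qed
  have lowm: "m * \<eta> \<le> m1 p * \<eta>" "m * \<eta> \<le> m2 p * \<eta>" if "p \<in> P" for p
    using mN[OF that] \<eta>(1) by (auto intro!: mult_right_mono)
  have lowpi: "pi * (m * \<eta>) \<le> pi * (m1 p * \<eta>)" "pi * (m * \<eta>) \<le> pi * (m2 p * \<eta>)" if "p \<in> P" for p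
    using lowm[OF that] by (auto intro!: mult_left_mono)
  have small: "\<bar>- (m1 p * f1 p) * y1 p t + (m2 p * f2 p) * y0 p t\<bar> \<le> 4 * (N * \<eta>)"
    if p: "p \<in> S \<times> {0..e1}" and t: "t \<in> ?I" for p t
  proof -
    have "\<bar>- (m1 p * f1 p) * y1 p t + (m2 p * f2 p) * y0 p t\<bar> \<le> \<bar>m1 p * f1 p\<bar> * \<bar>y1 p t\<bar> + \<bar>m2 p * f2 p\<bar> * \<bar>y0 p t\<bar>"
      by (metis abs_minus_cancel abs_mult abs_triangle_ineq)
    also have "\<dots> \<le> (N * \<eta>) * 2 + (N * \<eta>) * 2"
      using Nb[OF p] le2[OF p t] N0 \<eta>(1) by (intro add_mono mult_mono) auto
    finally show ?thesis by simp
  qed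
  have big: "5 * (N * \<eta>) \<le> m3 p * (\<kappa> * \<eta>)" if "p \<in> P" for p
  proof -
    have "5 * (N * \<eta>) = m * (\<kappa> * \<eta>)" using \<kappa>(2) by (metis mult.assoc mult.commute)
    also have "\<dots> \<le> m3 p * (\<kappa> * \<eta>)" using mN[OF that] \<kappa> \<eta> by (intro mult_right_mono) auto
    finally show ?thesis .
  qed
  have N\<eta>: "0 < N * \<eta>" using N0 \<eta> by simp
  have "\<exists>e\<in>{0<..e1}. \<exists>z\<in>S. F1 (z, e) = 0 \<and> F2 (z, e) = 0 \<and> F3 (z, e) = 0 \<and> F4 (z, e) = 0"
    unfolding S_def
  proof (rule poincare_miranda_4_perturbed[OF _ _ _ _ e1(1)]; (fold S_def)?)
    show "A1 \<le> 2" "- \<eta> \<le> \<eta>" "- \<eta> \<le> \<eta>" "- (\<kappa> * \<eta>) \<le> \<kappa> * \<eta>" using A1 \<eta> by auto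
    fix z assume z: "z \<in> S"
    note p = z0(1)[OF z] and pP = z0(2)[OF z]
    have e: "fe (z, 0) = 0" by (simp add: fe_def)
    note en = ends[OF p e] and er = err[OF p] and lp = lowpi[OF pP] and sm = small[OF p] and bg = big[OF pP]
    show "F1 (z, 0) < 0" if "fst z = A1"
    proof -
      have "\<mu> / 3 \<le> \<mu> * w (z, 0)" using w3[OF pP] \<mu>(1) by (simp add: field_simps)
      then show ?thesis unfolding F1z that using A1m by linarith
    qed
    show "0 < F1 (z, 0)" if f: "fst z = 2"
    proof -
      have fA2: "fA (z, 0) = 2" using f by (simp add: fA_def)
      have "(B (z, 0))\<^sup>2 \<le> (2 * g' 2)\<^sup>2"
        using B[OF pP] fm(2)[OF pP] unfolding fA2 by (intro power_mono) linarith+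
      then have "a * 3 * (B (z, 0))\<^sup>2 / (4 * b) \<le> a * 3 * (2 * g' 2)\<^sup>2 / (4 * b)"
        using a b by (intro divide_right_mono mult_left_mono) auto
      moreover have "- f1 (z, 0) \<le> 1/8" using rng(4)[OF pP] xb by linarith
      ultimately have "(w (z, 0))\<^sup>2 \<le> W" unfolding freq[OF pP] fA2 W_def by simp
      then have "w (z, 0) \<le> sqrt W" by (rule real_le_rsqrt)
      then have "\<mu> * w (z, 0) \<le> \<mu> * sqrt W" using \<mu>(1) by simp
      then show ?thesis unfolding F1z f using \<mu>(2) by simp
    qed
    show "F2 (z, 0) < 0" if "fst (snd z) = - \<eta>"
    proof -
      have "f1 (z, 0) = - \<eta>" using that by (simp add: f1_def)
      then have "pi * (m1 (z, 0) * f1 (z, 0)) = - (pi * (m1 (z, 0) * \<eta>))" by simp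
      then show ?thesis using en(2) er lp(1) by linarith
    qed
    show "0 < F2 (z, 0)" if "fst (snd z) = \<eta>"
    proof -
      have "f1 (z, 0) = \<eta>" using that by (simp add: f1_def)
      then have "pi * (m1 (z, 0) * f1 (z, 0)) = pi * (m1 (z, 0) * \<eta>)" by simp
      then show ?thesis using en(2) er lp(1) by linarith
    qed
    show "F3 (z, 0) < 0" if "fst (snd (snd z)) = - \<eta>"
    proof -
      have "f2 (z, 0) = - \<eta>" using that by (simp add: f2_def)
      then have "pi * (m2 (z, 0) * f2 (z, 0)) = - (pi * (m2 (z, 0) * \<eta>))" by simp
      then show ?thesis using en(1) er lp(2) by linarith
    qed
    show "0 < F3 (z, 0)" if "fst (snd (snd z)) = \<eta>"
    proof -
      have "f2 (z, 0) = \<eta>" using that by (simp add: f2_def)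
      then have "pi * (m2 (z, 0) * f2 (z, 0)) = pi * (m2 (z, 0) * \<eta>)" by simp
      then show ?thesis using en(1) er lp(2) by linarith
    qed
    show "F4 (z, 0) < 0" if "snd (snd (snd z)) = - (\<kappa> * \<eta>)"
    proof (rule en(4))
      fix t assume t: "t \<in> ?I"
      have "m3 (z, 0) * f3 (z, 0) = - (m3 (z, 0) * (\<kappa> * \<eta>))" using that by (simp add: f3_def)
      then show "0 < - (m1 (z, 0) * f1 (z, 0)) * y1 (z, 0) t + (m2 (z, 0) * f2 (z, 0)) * y0 (z, 0) t - m3 (z, 0) * f3 (z, 0)"
        using sm[OF t] bg N\<eta> by linarith
    qed
    show "0 < F4 (z, 0)" if "snd (snd (snd z)) = \<kappa> * \<eta>"
    proof (rule en(3))
      fix t assume t: "t \<in> ?I"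
      have "m3 (z, 0) * f3 (z, 0) = m3 (z, 0) * (\<kappa> * \<eta>)" using that by (simp add: f3_def)
      then show "- (m1 (z, 0) * f1 (z, 0)) * y1 (z, 0) t + (m2 (z, 0) * f2 (z, 0)) * y0 (z, 0) t - m3 (z, 0) * f3 (z, 0) < 0"
        using sm[OF t] bg N\<eta> by linarith
    qed
  qed (rule cF)+

  \<comment> \<open>From the four equations to a periodic profile\<close>
  then obtain e z where ez: "e \<in> {0<..e1}" "z \<in> S" and F: "F1 (z, e) = 0" "F2 (z, e) = 0" "F3 (z, e) = 0" "F4 (z, e) = 0" by blast
  define p where "p = (z, e)"
  have p: "p \<in> S \<times> {0..e1}" and pP: "p \<in> P" using ez SP by (auto simp: p_def)
  have fe: "fe p = e" "0 < e" using ez by (auto simp: p_def fe_def)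
  note F = F[folded p_def]
  \<comment> \<open>The three boundary equations form a homogeneous linear system for the deviation
    from the initial state. Elimination leaves the factor \<open>(\<rho> p)\<^sup>2 + 1\<close>, so
    the system is regular for every real \<rho>.\<close>
  have per: "y0 p (2*pi) = 1" "y1 p (2*pi) = 0" "y2 p (2*pi) = -1"
  proof -
    define u where "u = y0 p (2*pi) - 1"
    have 1: "y1 p (2*pi) = \<rho> p * u" using F(2) by (simp add: F2_def u_def)
    have 2: "y2 p (2*pi) + 1 = \<rho> p * (\<rho> p * u)" using F(3) 1 by (simp add: F3_def)
    have "\<rho> p * (\<rho> p * u) + u = 0" using F(4) 2 by (simp add: F4_def u_def)
    then have "((\<rho> p)\<^sup>2 + 1) * u = 0" by (simp add: power2_eq_square algebra_simps)
    moreover have "(\<rho> p)\<^sup>2 + 1 \<noteq> 0" by (metis power_one sum_power2_eq_zero_iff zero_neq_one)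
    ultimately have "u = 0" by simp
    then show "y0 p (2*pi) = 1" "y1 p (2*pi) = 0" "y2 p (2*pi) = -1"
      using 1 2 by (simp_all add: u_def)
  qed
  show thesis
  proof (rule that[of n "w p" "k p" e "fA p" "y0 p" "y1 p" "y2 p" "f3 p"])
    show "1 < fA p - 2 * e" using loA[OF pP] lo fe(1) by linarith
    show "y0 p pi \<noteq> y0 p 0" using near'(1)[OF p, of pi] init(1)[OF pP] d(2) by auto
    show "integral ?I (\<lambda>t. (fA p + e * y0 p t)\<^sup>2 - 1) = M / n * w p"
      using F(1) fe(1) by (simp add: F1_def \<mu>_def)
    show "(y2 p has_real_derivative profile_field (fA p) (w p) (k p) (f3 p) e (y0 p t) (y1 p t) (y2 p t)) (at t within ?I)" if "t \<in> ?I" for t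
      using E2[OF p that] fe(1) by simp
  qed (use n0 w0[OF pP] k0[OF pP] fe(2) E0[OF p] E1[OF p] le2[OF p] per init[OF pP] in auto)
qed

end

section \<open>Travelling waves\<close>

lemma constant_travelling_wave:
  fixes a b c s h u :: real
  assumes "1 < h" "g h \<noteq> 0" "u = g h"
  shows "travelling_wave a b c g L s (\<lambda>_. h) (\<lambda>_. u)"
proof -
  have d: "deriv (\<lambda>_. v) = (\<lambda>_. 0)" for v :: real by (rule ext) simp
  have cd: "C_diff n (\<lambda>_. v)" for n and v :: real
  proof -
    have "(deriv ^^ k) (\<lambda>_. v) = (\<lambda>_. if k = 0 then v else 0)" for k
      by (induction k) (auto simp: d)
    then show ?thesis by (simp add: C_diff_def)
  qed
  have V: "film_V (\<lambda>_. h) = (\<lambda>_. h\<^sup>2 - 1)" by (auto simp: film_V_def)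
  have "curvature (\<lambda>_. h) = (\<lambda>_. slope_factor 0 * inverse h)" by (auto simp: curvature_def d)
  then show ?thesis
    using assms one_less_power[of h 2] unfolding travelling_wave_def V by (simp add: d cd)
qed

section \<open>Monotonicity of the two choices of \<open>g\<close>\<close>

lemma g_quadratic_deriv: "(g_quadratic has_real_derivative 2 * x) (at x)"
  unfolding g_quadratic_def by (auto intro!: derivative_eq_intros)

lemma film_I_deriv:
  assumes "0 < x"
  shows "(film_I has_real_derivative x ^ 3 * ln x - x * (x\<^sup>2 - 1) / 2) (at x)"
  unfolding film_I_def
  using assms by (auto intro!: derivative_eq_intros simp: field_simps power2_eq_square power3_eq_cube power4_eq_xxxx)

lemma g_log_deriv:
  assumes x: "1 < x"
  shows "(g_log has_real_derivative ((x ^ 3 * ln x - x * (x\<^sup>2 - 1) / 2) * (x\<^sup>2 - 1) - film_I x * (2 * x)) / (x\<^sup>2 - 1)\<^sup>2) (at x)"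
proof -
  have "x\<^sup>2 - 1 \<noteq> 0" using one_less_power[OF x, of 2] by simp
  moreover have "((\<lambda>x. x\<^sup>2 - 1) has_real_derivative 2 * x) (at x)" by (auto intro!: derivative_eq_intros)
  ultimately show ?thesis
    unfolding g_log_def[abs_def] power2_eq_square[of "x\<^sup>2 - 1"] using film_I_deriv[of x] x by (intro DERIV_divide) auto
qed

text \<open>With \<open>y = x\<^sup>2\<close> the numerator is \<open>x / 8\<close> times
  \<open>ln y * (2 * y\<^sup>2 - 4 * y) + (y - 1) * (3 - y)\<close>. This factor vanishes at
  \<open>y = 1\<close> and has the derivative \<open>4 * (y - 1) * ln y\<close>, which is positive
  for \<open>y > 1\<close>.\<close>

lemma g_log_deriv_pos:
  assumes x: "1 < x"
  shows "0 < ((x ^ 3 * ln x - x * (x\<^sup>2 - 1) / 2) * (x\<^sup>2 - 1) - film_I x * (2 * x)) / (x\<^sup>2 - 1)\<^sup>2"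
proof -
  let ?\<phi> = "\<lambda>y::real. ln y * (2 * y\<^sup>2 - 4 * y) + (y - 1) * (3 - y)"
  have x2: "1 < x\<^sup>2" using x by (rule one_less_power) simp
  have "\<exists>z>1. z < x\<^sup>2 \<and> ?\<phi> (x\<^sup>2) - ?\<phi> 1 = (x\<^sup>2 - 1) * (4 * (z - 1) * ln z)"
    by (rule MVT2[OF x2]) (auto intro!: derivative_eq_intros simp: field_simps power2_eq_square)
  then obtain z where z: "1 < z" "?\<phi> (x\<^sup>2) = (x\<^sup>2 - 1) * (4 * (z - 1) * ln z)" by auto
  have "0 < (x\<^sup>2 - 1) * (4 * (z - 1) * ln z)" using x2 z(1) by (intro mult_pos_pos) auto
  then have "0 < x / 8 * ?\<phi> (x\<^sup>2)" using z(2) x by simp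
  also have "x / 8 * ?\<phi> (x\<^sup>2) = (x ^ 3 * ln x - x * (x\<^sup>2 - 1) / 2) * (x\<^sup>2 - 1) - film_I x * (2 * x)"
  proof -
    have "ln (x\<^sup>2) = 2 * ln x" using x by (simp add: ln_realpow)
    then show ?thesis
      unfolding film_I_def by (simp add: field_simps power2_eq_square power3_eq_cube power4_eq_xxxx)
  qed
  finally show ?thesis using x2 by simp
qed

section \<open>Slope factor and regularity\<close>

lemma slope_factor_eq: "slope_factor z = 1 / sqrt (1 + z\<^sup>2)"
proof -
  have "slope_factor z = inverse ((1 + z\<^sup>2) powr (1/2))"
    unfolding slope_factor_def using powr_minus[of "1 + z\<^sup>2" "1/2"] by simp
  also have "(1 + z\<^sup>2) powr (1/2) = sqrt (1 + z\<^sup>2)" by (rule powr_half_sqrt) simp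
  finally show ?thesis by (simp only: inverse_eq_divide)
qed

lemma slope_factor_deriv: "(slope_factor has_real_derivative - z * slope_factor z ^ 3) (at z)"
proof -
  have p: "0 < 1 + z\<^sup>2" by (simp add: add_pos_nonneg)
  have "((\<lambda>z. 1 + z\<^sup>2) has_real_derivative 2 * z) (at z)" by (auto intro!: derivative_eq_intros)
  from DERIV_chain2[OF DERIV_real_sqrt[OF p] this]
  have "((\<lambda>z. sqrt (1 + z\<^sup>2)) has_real_derivative inverse (sqrt (1 + z\<^sup>2)) * z) (at z)" by simp
  from DERIV_inverse'[OF this]
  have "((\<lambda>z. inverse (sqrt (1 + z\<^sup>2))) has_real_derivative - z * inverse (sqrt (1 + z\<^sup>2)) ^ 3) (at z)"
    using p by (simp add: power3_eq_cube mult_ac)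
  then show ?thesis by (simp add: slope_factor_eq[abs_def] inverse_eq_divide)
qed

lemma C_diffI:
  assumes "\<And>x. (F has_real_derivative F1 x) (at x)" "\<And>x. (F1 has_real_derivative F2 x) (at x)"
  shows "continuous_on UNIV F2 \<Longrightarrow> C_diff 2 F"
    and "(\<And>x. (F2 has_real_derivative F3 x) (at x)) \<Longrightarrow> continuous_on UNIV F3 \<Longrightarrow> C_diff 3 F"
proof -
  have 1: "deriv F = F1" "deriv F1 = F2" using assms by (auto intro: DERIV_imp_deriv)
  show "continuous_on UNIV F2 \<Longrightarrow> C_diff 2 F"
    using assms 1 unfolding C_diff_def
    by (auto simp: numeral_2_eq_2 less_Suc_eq real_differentiable_def)
  assume 3: "\<And>x. (F2 has_real_derivative F3 x) (at x)" "continuous_on UNIV F3"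
  have "deriv F2 = F3" using 3 by (auto intro: DERIV_imp_deriv)
  then show "C_diff 3 F"
    using assms 1 3 unfolding C_diff_def
    by (auto simp: numeral_3_eq_3 less_Suc_eq real_differentiable_def)
qed

context film_flow
begin

text \<open>The value of \<open>H'''\<close> for \<open>(H, H', H'') = (h, p, q)\<close> forced by the momentum equation with \<open>C\<^sub>0 = -k\<close>.\<close>

definition third_deriv :: "real \<Rightarrow> real \<Rightarrow> real \<Rightarrow> real \<Rightarrow> real \<Rightarrow> real" where
  "third_deriv k s h p q = (let V = h\<^sup>2 - 1; D = 1 + p\<^sup>2 in
     - (D * p / h\<^sup>2) - p * q / h + 3 * p * q\<^sup>2 / D
     - D * sqrt D / b * (2 * k\<^sup>2 / a * (h / V ^ 3) * p + 2 * c * k / a * (h / V\<^sup>2 * q - (h\<^sup>2 + 1) / V ^ 3 * p\<^sup>2)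
         + (1 - (s - k / V) / a / g h)))"

text \<open>The chain rule gives \<open>H''' = e * w ^ 3 * y'''\<close>, so this identifies the
  rescaled field with the original one. The essential point is the factor \<open>e\<close> in
  \<open>1 - U / g(H)\<close>: the choice of \<open>s\<close> gives
  \<open>U = g A * (1 - e * r)\<close> at \<open>H = A\<close>, and both \<open>g h - g A\<close>
  and \<open>1 / VA - 1 / V\<close> contain the factor \<open>e * y0\<close>.\<close>

lemma profile_field_unscale:
  assumes e: "0 < e" and w: "0 < w" and A: "1 < A" and h: "1 < A + e * y0"
  shows "e * w ^ 3 * profile_field A w k r e y0 y1 y2
    = third_deriv k (a * g A * (1 - e * r) + k / (A\<^sup>2 - 1)) (A + e * y0) (e * w * y1) (e * w\<^sup>2 * y2)"
proof -
  define h where "h = A + e * y0"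
  define V where "V = h\<^sup>2 - 1"
  define VA where "VA = A\<^sup>2 - 1"
  define D where "D = 1 + (e * w * y1)\<^sup>2"
  define s where "s = a * g A * (1 - e * r) + k / VA"
  have pos: "0 < V" "0 < VA" "0 < D" "0 < g h" "0 < h"
    using one_less_power[OF A, of 2] one_less_power[OF h, of 2] g_pos[OF h] h
    by (auto simp: V_def VA_def D_def h_def add_pos_nonneg)
  have R: "1 - (s - k / V) / a / g h
     = e * ((y0 * gslope A (e * y0) + r * g A - (k / a) * y0 * (2 * A + e * y0) * (1 / V) * (1 / VA)) * (1 / g h))"
  proof -
    have 1: "g h = g A + e * y0 * gslope A (e * y0)" using gslope_eq[OF A h] by (simp add: h_def)
    have "V - VA = e * y0 * (2 * A + e * y0)" by (simp add: V_def VA_def h_def power2_eq_square algebra_simps)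
    then have 2: "1 / VA - 1 / V = e * y0 * (2 * A + e * y0) * (1 / V) * (1 / VA)" using pos by (simp add: field_simps)
    have "g h - (s - k / V) / a = g h - g A * (1 - e * r) - (k / a) * (1 / VA - 1 / V)"
      using a by (simp add: s_def field_simps)
    also have "\<dots> = e * (y0 * gslope A (e * y0) + r * g A - (k / a) * y0 * (2 * A + e * y0) * (1 / V) * (1 / VA))"
      unfolding 1 2 by (simp add: algebra_simps)
    finally have 3: "g h - (s - k / V) / a = e * (y0 * gslope A (e * y0) + r * g A - (k / a) * y0 * (2 * A + e * y0) * (1 / V) * (1 / VA))" .
    have "1 - X / g h = (g h - X) * (1 / g h)" for X using pos by (simp add: diff_divide_distrib)
    then show ?thesis unfolding 3[symmetric] mult.assoc[symmetric] .
  qed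
  define Z where "Z = (y0 * gslope A (e * y0) + r * g A - (k / a) * y0 * (2 * A + e * y0) * (1 / V) * (1 / VA)) * (1 / g h)"
  define X where "X = D * sqrt D * (1 / b)"
  define \<gamma> where "\<gamma> = 2 * k\<^sup>2 / a * (h / V ^ 3)"
  define \<zeta> where "\<zeta> = 2 * c * k / a"
  define m where "m = h / V\<^sup>2"
  define l where "l = (h\<^sup>2 + 1) / V ^ 3"
  have "profile_field A w k r e y0 y1 y2 = - (D * y1 * (1 / h\<^sup>2) * (1 / w\<^sup>2)) - e * y1 * y2 * (1 / h) + 3 * e\<^sup>2 * w\<^sup>2 * y1 * y2\<^sup>2 * (1 / D)
     - X * (\<gamma> * y1 * (1 / w\<^sup>2) + \<zeta> * (m * y2 - e * l * y1\<^sup>2) * (1 / w) + Z * (1 / w ^ 3))"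
    unfolding profile_field_def Let_def h_def[symmetric] V_def[symmetric] VA_def[symmetric] D_def[symmetric]
      X_def \<gamma>_def \<zeta>_def m_def l_def Z_def by simp
  then have "e * w ^ 3 * profile_field A w k r e y0 y1 y2 = e * w ^ 3 * (- (D * y1 * (1 / h\<^sup>2) * (1 / w\<^sup>2)) - e * y1 * y2 * (1 / h) + 3 * e\<^sup>2 * w\<^sup>2 * y1 * y2\<^sup>2 * (1 / D)
     - X * (\<gamma> * y1 * (1 / w\<^sup>2) + \<zeta> * (m * y2 - e * l * y1\<^sup>2) * (1 / w) + Z * (1 / w ^ 3)))" by simp
  also have "\<dots> = - (e * w * D * y1 * (1 / h\<^sup>2)) - (e * w * y1) * (e * w\<^sup>2 * y2) * (1 / h) + 3 * (e * w * y1) * (e * w\<^sup>2 * y2)\<^sup>2 * (1 / D)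
     - X * (\<gamma> * (e * w * y1) + \<zeta> * (m * (e * w\<^sup>2 * y2) - l * (e * w * y1)\<^sup>2) + e * Z)"
  proof -
    have "e * w ^ 3 * (- (D * y1 * p * (1 / w\<^sup>2)) - e * y1 * y2 * q + 3 * e\<^sup>2 * w\<^sup>2 * y1 * y2\<^sup>2 * u
      - X * (\<gamma> * y1 * (1 / w\<^sup>2) + \<zeta> * (m * y2 - e * l * y1\<^sup>2) * (1 / w) + Z * (1 / w ^ 3)))
      = - (e * w * D * y1 * p) - (e * w * y1) * (e * w\<^sup>2 * y2) * q + 3 * (e * w * y1) * (e * w\<^sup>2 * y2)\<^sup>2 * u
     - X * (\<gamma> * (e * w * y1) + \<zeta> * (m * (e * w\<^sup>2 * y2) - l * (e * w * y1)\<^sup>2) + e * Z)" for p q u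
      using w by (simp add: field_simps power2_eq_square power3_eq_cube)
    then show ?thesis .
  qed
  also have "\<dots> = third_deriv k s h (e * w * y1) (e * w\<^sup>2 * y2)"
    unfolding third_deriv_def Let_def V_def[symmetric] D_def[symmetric] R
      X_def \<gamma>_def \<zeta>_def m_def l_def Z_def by (simp add: mult_ac)
  finally show ?thesis by (simp add: s_def h_def VA_def)
qed

text \<open>\<open>U\<close> is read off from the flux relation, so \<open>U * V\<close> is affine
  in \<open>V\<close> and mass conservation follows. The derivative of the curvature contains
  \<open>H'''\<close> with the factor \<open>- f ^ 3\<close>, which never vanishes; hence the
  momentum equation can be solved for \<open>H'''\<close>, and \<open>third_deriv\<close> is the
  result.\<close>

lemma travelling_wave_from_third_order:
  fixes H H1 H2 :: "real \<Rightarrow> real"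
  assumes dH: "\<And>x. (H has_real_derivative H1 x) (at x)" and dH1: "\<And>x. (H1 has_real_derivative H2 x) (at x)"
    and dH2: "\<And>x. (H2 has_real_derivative third_deriv k s (H x) (H1 x) (H2 x)) (at x)"
    and gt1: "\<And>x. 1 < H x" and per: "\<And>x. H (x + L) = H x"
  defines "U \<equiv> \<lambda>x. (s - k / ((H x)\<^sup>2 - 1)) / a"
  shows "travelling_wave a b c g L s H U" and "- film_V H x * (s - a * U x) = - k"
proof -
  define V where "V x = (H x)\<^sup>2 - 1" for x
  have V: "0 < V x" for x using one_less_power[OF gt1[of x], of 2] by (simp add: V_def)
  have V': "V x \<noteq> 0" "H x \<noteq> 0" "g (H x) \<noteq> 0" for x using V[of x] gt1[of x] g_pos[OF gt1[of x]] by auto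
  have fV: "film_V H = V" by (auto simp: film_V_def V_def)
  show "- film_V H x * (s - a * U x) = - k"
  proof -
    have "s - a * U x = k / V x" using a by (simp add: U_def V_def)
    then show ?thesis using V'(1)[of x] by (simp add: fV)
  qed
  have cont: "continuous_on UNIV H" "continuous_on UNIV H1" "continuous_on UNIV H2"
    using DERIV_continuous_on[of UNIV H H1] DERIV_continuous_on[of UNIV H1 H2]
      DERIV_continuous_on[of UNIV H2 "\<lambda>x. third_deriv k s (H x) (H1 x) (H2 x)"] dH dH1 dH2 by auto
  have cg: "continuous_on UNIV (\<lambda>x. g (H x))"
    by (rule continuous_on_compose2[OF g_cont cont(1)]) (use gt1 in auto)
  have cV: "continuous_on UNIV V" unfolding V_def by (intro continuous_intros cont)
  define H3 where "H3 x = third_deriv k s (H x) (H1 x) (H2 x)" for x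
  have D0: "1 + (H1 x)\<^sup>2 \<noteq> 0" for x by (metis power_one sum_power2_eq_zero_iff zero_neq_one)
  have cH3: "continuous_on UNIV H3"
    unfolding H3_def third_deriv_def Let_def V_def[symmetric]
    using V' D0 a b by (intro continuous_intros cont cg cV) auto
  \<comment> \<open>In terms of \<open>iV\<close> all derivatives of \<open>U\<close> are polynomial
    expressions, and \<open>V * iV = 1\<close> is the only relation needed to simplify them.\<close>
  define iV where "iV x = inverse (V x)" for x
  have ViV: "V x * iV x = 1" for x using V'(1)[of x] by (simp add: iV_def)
  have div: "y / V x ^ n = y * iV x ^ n" "y / V x = y * iV x" for x y n
    by (simp_all add: iV_def divide_inverse power_inverse)
  define U1 where "U1 x = 2 * k / a * (H x * H1 x * (iV x)\<^sup>2)" for x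
  define U2 where "U2 x = 2 * k / a * (((H1 x)\<^sup>2 + H x * H2 x) * (iV x)\<^sup>2 - 4 * (H x)\<^sup>2 * (H1 x)\<^sup>2 * iV x ^ 3)" for x
  have dV: "(V has_real_derivative 2 * H x * H1 x) (at x)" for x
    unfolding V_def by (auto intro!: derivative_eq_intros dH)
  have diV: "(iV has_real_derivative - (2 * H x * H1 x * (iV x)\<^sup>2)) (at x)" for x
    using DERIV_inverse'[OF dV V'(1)] by (simp add: iV_def[abs_def] power2_eq_square mult_ac)
  have U: "U = (\<lambda>x. 1 / a * (s - k * iV x))"
    by (auto simp: U_def V_def[symmetric] iV_def divide_inverse)
  have dU: "(U has_real_derivative U1 x) (at x)" for x
    unfolding U by (rule derivative_eq_intros diV refl)+ (simp add: U1_def)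
  have dU1: "(U1 has_real_derivative U2 x) (at x)" for x
    unfolding U1_def[abs_def] power2_eq_square
    by (rule derivative_eq_intros diV dH dH1 refl)+
       (simp add: U2_def algebra_simps power2_eq_square power3_eq_cube)
  have ciV: "continuous_on UNIV iV" unfolding iV_def using V' by (intro continuous_intros cV) auto
  have cU2: "continuous_on UNIV U2" unfolding U2_def by (intro continuous_intros cont ciV)
  have deriv: "deriv H = H1" "deriv H1 = H2" "deriv U = U1" "deriv V = (\<lambda>x. 2 * H x * H1 x)"
    by (rule ext, rule DERIV_imp_deriv, rule dH dH1 dU dV)+
  define W1 where "W1 x = 2 * k / a * (((H1 x)\<^sup>2 + H x * H2 x) * iV x - 2 * (H x)\<^sup>2 * (H1 x)\<^sup>2 * (iV x)\<^sup>2)" for x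
  have VU1: "V x * U1 x = 2 * k / a * (H x * H1 x * iV x)" for x
  proof -
    have "V x * U1 x = 2 * k / a * (H x * H1 x * iV x) * (V x * iV x)"
      by (simp add: U1_def power2_eq_square mult_ac)
    then show ?thesis by (simp add: ViV)
  qed
  have dW: "((\<lambda>x. V x * U1 x) has_real_derivative W1 x) (at x)" for x
    unfolding VU1 by (rule derivative_eq_intros diV dH dH1 refl)+
       (simp add: W1_def algebra_simps power2_eq_square)
  define f where "f x = slope_factor (H1 x)" for x
  have df: "(f has_real_derivative - H1 x * f x ^ 3 * H2 x) (at x)" for x
    unfolding f_def using DERIV_chain2[OF slope_factor_deriv dH1] by simp
  have curv: "curvature H = (\<lambda>x. f x * inverse (H x) - f x ^ 3 * H2 x)"
    by (auto simp: curvature_def deriv f_def)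
  define K1 where "K1 x = - (f x * H1 x / (H x)\<^sup>2) - f x ^ 3 * H1 x * H2 x / H x - f x ^ 3 * H3 x + 3 * H1 x * f x ^ 5 * (H2 x)\<^sup>2" for x
  have dK: "(curvature H has_real_derivative K1 x) (at x)" for x
    unfolding curv
    by (rule derivative_eq_intros df dH dH2[folded H3_def] refl V')+
       (use V'[of x] in \<open>simp add: K1_def field_simps power2_eq_square power3_eq_cube power_numeral_reduce\<close>)
  have eq1: "- s * U1 x + a * U x * U1 x + b * K1 x = c * (W1 x / V x) + 1 - U x / g (H x)" for x
  proof -
    define D where "D = 1 + (H1 x)\<^sup>2"
    have D: "0 < D" unfolding D_def by (simp add: add_pos_nonneg)
    have f: "f x = 1 / sqrt D" by (simp add: f_def slope_factor_eq D_def)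
    have ff: "f x ^ 3 * D = f x" "f x ^ 3 * (D * sqrt D) = 1" "f x ^ 3 / D = f x ^ 5"
      unfolding f using D by (simp_all add: field_simps power_numeral_reduce)
    define E where "E = 2 * k\<^sup>2 / a * (H x / V x ^ 3) * H1 x + 2 * c * k / a * (H x / (V x)\<^sup>2 * H2 x - ((H x)\<^sup>2 + 1) / V x ^ 3 * (H1 x)\<^sup>2)
         + (1 - U x / g (H x))"
    have H3eq: "H3 x = - (D * H1 x / (H x)\<^sup>2) - H1 x * H2 x / H x + 3 * H1 x * (H2 x)\<^sup>2 / D - D * sqrt D / b * E"
      unfolding H3_def third_deriv_def Let_def V_def[symmetric] D_def[symmetric] E_def U_def ..
    have fH3: "f x ^ 3 * H3 x = - (f x ^ 3 * D * H1 x / (H x)\<^sup>2) - f x ^ 3 * H1 x * H2 x / H x + 3 * H1 x * (H2 x)\<^sup>2 * (f x ^ 3 / D)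
        - f x ^ 3 * (D * sqrt D) * (E / b)"
      unfolding H3eq by (simp add: algebra_simps)
    \<comment> \<open>The geometric terms of \<open>K1\<close> cancel against those in
      \<open>H3\<close>, which leaves the force balance.\<close>
    have KE: "b * K1 x = E"
      unfolding K1_def fH3 ff using b by (simp add: algebra_simps)
    have S: "(s - a * U x) * U1 x = 2 * k\<^sup>2 / a * (H x / V x ^ 3) * H1 x"
      unfolding div U U1_def using a by (simp add: power2_eq_square power3_eq_cube mult_ac)
    have WX: "W1 x / V x = 2 * k / a * (H x / (V x)\<^sup>2 * H2 x - ((H x)\<^sup>2 + 1) / V x ^ 3 * (H1 x)\<^sup>2)"
    proof -
      have H2: "(H x)\<^sup>2 = V x + 1" by (simp add: V_def)
      have "((H x)\<^sup>2 + 1) * iV x ^ 3 = 2 * (H x)\<^sup>2 * iV x ^ 3 - (V x * iV x) * (iV x)\<^sup>2"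
        unfolding H2 by (simp add: algebra_simps power2_eq_square power3_eq_cube)
      then have H2V: "((H x)\<^sup>2 + 1) * iV x ^ 3 = 2 * (H x)\<^sup>2 * iV x ^ 3 - (iV x)\<^sup>2" by (simp add: ViV)
      show ?thesis unfolding W1_def div H2V
        by (simp add: algebra_simps power2_eq_square power3_eq_cube)
    qed
    have "- s * U1 x + a * U x * U1 x = - ((s - a * U x) * U1 x)" by (simp add: algebra_simps)
    then show ?thesis unfolding KE S WX E_def by simp
  qed
  have UV: "((\<lambda>\<zeta>. U \<zeta> * V \<zeta>) has_real_derivative s / a * (2 * H x * H1 x)) (at x)" for x
  proof -
    have "U \<zeta> * V \<zeta> = s / a * V \<zeta> - k / a * (V \<zeta> * iV \<zeta>)" for \<zeta>
      by (simp add: U algebra_simps diff_divide_distrib)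
    then have "(\<lambda>\<zeta>. U \<zeta> * V \<zeta>) = (\<lambda>\<zeta>. s / a * V \<zeta> - k / a)" by (simp add: ViV)
    then show ?thesis using a by (auto intro!: derivative_eq_intros dV)
  qed
  show "travelling_wave a b c g L s H U"
    unfolding travelling_wave_def fV deriv
  proof (intro conjI allI ballI)
    show "C_diff 3 H" by (rule C_diffI(2)[OF dH dH1 dH2]) (use cH3 in \<open>simp add: H3_def[abs_def]\<close>)
    show "C_diff 2 U" by (rule C_diffI(1)[OF dU dU1 cU2])
    show "U (x + L) = U x" for x by (simp add: U_def per)
    show "- s * U1 x + a * U x * U1 x + b * deriv (curvature H) x = c * (deriv (\<lambda>\<zeta>. V \<zeta> * U1 \<zeta>) x / V x) + 1 - U x / g (H x)" for x
      unfolding DERIV_imp_deriv[OF dK] DERIV_imp_deriv[OF dW] by (rule eq1)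
    show "- s * (2 * H x * H1 x) + a * deriv (\<lambda>\<zeta>. U \<zeta> * V \<zeta>) x = 0" for x
      unfolding DERIV_imp_deriv[OF UV] using a by simp
  qed (use V per in auto)
qed

lemma nonconstant_travelling_wave_exists:
  assumes M: "0 < M"
  shows "\<exists>L s C\<^sub>0 :: real. \<exists>H U :: real \<Rightarrow> real.
    0 < L \<and> C\<^sub>0 \<noteq> 0 \<and>
    travelling_wave a b c g L s H U \<and>
    integral {0..L} (\<lambda>\<xi>. (H \<xi>)\<^sup>2) = M + L \<and>
    (\<forall>\<xi>\<in>{0..L}. - film_V H \<xi> * (s - a * U \<xi>) = C\<^sub>0) \<and>
    H 0 = H L \<and> H L > 1 \<and> deriv H 0 = 0 \<and> deriv H L = 0 \<and> \<not> H constant_on {0..L}"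
proof -
  let ?I = "{0..2*pi}"
  obtain n :: nat and A w k r e y0 y1 y2 where
    pos: "0 < n" "0 < w" "0 < k" "0 < e" "1 < A - 2 * e"
    and d0: "\<And>t. t \<in> ?I \<Longrightarrow> (y0 has_real_derivative y1 t) (at t within ?I)"
    and d1: "\<And>t. t \<in> ?I \<Longrightarrow> (y1 has_real_derivative y2 t) (at t within ?I)"
    and d2: "\<And>t. t \<in> ?I \<Longrightarrow> (y2 has_real_derivative profile_field A w k r e (y0 t) (y1 t) (y2 t)) (at t within ?I)"
    and le2: "\<And>t. t \<in> ?I \<Longrightarrow> \<bar>y0 t\<bar> \<le> 2"
    and per: "y0 (2*pi) = y0 0" "y1 (2*pi) = y1 0" "y2 (2*pi) = y2 0"
    and ne: "y0 pi \<noteq> y0 0" and init: "y1 0 = 0"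
    and mass: "integral ?I (\<lambda>t. (A + e * y0 t)\<^sup>2 - 1) = M / n * w"
    by (rule periodic_profile_exists[OF M]) blast
  define ext :: "(real \<Rightarrow> real) \<Rightarrow> real \<Rightarrow> real" where "ext = (\<lambda>h x. h (x - (2*pi) * of_int \<lfloor>x / (2*pi)\<rfloor>))"
  have ext_range: "x - (2*pi) * of_int \<lfloor>x / (2*pi)\<rfloor> \<in> ?I" for x :: real
  proof -
    define m :: real where "m = of_int \<lfloor>x / (2*pi)\<rfloor>"
    have "m \<le> x / (2*pi)" "x / (2*pi) < m + 1" unfolding m_def by linarith+
    then have "m * (2*pi) \<le> x" "x < (m + 1) * (2*pi)"
      by (simp_all add: pos_le_divide_eq pos_divide_less_eq)
    then show ?thesis unfolding m_def[symmetric] by (simp add: algebra_simps)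
  qed
  have ext_per: "ext h (x + 2*pi) = ext h x" for h x
  proof -
    have "(x + 2*pi) / (2*pi) = x / (2*pi) + 1" by (simp add: add_divide_distrib)
    then have "\<lfloor>(x + 2*pi) / (2*pi)\<rfloor> = \<lfloor>x / (2*pi)\<rfloor> + 1" by simp
    then show ?thesis by (simp add: ext_def algebra_simps)
  qed
  have ext_id: "ext h x = h x" if "x \<in> {0..<2*pi}" for h x
  proof -
    have "\<lfloor>x / (2*pi)\<rfloor> = 0" using that by (intro floor_unique) auto
    then show ?thesis by (simp add: ext_def)
  qed
  have extI: "ext y0 x = y0 x" if "x \<in> ?I" for x
  proof (cases "x = 2*pi")
    case True
    then show ?thesis using ext_per[of y0 0] ext_id[of 0 y0] per(1) by simp
  qed (use ext_id[of x y0] that in auto)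
  have tp: "0 < 2*pi" by simp
  have D0: "(ext y0 has_real_derivative ext y1 x) (at x)" for x
    unfolding ext_def by (rule periodic_extension_derivative[OF tp d0 per(1,2)])
  have D1: "(ext y1 has_real_derivative ext y2 x) (at x)" for x
    unfolding ext_def by (rule periodic_extension_derivative[OF tp d1 per(2,3)])
  \<comment> \<open>The field depends on time only through \<open>(y0, y1, y2)\<close>. Its values
    at the two ends of the period therefore agree, as gluing at the multiples of
    \<open>2 * pi\<close> requires.\<close>
  have D2: "(ext y2 has_real_derivative profile_field A w k r e (ext y0 x) (ext y1 x) (ext y2 x)) (at x)" for x
    using periodic_extension_derivative[OF tp d2 per(3), of x] per unfolding ext_def by simp
  have A: "1 < A" using pos by linarith
  define H where "H x = A + e * ext y0 (w * x)" for x
  define H1 where "H1 x = e * w * ext y1 (w * x)" for x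
  define H2 where "H2 x = e * w\<^sup>2 * ext y2 (w * x)" for x
  define s where "s = a * g A * (1 - e * r) + k / (A\<^sup>2 - 1)"
  define T where "T = 2 * pi / w"
  define L where "L = real n * T"
  have T: "0 < T" "w * T = 2 * pi" using pos by (auto simp: T_def)
  have L: "0 < L" "T \<le> L" using T pos(1) by (auto simp: L_def)
  have wd: "((\<lambda>x. w * x) has_real_derivative w) (at x)" for x by (auto intro!: derivative_eq_intros)
  have gt1: "1 < H x" for x
  proof -
    have "\<bar>e * ext y0 (w * x)\<bar> \<le> e * 2"
      unfolding abs_mult ext_def using le2[OF ext_range] pos(4) by (intro mult_mono) auto
    then show ?thesis unfolding H_def using pos(5) by linarith
  qed
  have dH: "(H has_real_derivative H1 x) (at x)" for x
    unfolding H_def[abs_def] H1_def using DERIV_chain2[OF D0 wd]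
    by (auto intro!: derivative_eq_intros simp: mult_ac)
  have dH1: "(H1 has_real_derivative H2 x) (at x)" for x
  proof -
    have "(H1 has_real_derivative e * w * (ext y2 (w * x) * w)) (at x)"
      unfolding H1_def[abs_def] by (rule DERIV_cmult[OF DERIV_chain2[OF D1 wd]])
    moreover have "e * w * (ext y2 (w * x) * w) = H2 x" by (simp add: H2_def power2_eq_square)
    ultimately show ?thesis by simp
  qed
  have dH2: "(H2 has_real_derivative third_deriv k s (H x) (H1 x) (H2 x)) (at x)" for x
  proof -
    have "e * w ^ 3 * profile_field A w k r e (ext y0 (w * x)) (ext y1 (w * x)) (ext y2 (w * x)) = third_deriv k s (H x) (H1 x) (H2 x)"
      unfolding H_def H1_def H2_def s_def
      by (rule profile_field_unscale[OF pos(4,2) A]) (use gt1[of x] in \<open>simp add: H_def\<close>)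
    moreover have "(H2 has_real_derivative e * w\<^sup>2 * (profile_field A w k r e (ext y0 (w * x)) (ext y1 (w * x)) (ext y2 (w * x)) * w)) (at x)"
      unfolding H2_def[abs_def] by (rule DERIV_cmult[OF DERIV_chain2[OF D2 wd]])
    ultimately show ?thesis by (simp add: power2_eq_square power3_eq_cube mult_ac)
  qed
  have wT: "w * (x + T) = w * x + 2 * pi" for x using T(2) by (simp add: distrib_left)
  have perT: "H (x + T) = H x" "H1 (x + T) = H1 x" for x
    by (simp_all add: H_def H1_def wT ext_per)
  have perL: "H (x + L) = H x \<and> H1 (x + L) = H1 x" for x
    unfolding L_def
  proof (induction n)
    case (Suc m)
    have "x + real (Suc m) * T = (x + real m * T) + T" by (simp add: algebra_simps)
    then show ?case using Suc perT by metis
  qed simp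
  define U where "U = (\<lambda>x. (s - k / ((H x)\<^sup>2 - 1)) / a)"
  have tw: "travelling_wave a b c g L s H U" and flux: "- film_V H x * (s - a * U x) = - k" for x
    unfolding U_def by (rule travelling_wave_from_third_order[OF dH dH1 dH2 gt1 conjunct1[OF perL]])+
  have cH: "continuous_on UNIV H" using DERIV_continuous_on[of UNIV H H1] dH by auto
  have "integral {0..L} (\<lambda>x. (H x)\<^sup>2) = n * integral {0..T} (\<lambda>x. (H x)\<^sup>2)"
    unfolding L_def by (rule integral_periodic_multiple[OF T(1)]) (auto intro!: continuous_intros cH simp: perT)
  also have "integral {0..T} (\<lambda>x. (H x)\<^sup>2) = M / n + T"
  proof -
    have cy: "continuous_on ?I y0" by (rule DERIV_continuous_on[OF d0])
    have "integral ?I (\<lambda>t. (A + e * y0 t)\<^sup>2) = integral ?I (\<lambda>t. ((A + e * y0 t)\<^sup>2 - 1) + 1)" by simp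
    also have "\<dots> = integral ?I (\<lambda>t. (A + e * y0 t)\<^sup>2 - 1) + integral ?I (\<lambda>t. 1)"
      by (rule integral_add) (auto intro!: integrable_continuous_real continuous_intros cy)
    finally have "integral ?I (\<lambda>t. (A + e * y0 t)\<^sup>2) = M / n * w + 2 * pi" using mass by simp
    moreover have "integral ?I (\<lambda>t. (A + e * ext y0 t)\<^sup>2) = integral ?I (\<lambda>t. (A + e * y0 t)\<^sup>2)"
      by (rule integral_cong) (simp add: extI)
    moreover have "(\<lambda>t. (A + e * ext y0 t)\<^sup>2) integrable_on ?I"
    proof -
      have "continuous_on ?I (ext y0)"
        using DERIV_continuous_on[of ?I "ext y0" "ext y1"] D0 has_field_derivative_at_within by blast
      then show ?thesis by (intro integrable_continuous_real continuous_intros)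
    qed
    ultimately have "((\<lambda>t. (A + e * ext y0 t)\<^sup>2) has_integral (M / n * w + 2 * pi)) ?I"
      by (simp add: has_integral_iff)
    from has_integral_stretch_real[OF this, of w] pos(2)
    have "((\<lambda>x. (H x)\<^sup>2) has_integral (1 / w) * (M / n * w + 2 * pi)) ((\<lambda>x. x / w) ` ?I)"
      by (simp add: H_def)
    moreover have "(\<lambda>x. x / w) ` ?I = {0..T}" using pos(2) by (simp add: T_def image_divide_atLeastAtMost)
    moreover have "(1 / w) * (M / n * w + 2 * pi) = M / n + T" using pos(2) by (simp add: T_def field_simps)
    ultimately show ?thesis by (simp add: integral_unique)
  qed
  also have "n * (M / n + T) = M + L" using pos(1) by (simp add: L_def distrib_left)
  finally have int: "integral {0..L} (\<lambda>x. (H x)\<^sup>2) = M + L" .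
  have H10: "H1 0 = 0" using ext_id[of 0 y1] init by (simp add: H1_def)
  have dHe: "deriv H x = H1 x" for x using dH by (rule DERIV_imp_deriv)
  \<comment> \<open>The witness is \<open>pi / w\<close>, half a period after 0, where
    \<open>y0\<close> differs from its initial value.\<close>
  have "\<not> H constant_on {0..L}"
  proof
    assume "H constant_on {0..L}"
    moreover have "pi / w \<le> T" "0 \<le> pi / w" using pos(2) by (auto simp: T_def divide_right_mono)
    then have "pi / w \<in> {0..L}" "0 \<in> {0..L}" using L by auto
    ultimately have "H (pi / w) = H 0" unfolding constant_on_def by metis
    then have "ext y0 pi = ext y0 0" using pos(2,4) by (simp add: H_def)
    then show False using ext_id[of pi y0] ext_id[of 0 y0] ne by simp
  qed
  moreover have "H 0 = H L" "deriv H 0 = 0" "deriv H L = 0" using perL[of 0] H10 by (simp_all add: dHe)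
  moreover have "- k \<noteq> 0" using pos(3) by simp
  ultimately show ?thesis using L(1) tw int flux gt1[of L] by blast
qed

end

lemma film_flow_g:
  assumes "0 < a" "0 < b" "0 \<le> c" "g = g_quadratic \<or> g = g_log"
  shows "\<exists>g'. film_flow a b c g g'"
proof -
  have "film_flow a b c g_quadratic (\<lambda>x. 2 * x)"
    using assms(1-3) g_regular(2)[of g_quadratic]
    by unfold_locales (auto intro!: g_quadratic_deriv continuous_intros)
  moreover have "film_flow a b c g_log (\<lambda>x. ((x ^ 3 * ln x - x * (x\<^sup>2 - 1) / 2) * (x\<^sup>2 - 1) - film_I x * (2 * x)) / (x\<^sup>2 - 1)\<^sup>2)"
  proof
    have "x\<^sup>2 - 1 \<noteq> 0" if "1 < x" for x :: real using one_less_power[OF that, of 2] by simp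
    then show "continuous_on {1<..} (\<lambda>x. ((x ^ 3 * ln x - x * (x\<^sup>2 - 1) / 2) * (x\<^sup>2 - 1) - film_I x * (2 * x)) / (x\<^sup>2 - 1)\<^sup>2)"
      unfolding film_I_def by (intro continuous_intros) auto
  qed (use assms(1-3) g_regular(2)[of g_log] g_log_deriv g_log_deriv_pos in auto)
  ultimately show ?thesis using assms(4) by blast
qed

theorem lemma4p1:
  fixes a b c M :: real and g :: "real \<Rightarrow> real"
  assumes "0 \<le> a" and "0 \<le> b" and "0 \<le> c" and "0 < M"
    and "g = g_quadratic \<or> g = g_log"
  shows "\<exists>L s C\<^sub>0 :: real. \<exists>H U :: real \<Rightarrow> real.
    0 < L \<and> C\<^sub>0 \<noteq> 0 \<and>
    travelling_wave a b c g L s H U \<and>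
    integral {0..L} (\<lambda>\<xi>. (H \<xi>)\<^sup>2) = M + L \<and>
    (\<forall>\<xi>\<in>{0..L}. - film_V H \<xi> * (s - a * U \<xi>) = C\<^sub>0) \<and>
    H 0 = H L \<and> H L > 1 \<and> deriv H 0 = 0 \<and> deriv H L = 0 \<and>
    (0 < a \<and> 0 < b \<longrightarrow> \<not> H constant_on {0..L})"
proof (cases "0 < a \<and> 0 < b")
  case True
  then obtain g' where "film_flow a b c g g'" using film_flow_g assms by blast
  then interpret film_flow a b c g g' .
  show ?thesis using nonconstant_travelling_wave_exists[OF assms(4)] by blast
next
  case False
  have "g 2 \<noteq> 0" using g_regular(2)[OF assms(5)] by (metis less_irrefl one_less_numeral_iff semiring_norm(76))
  \<comment> \<open>For the constant height 2 one has \<open>V = 3\<close>. The speed makes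
    \<open>s - a * U = 1\<close>, so the flux constant is \<open>-3\<close>, and the mass condition
    \<open>4 * L = M + L\<close> gives \<open>L = M / 3\<close>.\<close>
  then have tw: "travelling_wave a b c g (M / 3) (a * g 2 + 1) (\<lambda>_. 2) (\<lambda>_. g 2)"
    by (intro constant_travelling_wave) auto
  show ?thesis
    by (rule exI[of _ "M / 3"], rule exI[of _ "a * g 2 + 1"], rule exI[of _ "- 3"],
        rule exI[of _ "\<lambda>_. 2"], rule exI[of _ "\<lambda>_. g 2"])
       (use False assms(4) tw in \<open>auto simp: film_V_def\<close>)
qed

end
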